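(* Let $\epsilon_n\to0^+$ and let $u_n$ be solutions of $$-\epsilon_n(\phi_p(\epsilon_n u'))'+a(x)W'(u)=0\ \text{ on }[0,1],\qquad u'(0)=0=u'(1),$$ whose energies $$E_n(x)=-\frac{1}{a(x)}\mathcal L(\epsilon_n u_n'(x))+W(u_n(x)),\qquad x\in[0,1],$$ converge uniformly on $[0,1]$ to some limit $E$. Let $z_n$ be the number of zeros of $u_n$ in $[0,1]$. Then $$\lim_{n\to+\infty}\epsilon_n z_n=\int_0^1\frac{2\,a(x)^{1/p}}{T(E(x))}\,dx,$$ where the right-hand side has to be considered equal to zero when $E\equiv0$.
   Context: Fix $p>1$, $\phi_p(s)=|s|^{p-2}s$ (with $\phi_p(0)=0$), $p^*=p/(p-1)$, $\mathcal L(s)=\frac{1}{p^*}|s|^p$. The weight $a\in C^1([0,1])$ satisfies $a(x)>0$ for all $x\in[0,1]$. The potential $W:[-1,1]\to\mathbb R$ is of class $C^1$ and satisfies: (W1) there are constants $C_{-1},C_0,C_1,W_0>0$ with $W(u)=\frac{C_{\pm1}}{p}|u-(\pm1)|^p+o(|u-(\pm1)|^p)$ as $u\to\pm1$, and $W(u)=W_0-\frac{C_0}{p}|u|^p+o(|u|^p)$ as $u\to0$; (W2) the function $u\mapsto W'(u)/\phi_p(u)$ on $[-1,1]\setminus\{0\}$ is strictly decreasing on $[-1,0)$ and strictly increasing on $(0,1]$. A solution of the boundary value problem is a function $u\in C^1([0,1])$ with values in $[-1,1]$, with $u'(0)=u'(1)=0$, such that $\phi_p(u')\in C^1([0,1])$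 and the equation holds for every $x\in[0,1]$. Definition of $T$: for $\xi\in(0,W_0)$, $T(\xi)$ is the minimal period of the periodic solutions of $-(\phi_p(v'))'+W'(v)=0$ with conserved energy $-\mathcal L(v')+W(v)\equiv\xi$, i.e. $T(\xi)=2\int_{h_-(\xi)}^{h_+(\xi)}\frac{ds}{(p^*(W(s)-\xi))^{1/p}}$, where $h_-(\xi)<0<h_+(\xi)$ are the unique points of $(-1,1)$ with $W(h_\pm(\xi))=\xi$. At the endpoints $T$ is understood through its limits: $T(W_0)=\lim_{\xi\to W_0^-}T(\xi)=2\pi_p/C_0^{1/p}$ with $\pi_p=2(p-1)^{1/p}\int_0^1\frac{ds}{(1-s^p)^{1/p}}$, and $T(0)=\lim_{\xi\to0^+}T(\xi)=+\infty$, i.e. the integrand is $0$ where $E(x)=0$. (The limit $E$ takes values in $[0,W_0]$.)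
   Formalization: The solutions u_n are assumed not identically zero: the zero function solves the problem with energy W_0 but has infinitely many zeros, so the claimed finite limit fails for it. *)

theory Defs
  imports "HOL-Analysis.Analysis" "HOL-Library.Landau_Symbols"
begin

(* Functions on a compact interval S are represented by total functions on the reals of which only
   the values on S matter.  Derivatives are therefore taken within S (one-sided at the end points). *)
definition deriv_on :: "real set \<Rightarrow> (real \<Rightarrow> real) \<Rightarrow> real \<Rightarrow> real" where
  "deriv_on S f x = vector_derivative f (at x within S)"

definition C1_on :: "real set \<Rightarrow> (real \<Rightarrow> real) \<Rightarrow> bool" where
  "C1_on S f \<longleftrightarrow> f differentiable_on S \<and> continuous_on S (deriv_on S f)"

definition conj_exp :: "real \<Rightarrow> real" where
  "conj_exp p = p / (p - 1)"

(* The factor s makes the value at s = 0 equal to 0, whatever p is. *)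
definition phi :: "real \<Rightarrow> real \<Rightarrow> real" where
  "phi p s = \<bar>s\<bar> powr (p - 2) * s"

definition kinetic :: "real \<Rightarrow> real \<Rightarrow> real" where
  "kinetic p s = 1 / conj_exp p * \<bar>s\<bar> powr p"

definition W1 :: "real \<Rightarrow> (real \<Rightarrow> real) \<Rightarrow> real \<Rightarrow> real \<Rightarrow> real \<Rightarrow> real \<Rightarrow> bool" where
  "W1 p W Cm1 C0 C1 W0 \<longleftrightarrow>
     Cm1 > 0 \<and> C0 > 0 \<and> C1 > 0 \<and> W0 > 0 \<and>
     (\<lambda>u. W u - Cm1 / p * \<bar>u - (- 1)\<bar> powr p)
        \<in> o[at (- 1) within {- 1..1}](\<lambda>u. \<bar>u - (- 1)\<bar> powr p) \<and>
     (\<lambda>u. W u - C1 / p * \<bar>u - 1\<bar> powr p)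
        \<in> o[at 1 within {- 1..1}](\<lambda>u. \<bar>u - 1\<bar> powr p) \<and>
     (\<lambda>u. W u - (W0 - C0 / p * \<bar>u\<bar> powr p)) \<in> o[at 0](\<lambda>u. \<bar>u\<bar> powr p)"

definition W2 :: "real \<Rightarrow> (real \<Rightarrow> real) \<Rightarrow> bool" where
  "W2 p W \<longleftrightarrow>
     strict_antimono_on {- 1..<0} (\<lambda>u. deriv_on {- 1..1} W u / phi p u) \<and>
     strict_mono_on {0<..1} (\<lambda>u. deriv_on {- 1..1} W u / phi p u)"

definition is_solution ::
  "real \<Rightarrow> (real \<Rightarrow> real) \<Rightarrow> (real \<Rightarrow> real) \<Rightarrow> real \<Rightarrow> (real \<Rightarrow> real) \<Rightarrow> bool" where
  "is_solution p a W \<epsilon> u \<longleftrightarrow>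
     C1_on {0..1} u \<and> (\<forall>x\<in>{0..1}. u x \<in> {- 1..1}) \<and>
     C1_on {0..1} (\<lambda>x. phi p (deriv_on {0..1} u x)) \<and>
     (\<forall>x\<in>{0..1}. - \<epsilon> * deriv_on {0..1} (\<lambda>y. phi p (\<epsilon> * deriv_on {0..1} u y)) x
                    + a x * deriv_on {- 1..1} W (u x) = 0) \<and>
     deriv_on {0..1} u 0 = 0 \<and> deriv_on {0..1} u 1 = 0"

definition energy ::
  "real \<Rightarrow> (real \<Rightarrow> real) \<Rightarrow> (real \<Rightarrow> real) \<Rightarrow> real \<Rightarrow> (real \<Rightarrow> real) \<Rightarrow> real \<Rightarrow> real" where
  "energy p a W \<epsilon> u x = - (1 / a x) * kinetic p (\<epsilon> * deriv_on {0..1} u x) + W (u x)"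

(* Under W1 and W2 the potential is strictly monotone on [-1,0] and on [0,1], so for 0 < \<xi> < W0
   each level point below exists and is unique. *)
definition h_minus :: "(real \<Rightarrow> real) \<Rightarrow> real \<Rightarrow> real" where
  "h_minus W \<xi> = (THE s. - 1 < s \<and> s < 0 \<and> W s = \<xi>)"

definition h_plus :: "(real \<Rightarrow> real) \<Rightarrow> real \<Rightarrow> real" where
  "h_plus W \<xi> = (THE s. 0 < s \<and> s < 1 \<and> W s = \<xi>)"

definition pi_p :: "real \<Rightarrow> real" where
  "pi_p p = 2 * (p - 1) powr (1 / p) * integral {0..1} (\<lambda>s. 1 / (1 - s powr p) powr (1 / p))"

(* The period on [0,W0].  The values at 0 and W0 are the one-sided limits of the interior formula;
   only arguments in [0,W0] are meaningful.  The integrand blows up at both end points (where it is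
   set to 0 by division by zero) but is integrable for 0 < \<xi> < W0. *)
definition period :: "real \<Rightarrow> (real \<Rightarrow> real) \<Rightarrow> real \<Rightarrow> real \<Rightarrow> real \<Rightarrow> ereal" where
  "period p W C0 W0 \<xi> =
     (if \<xi> = 0 then \<infinity>
      else if \<xi> = W0 then ereal (2 * pi_p p / C0 powr (1 / p))
      else ereal (2 * integral {h_minus W \<xi>..h_plus W \<xi>}
                        (\<lambda>s. 1 / (conj_exp p * (W s - \<xi>)) powr (1 / p))))"

end

theory Submission
  imports Defs
begin

text \<open>
  Write \<open>P = W0 - W\<close> and \<open>D = W0 - E\<close> for the depths of the position and of the energy below the
  top of the well.  With the signed root \<open>w(u) = sgn(u) P(u)^(1/p)\<close> the definition of the energy
  says that \<open>w(u) / D^(1/p)\<close> and the rescaled velocity form a point of the \<open>p\<close>-circle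
  \<open>|x|^p + |y|^p = 1\<close>, so a solution can be followed by an angle on that circle.  Along a solution
  \<open>D' = - (a'/a) k\<close> with \<open>0 \<le> k \<le> D\<close>.  Hence \<open>D\<close> never vanishes, all zeros of \<open>u\<close> are simple,
  and \<open>D\<close> varies at a relative rate that is independent of \<open>\<epsilon>\<close>.

  Let \<open>\<sigma> = w(u) / D^(1/p)\<close>, which lies in \<open>[-1, 1]\<close> and reaches \<open>\<plusminus>1\<close> at the turning points.  The
  integral of \<open>1 / (1 - |s|^p)^(1/p)\<close> up to \<open>\<sigma>\<close> moves with speed
  \<open>w'(u) (p\<^sup>* a)^(1/p) / \<epsilon> + O(1)\<close>, up to the sign of \<open>u'\<close> (lemma \<open>arc_rate\<close>).  The singularity of
  the period integral at the turning points has disappeared, and nothing special happens as \<open>D\<close>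
  tends to 0.  Dividing the integrand by the value of \<open>w'(u)\<close> at a fixed energy \<open>\<xi>\<close> turns the angle
  into a clock, which runs at speed close to \<open>(p\<^sup>* a)^(1/p) / \<epsilon>\<close> while the energy stays close to
  \<open>\<xi>\<close>, and which runs through a total of \<open>Q = p\<^sup>*^(1/p) T(\<xi>) / 2\<close> between two turning points
  (\<open>period_interior\<close>, \<open>period_top\<close>).  Between zeros the clock goes up and down.  Unfolding it gives a
  continuous phase that grows by \<open>Q\<close> per zero on average (\<open>zero_count_by_phase\<close>), so a short interval around
  \<open>x\<close> contains about \<open>(p\<^sup>* a(x))^(1/p) / (\<epsilon> Q)\<close> zeros per unit length, which is
  \<open>2 a(x)^(1/p) / (\<epsilon> T(E(x)))\<close>.

  If \<open>E(x) = 0\<close>, the value \<open>w'(u)\<close> vanishes at \<open>u = \<plusminus>1\<close>, and a small \<open>\<kappa>\<close> is added to it before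
  dividing.  The clock then runs at bounded speed, while the time that it needs from a zero to a
  turning point tends to infinity with \<open>\<kappa> \<rightarrow> 0\<close> (\<open>arc_divergence\<close>); consecutive zeros are
  therefore separated by more than any multiple of \<open>\<epsilon>\<close>, and the density of zeros is 0.  A negative
  limit energy is impossible, as \<open>u'\<close> would then be of order \<open>1/\<epsilon>\<close> on a whole interval.

  The estimates are local: for every \<open>x\<close> and every tolerance, they hold on sufficiently short
  intervals around \<open>x\<close>.  This says that the limiting counting function has derivative
  \<open>2 a^(1/p) / T(E)\<close> at every point, and the fundamental theorem of calculus for the
  Henstock-Kurzweil integral then yields the integrability of the density together with the limit
  (\<open>interval_function_limit\<close>).
\<close>

section \<open>Counting zeros by a continuous phase\<close>

text \<open>
  One-sided increment bounds near every point add up along the interval by bisection.  The function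
  may fail to be differentiable at the points where the phase below changes from one branch to the
  next.
\<close>
lemma increment_bounds_from_local:
  fixes f :: "real \<Rightarrow> real"
  assumes "\<alpha> \<le> \<beta>"
    and right: "\<And>x. \<alpha> \<le> x \<Longrightarrow> x < \<beta> \<Longrightarrow> \<exists>d>0. \<forall>y. x < y \<and> y < x + d \<and> y \<le> \<beta> \<longrightarrow>
                  f y - f x \<in> {c * (y - x)..C * (y - x)}"
    and left: "\<And>x. \<alpha> < x \<Longrightarrow> x \<le> \<beta> \<Longrightarrow> \<exists>d>0. \<forall>y. x - d < y \<and> y < x \<and> \<alpha> \<le> y \<longrightarrow>
                  f x - f y \<in> {c * (x - y)..C * (x - y)}"
  shows "f \<beta> - f \<alpha> \<in> {c * (\<beta> - \<alpha>)..C * (\<beta> - \<alpha>)}"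
proof -
  define P where "P s t \<longleftrightarrow> (\<alpha> \<le> s \<and> t \<le> \<beta> \<longrightarrow> f t - f s \<in> {c * (t - s)..C * (t - s)})" for s t
  have "P \<alpha> \<beta>"
  proof (rule Bolzano[OF assms(1)])
    fix x y z assume "P x y" "P y z" "x \<le> y" "y \<le> z"
    then show "P x z"
      unfolding P_def by (auto simp: algebra_simps)
  next
    fix x assume x: "\<alpha> \<le> x" "x \<le> \<beta>"
    obtain d1 where d1: "d1 > 0" "\<And>y. x < y \<Longrightarrow> y < x + d1 \<Longrightarrow> y \<le> \<beta> \<Longrightarrow>
        f y - f x \<in> {c * (y - x)..C * (y - x)}"
    proof (cases "x < \<beta>")
      case True
      show ?thesis using right[OF x(1) True] that by blast
    qed (use that[of 1] in auto)
    obtain d2 where d2: "d2 > 0" "\<And>y. x - d2 < y \<Longrightarrow> y < x \<Longrightarrow> \<alpha> \<le> y \<Longrightarrow>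
        f x - f y \<in> {c * (x - y)..C * (x - y)}"
    proof (cases "\<alpha> < x")
      case True
      show ?thesis using left[OF True x(2)] that by blast
    qed (use that[of 1] in auto)
    have "P s t" if st: "s \<le> x \<and> x \<le> t \<and> t - s < min d1 d2" for s t
      unfolding P_def
    proof
      assume ab: "\<alpha> \<le> s \<and> t \<le> \<beta>"
      have 1: "f t - f x \<in> {c * (t - x)..C * (t - x)}"
        using d1(2)[of t] st ab by (cases "x = t") auto
      have 2: "f x - f s \<in> {c * (x - s)..C * (x - s)}"
        using d2(2)[of s] st ab by (cases "x = s") auto
      show "f t - f s \<in> {c * (t - s)..C * (t - s)}"
        using 1 2 by (auto simp: algebra_simps)
    qed
    then show "\<exists>d>0. \<forall>s t. s \<le> x \<and> x \<le> t \<and> t - s < d \<longrightarrow> P s t"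
      using d1(1) d2(1) by (intro exI[of _ "min d1 d2"]) auto
  qed
  then show ?thesis unfolding P_def by auto
qed

lemma continuous_sign_locally:
  fixes V :: "real \<Rightarrow> real"
  assumes "continuous_on S V" "x \<in> S" "V x \<noteq> 0"
  shows "\<exists>d>0. \<forall>y\<in>S. \<bar>y - x\<bar> < d \<longrightarrow> sgn (V y) = sgn (V x)"
proof -
  obtain d where d: "d > 0" "\<And>y. y \<in> S \<Longrightarrow> dist y x < d \<Longrightarrow> dist (V y) (V x) < \<bar>V x\<bar>"
    using assms unfolding continuous_on_iff by (metis zero_less_abs_iff)
  have "sgn (V y) = sgn (V x)" if "y \<in> S" "\<bar>y - x\<bar> < d" for y
    using d(2)[OF that(1)] that(2) by (auto simp: dist_real_def sgn_if abs_if split: if_splits)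
  then show ?thesis using d(1) by blast
qed

text \<open>
  Used at zeros of \<open>u\<close> and, with the derivative given by the equation, at turning points.
\<close>
lemma sign_near_simple_zero:
  fixes U :: "real \<Rightarrow> real"
  assumes der: "(U has_real_derivative l) (at x within S)" and "U x = 0" and "l \<noteq> 0"
  shows "\<exists>d>0. \<forall>y\<in>S. y \<noteq> x \<and> \<bar>y - x\<bar> < d \<longrightarrow> sgn (U y) = sgn l * sgn (y - x)"
proof -
  have "((\<lambda>y. (U y - U x) / (y - x)) \<longlongrightarrow> l) (at x within S)"
    using der by (simp add: has_field_derivative_iff)
  then have "\<forall>\<^sub>F y in at x within S. dist (U y / (y - x)) l < \<bar>l\<bar>"
    using assms(2,3) by (auto dest!: tendstoD[where e="\<bar>l\<bar>"])
  then obtain d where d: "d > 0" "\<And>y. y \<in> S \<Longrightarrow> y \<noteq> x \<Longrightarrow> dist y x < d \<Longrightarrow> dist (U y / (y - x)) l < \<bar>l\<bar>"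
    unfolding eventually_at by blast
  have "sgn (U y) = sgn l * sgn (y - x)" if "y \<in> S" "y \<noteq> x" "\<bar>y - x\<bar> < d" for y
  proof -
    have "sgn (U y / (y - x)) = sgn l"
      using d(2)[of y] that by (auto simp: dist_real_def sgn_if abs_if split: if_splits)
    then show ?thesis using that
      by (auto simp: sgn_if zero_less_divide_iff split: if_splits)
  qed
  then show ?thesis using d(1) by blast
qed

text \<open>
  The part of the phase that does not count zeros.  Here \<open>b\<close> stands for the clock, which runs
  upwards from 0 to \<open>Q\<close> while \<open>V = U' > 0\<close> and back while \<open>V < 0\<close>.  A zero of \<open>U\<close> belongs to the arch
  on its right, which has the sign of \<open>V\<close>.  On a positive arch the value is \<open>b\<close> and then
  \<open>2 Q - b\<close>; on a negative arch it is \<open>Q - b\<close> and then \<open>Q + b\<close>.  The branches agree at the turning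
  points, and at every zero the value drops by exactly \<open>Q\<close>, whichever way \<open>U\<close> crosses.
\<close>
definition phase_angle :: "real \<Rightarrow> (real \<Rightarrow> real) \<Rightarrow> (real \<Rightarrow> real) \<Rightarrow> (real \<Rightarrow> real) \<Rightarrow> real \<Rightarrow> real" where
  "phase_angle Q b U V x =
     (if 0 \<le> V x then b x else Q - b x) +
     (if (0 < U x \<or> U x = 0 \<and> 0 < V x) = (0 \<le> V x) then 0 else Q)"

text \<open>
  Since \<open>phase_angle\<close> drops by \<open>Q\<close> at every zero, \<open>Q\<close> times the number of zeros passed, plus
  \<open>phase_angle\<close>, is continuous and grows at the speed \<open>|b'|\<close>.  As \<open>phase_angle\<close> lies in
  \<open>[0, 2 Q]\<close>, the growth of this sum equals \<open>Q\<close> times the number of zeros up to an error \<open>2 Q\<close>.  Positive and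
  negative arches may contribute different amounts; only their sum per pair of zeros enters.
\<close>
lemma zero_count_by_phase:
  fixes U V b :: "real \<Rightarrow> real"
  assumes "\<alpha> \<le> \<beta>" and fin: "finite {z \<in> {\<alpha>..\<beta>}. U z = 0}"
    and der: "\<And>x. x \<in> {\<alpha>..\<beta>} \<Longrightarrow> (U has_real_derivative V x) (at x within {\<alpha>..\<beta>})"
    and contV: "continuous_on {\<alpha>..\<beta>} V"
    and nz: "\<And>x. x \<in> {\<alpha>..\<beta>} \<Longrightarrow> U x \<noteq> 0 \<or> V x \<noteq> 0"
    and turn: "\<And>x. x \<in> {\<alpha>..\<beta>} \<Longrightarrow> V x = 0 \<Longrightarrow>
       \<exists>d>0. \<forall>y\<in>{\<alpha>..\<beta>}. y \<noteq> x \<and> \<bar>y - x\<bar> < d \<longrightarrow> sgn (V y) = - sgn (U x) * sgn (y - x)"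
    and brange: "\<And>x. x \<in> {\<alpha>..\<beta>} \<Longrightarrow> b x \<in> {0..Q}"
    and btop: "\<And>x. x \<in> {\<alpha>..\<beta>} \<Longrightarrow> V x = 0 \<Longrightarrow> U x > 0 \<Longrightarrow> b x = Q"
    and bbot: "\<And>x. x \<in> {\<alpha>..\<beta>} \<Longrightarrow> V x = 0 \<Longrightarrow> U x < 0 \<Longrightarrow> b x = 0"
    and binc: "\<And>x y. \<alpha> \<le> x \<Longrightarrow> x < y \<Longrightarrow> y \<le> \<beta> \<Longrightarrow>
       (\<And>t. x < t \<Longrightarrow> t < y \<Longrightarrow> U t \<noteq> 0 \<and> V t > 0) \<Longrightarrow> b y - b x \<in> {c * (y - x)..C * (y - x)}"
    and bdec: "\<And>x y. \<alpha> \<le> x \<Longrightarrow> x < y \<Longrightarrow> y \<le> \<beta> \<Longrightarrow>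
       (\<And>t. x < t \<Longrightarrow> t < y \<Longrightarrow> U t \<noteq> 0 \<and> V t < 0) \<Longrightarrow> b x - b y \<in> {c * (y - x)..C * (y - x)}"
  shows "Q * real (card {z \<in> {\<alpha><..\<beta>}. U z = 0}) \<in> {c * (\<beta> - \<alpha>) - 2 * Q..C * (\<beta> - \<alpha>) + 2 * Q}"
proof -
  define N where "N x = real (card {z \<in> {\<alpha><..x}. U z = 0})" for x
  define \<theta> where "\<theta> = phase_angle Q b U V"
  define \<psi> where "\<psi> x = Q * N x + \<theta> x" for x
  have finN: "finite {z \<in> {s<..t}. U z = 0}" if "\<alpha> \<le> s" "t \<le> \<beta>" for s t
    by (rule finite_subset[OF _ fin]) (use that in auto)
  have Nadd: "N t = N s + real (card {z \<in> {s<..t}. U z = 0})" if "\<alpha> \<le> s" "s \<le> t" "t \<le> \<beta>" for s t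
  proof -
    have eq: "{z \<in> {\<alpha><..t}. U z = 0} = {z \<in> {\<alpha><..s}. U z = 0} \<union> {z \<in> {s<..t}. U z = 0}"
      using that by auto
    have "card ({z \<in> {\<alpha><..s}. U z = 0} \<union> {z \<in> {s<..t}. U z = 0}) =
        card {z \<in> {\<alpha><..s}. U z = 0} + card {z \<in> {s<..t}. U z = 0}"
      by (rule card_Un_disjoint[OF finN finN]) (use that in auto)
    then show ?thesis
      unfolding N_def eq by simp
  qed
  have contU: "continuous_on {\<alpha>..\<beta>} U"
    using der by (rule DERIV_continuous_on)
  have signU: "\<exists>d>0. \<forall>y\<in>{\<alpha>..\<beta>}. y \<noteq> x \<and> \<bar>y - x\<bar> < d \<longrightarrow>
      sgn (U y) = (if U x = 0 then sgn (V x) * sgn (y - x) else sgn (U x))" if "x \<in> {\<alpha>..\<beta>}" for x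
  proof (cases "U x = 0")
    case True
    then show ?thesis using sign_near_simple_zero[OF der[OF that] True] nz[OF that] by auto
  next
    case False
    then show ?thesis using continuous_sign_locally[OF contU that False] by auto
  qed
  have signV: "\<exists>d>0. \<forall>y\<in>{\<alpha>..\<beta>}. y \<noteq> x \<and> \<bar>y - x\<bar> < d \<longrightarrow>
      sgn (V y) = (if V x = 0 then - sgn (U x) * sgn (y - x) else sgn (V x))" if "x \<in> {\<alpha>..\<beta>}" for x
  proof (cases "V x = 0")
    case True
    then show ?thesis using turn[OF that True] by auto
  next
    case False
    then show ?thesis using continuous_sign_locally[OF contV that False] by auto
  qed
  \<comment> \<open>On either side of every point the signs of \<open>U\<close> and \<open>V\<close> are constant for a while, so that the
    phase is given there by a single branch.\<close>
  have sign: "\<exists>d>0. \<forall>y\<in>{\<alpha>..\<beta>}. y \<noteq> x \<and> \<bar>y - x\<bar> < d \<longrightarrow>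
      sgn (U y) = (if U x = 0 then sgn (V x) * sgn (y - x) else sgn (U x)) \<and>
      sgn (V y) = (if V x = 0 then - sgn (U x) * sgn (y - x) else sgn (V x))" if x: "x \<in> {\<alpha>..\<beta>}" for x
  proof -
    obtain d1 d2 where "d1 > 0" "d2 > 0"
      "\<forall>y\<in>{\<alpha>..\<beta>}. y \<noteq> x \<and> \<bar>y - x\<bar> < d1 \<longrightarrow>
        sgn (U y) = (if U x = 0 then sgn (V x) * sgn (y - x) else sgn (U x))"
      "\<forall>y\<in>{\<alpha>..\<beta>}. y \<noteq> x \<and> \<bar>y - x\<bar> < d2 \<longrightarrow>
        sgn (V y) = (if V x = 0 then - sgn (U x) * sgn (y - x) else sgn (V x))"
      using signU[OF x] signV[OF x] by blast
    then show ?thesis by (intro exI[of _ "min d1 d2"]) auto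
  qed
  have "\<psi> \<beta> - \<psi> \<alpha> \<in> {c * (\<beta> - \<alpha>)..C * (\<beta> - \<alpha>)}"
  proof (rule increment_bounds_from_local[OF \<open>\<alpha> \<le> \<beta>\<close>])
    fix x assume x: "\<alpha> \<le> x" "x < \<beta>"
    then have xin: "x \<in> {\<alpha>..\<beta>}" by auto
    obtain d where d: "d > 0" and sg: "\<And>y. y \<in> {\<alpha>..\<beta>} \<Longrightarrow> y \<noteq> x \<Longrightarrow> \<bar>y - x\<bar> < d \<Longrightarrow>
      sgn (U y) = (if U x = 0 then sgn (V x) * sgn (y - x) else sgn (U x)) \<and>
      sgn (V y) = (if V x = 0 then - sgn (U x) * sgn (y - x) else sgn (V x))"
      using sign[OF xin] by blast
    have "\<psi> y - \<psi> x \<in> {c * (y - x)..C * (y - x)}" if y: "x < y" "y < x + d" "y \<le> \<beta>" for y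
    proof -
      have sgt: "sgn (U t) = (if U x = 0 then sgn (V x) else sgn (U x)) \<and>
         sgn (V t) = (if V x = 0 then - sgn (U x) else sgn (V x))" if "x < t" "t \<le> y" for t
        using sg[of t] that y x by auto
      have no0: "U t \<noteq> 0" if "x < t" "t \<le> y" for t
        using sgt[OF that] nz[OF xin] by (cases "U x = 0"; cases "U t = 0") (auto simp: sgn_zero_iff split: if_splits)
      have Ne: "N y = N x"
      proof -
        have e: "{z \<in> {x<..y}. U z = 0} = {}" using no0 by auto
        show ?thesis using Nadd[of x y] x y unfolding e by simp
      qed
      show ?thesis
      proof (cases "sgn (V y) = 1")
        case True
        have "b y - b x \<in> {c * (y - x)..C * (y - x)}"
        proof (rule binc)
          fix t assume "x < t" "t < y"
          then have "sgn (V t) = 1" "U t \<noteq> 0"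
            using no0[of t] sgt[of t] sgt[of y] True y by linarith+
          then show "U t \<noteq> 0 \<and> V t > 0"
            by (simp add: sgn_1_pos)
        qed (use x y in auto)
        moreover have "\<theta> y - \<theta> x = b y - b x"
          using True sgt[of y] y bbot[OF xin] unfolding \<theta>_def phase_angle_def
          by (cases rule: linorder_cases[of "U x" 0]; cases rule: linorder_cases[of "V x" 0])
            (auto simp: sgn_1_pos sgn_1_neg)
        ultimately show ?thesis by (simp add: \<psi>_def Ne)
      next
        case False
        then have m1: "sgn (V y) = -1"
          using sgt[of y] y nz[OF xin]
          by (cases rule: linorder_cases[of "U x" 0]; cases rule: linorder_cases[of "V x" 0]) auto
        have "b x - b y \<in> {c * (y - x)..C * (y - x)}"
        proof (rule bdec)
          fix t assume "x < t" "t < y"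
          then have "sgn (V t) = -1" "U t \<noteq> 0"
            using no0[of t] sgt[of t] sgt[of y] m1 y by linarith+
          then show "U t \<noteq> 0 \<and> V t < 0"
            by (simp add: sgn_1_neg)
        qed (use x y in auto)
        moreover have "\<theta> y - \<theta> x = b x - b y"
          using m1 sgt[of y] y btop[OF xin] nz[OF xin] unfolding \<theta>_def phase_angle_def
          by (cases rule: linorder_cases[of "U x" 0]; cases rule: linorder_cases[of "V x" 0])
            (auto simp: sgn_1_pos sgn_1_neg)
        ultimately show ?thesis by (simp add: \<psi>_def Ne)
      qed
    qed
    then show "\<exists>d>0. \<forall>y. x < y \<and> y < x + d \<and> y \<le> \<beta> \<longrightarrow> \<psi> y - \<psi> x \<in> {c * (y - x)..C * (y - x)}"
      using d by blast
  next
    fix x assume x: "\<alpha> < x" "x \<le> \<beta>"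
    then have xin: "x \<in> {\<alpha>..\<beta>}" by auto
    obtain d where d: "d > 0" and sg: "\<And>y. y \<in> {\<alpha>..\<beta>} \<Longrightarrow> y \<noteq> x \<Longrightarrow> \<bar>y - x\<bar> < d \<Longrightarrow>
      sgn (U y) = (if U x = 0 then sgn (V x) * sgn (y - x) else sgn (U x)) \<and>
      sgn (V y) = (if V x = 0 then - sgn (U x) * sgn (y - x) else sgn (V x))"
      using sign[OF xin] by blast
    have "\<psi> x - \<psi> y \<in> {c * (x - y)..C * (x - y)}" if y: "x - d < y" "y < x" "\<alpha> \<le> y" for y
    proof -
      have sgt: "sgn (U t) = (if U x = 0 then - sgn (V x) else sgn (U x)) \<and>
         sgn (V t) = (if V x = 0 then sgn (U x) else sgn (V x))" if "y \<le> t" "t < x" for t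
        using sg[of t] that y x by auto
      have no0: "U t \<noteq> 0" if "y \<le> t" "t < x" for t
        using sgt[OF that] nz[OF xin] by (cases "U x = 0"; cases "U t = 0") (auto simp: sgn_zero_iff split: if_splits)
      have Ne: "N x = N y + (if U x = 0 then 1 else 0)"
      proof -
        have "z = x" if "z \<in> {y<..x}" "U z = 0" for z
          using no0[of z] that by (cases "z = x") auto
        then have e: "{z \<in> {y<..x}. U z = 0} = (if U x = 0 then {x} else {})"
          using y by auto
        show ?thesis using Nadd[of y x] x y unfolding e by simp
      qed
      show ?thesis
      proof (cases "sgn (V y) = 1")
        case True
        have "b x - b y \<in> {c * (x - y)..C * (x - y)}"
        proof (rule binc)
          fix t assume "y < t" "t < x"
          then have "sgn (V t) = 1" "U t \<noteq> 0"
            using no0[of t] sgt[of t] sgt[of y] True y by linarith+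
          then show "U t \<noteq> 0 \<and> V t > 0"
            by (simp add: sgn_1_pos)
        qed (use x y in auto)
        moreover have "\<psi> x - \<psi> y = b x - b y"
          using True sgt[of y] y nz[OF xin] Ne unfolding \<psi>_def \<theta>_def phase_angle_def
          by (cases rule: linorder_cases[of "U x" 0]; cases rule: linorder_cases[of "V x" 0])
            (auto simp: sgn_1_pos sgn_1_neg algebra_simps)
        ultimately show ?thesis by simp
      next
        case False
        then have m1: "sgn (V y) = -1"
          using sgt[of y] y nz[OF xin]
          by (cases rule: linorder_cases[of "U x" 0]; cases rule: linorder_cases[of "V x" 0]) auto
        have "b y - b x \<in> {c * (x - y)..C * (x - y)}"
        proof (rule bdec)
          fix t assume "y < t" "t < x"
          then have "sgn (V t) = -1" "U t \<noteq> 0"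
            using no0[of t] sgt[of t] sgt[of y] m1 y by linarith+
          then show "U t \<noteq> 0 \<and> V t < 0"
            by (simp add: sgn_1_neg)
        qed (use x y in auto)
        moreover have "\<psi> x - \<psi> y = b y - b x"
          using m1 sgt[of y] y bbot[OF xin] nz[OF xin] Ne unfolding \<psi>_def \<theta>_def phase_angle_def
          by (cases rule: linorder_cases[of "U x" 0]; cases rule: linorder_cases[of "V x" 0])
            (auto simp: sgn_1_pos sgn_1_neg algebra_simps)
        ultimately show ?thesis by simp
      qed
    qed
    then show "\<exists>d>0. \<forall>y. x - d < y \<and> y < x \<and> \<alpha> \<le> y \<longrightarrow> \<psi> x - \<psi> y \<in> {c * (x - y)..C * (x - y)}"
      using d by blast
  qed
  moreover have "\<theta> x \<in> {0..2 * Q}" if "x \<in> {\<alpha>..\<beta>}" for x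
    using brange[OF that] unfolding \<theta>_def phase_angle_def by auto
  from this[of \<alpha>] this[of \<beta>] have "\<theta> \<alpha> \<in> {0..2 * Q}" "\<theta> \<beta> \<in> {0..2 * Q}"
    using \<open>\<alpha> \<le> \<beta>\<close> by auto
  moreover have "N \<alpha> = 0" by (simp add: N_def)
  ultimately show ?thesis
    unfolding \<psi>_def N_def[of \<beta>] by auto
qed

text \<open>
  A crude substitute for the phase when only a lower bound on the distance of zeros is available.
\<close>
lemma count_from_gap:
  fixes \<delta> :: real
  assumes "finite Z" "Z \<subseteq> {\<alpha>..\<beta>}" "\<alpha> \<le> \<beta>" "0 \<le> \<delta>"
    and gap: "\<And>x y. x \<in> Z \<Longrightarrow> y \<in> Z \<Longrightarrow> x < y \<Longrightarrow> \<delta> \<le> y - x"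
  shows "\<delta> * real (card Z) \<le> \<delta> + (\<beta> - \<alpha>)"
  using assms
proof (induction "card Z" arbitrary: Z \<beta>)
  case 0
  then show ?case by simp
next
  case (Suc n)
  define m where "m = Max Z"
  have ne: "Z \<noteq> {}" using Suc(2) by auto
  have m: "m \<in> Z" "\<And>z. z \<in> Z \<Longrightarrow> z \<le> m"
    using Suc(3) ne by (auto simp: m_def)
  show ?case
  proof (cases "Z = {m}")
    case True
    then show ?thesis using Suc(5) by simp
  next
    case False
    define Y where "Y = Z - {m}"
    have Yne: "Y \<noteq> {}" using False m by (auto simp: Y_def)
    have cY: "card Z = Suc (card Y)" "finite Y"
      using m Suc(3) card_Suc_Diff1[OF Suc(3) m(1)] by (auto simp: Y_def)
    have sub: "Y \<subseteq> {\<alpha>..m - \<delta>}"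
    proof
      fix y assume y: "y \<in> Y"
      then have "y \<in> Z" "y < m" using m(2)[of y] by (auto simp: Y_def)
      then show "y \<in> {\<alpha>..m - \<delta>}" using Suc(7)[of y m] m Suc(4) by auto
    qed
    have "\<delta> * real (card Y) \<le> \<delta> + (m - \<delta> - \<alpha>)"
    proof (rule Suc(1))
      show "\<alpha> \<le> m - \<delta>" using sub Yne by auto
    qed (use Suc cY sub in \<open>auto simp: Y_def\<close>)
    moreover have "m \<le> \<beta>" using m Suc(4) by auto
    ultimately show ?thesis by (simp add: cY algebra_simps)
  qed
qed

section \<open>The arcsine of the p-circle, run at variable speed\<close>

text \<open>
  For \<open>m = 1\<close> the function \<open>arc\<close> is the generalised arcsine, normalised to vanish at \<open>-1\<close>.  At
  \<open>s = \<plusminus>1\<close> the density takes the value 0 by division by zero, which does not affect the integral.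
\<close>
definition arc_density :: "real \<Rightarrow> (real \<Rightarrow> real) \<Rightarrow> real \<Rightarrow> real" where
  "arc_density p m s = 1 / (m s * (1 - \<bar>s\<bar> powr p) powr (1 / p))"

definition arc :: "real \<Rightarrow> (real \<Rightarrow> real) \<Rightarrow> real \<Rightarrow> real" where
  "arc p m x = integral {-1..x} (arc_density p m)"

text \<open>
  This is where \<open>p > 1\<close> makes the time spent near a turning point finite.
\<close>
lemma endpoint_singularity_integrable:
  assumes "p > (1::real)"
  shows "(\<lambda>s::real. (1 - \<bar>s\<bar>) powr (- 1 / p)) integrable_on {-1..1}"
proof -
  define q where "q = 1 - 1 / p"
  have q: "q > 0" "q - 1 = -1 / p" using assms by (auto simp: q_def field_simps)
  have "((\<lambda>s. (1 - s) powr (-1 / p)) has_integral (- ((1 - 1) powr q / q)) - (- ((1 - 0) powr q / q))) {0..1::real}"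
  proof (rule fundamental_theorem_of_calculus_interior)
    show "continuous_on {0..1} (\<lambda>s::real. - ((1 - s) powr q / q))"
      using q by (intro continuous_intros continuous_on_powr') auto
    fix x :: real assume x: "x \<in> {0<..<1}"
    have "((\<lambda>s. - ((1 - s) powr q / q)) has_real_derivative (1 - x) powr (q - 1)) (at x)"
      using x q by (auto intro!: derivative_eq_intros)
    then show "((\<lambda>s. - ((1 - s) powr q / q)) has_vector_derivative (1 - x) powr (-1 / p)) (at x)"
      by (simp add: has_real_derivative_iff_has_vector_derivative q(2))
  qed auto
  then have i: "(\<lambda>s. (1 - s) powr (-1 / p)) integrable_on {0..1::real}"
    by (rule has_integral_integrable)
  then have "(\<lambda>s. (1 - - s) powr (-1 / p)) integrable_on {-1..-0::real}"
    by (subst Henstock_Kurzweil_Integration.integrable_reflect_real)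
  then have "(\<lambda>s. (1 - - s) powr (-1 / p)) integrable_on {-1..0::real}"
    by simp
  then have 1: "(\<lambda>s. (1 - \<bar>s\<bar>) powr (-1 / p)) integrable_on {-1..0::real}"
    by (rule integrable_eq) auto
  have 2: "(\<lambda>s. (1 - \<bar>s\<bar>) powr (-1 / p)) integrable_on {0..1::real}"
    by (rule integrable_eq[OF i]) auto
  show ?thesis using Henstock_Kurzweil_Integration.integrable_combine[OF _ _ 1 2] by simp
qed

locale arc_clock =
  fixes p :: real and m :: "real \<Rightarrow> real"
  assumes p1: "p > 1" and contm: "continuous_on {-1..1} m"
    and mpos: "\<And>s. s \<in> {-1..1} \<Longrightarrow> m s > 0"
begin

lemma power_le_base: "\<bar>s\<bar> powr p \<le> \<bar>s\<bar>" if "\<bar>s\<bar> \<le> 1"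
  using powr_mono'[of 1 p "\<bar>s\<bar>"] that p1 by simp

lemma power_less_one: "\<bar>s\<bar> powr p < 1" if "-1 < s" "s < 1"
  using power_le_base[of s] that by linarith

lemma radicand_cont: "continuous_on {-1..1} (\<lambda>s. (1 - \<bar>s\<bar> powr p) powr (1 / p))"
  using p1 power_le_base
  by (intro continuous_intros continuous_on_powr') (force simp: abs_le_iff)+

lemma arc_density_nonneg: "s \<in> {-1..1} \<Longrightarrow> arc_density p m s \<ge> 0"
  using mpos[of s] by (simp add: arc_density_def)

lemma arc_density_pos: "s \<in> {-1<..<1} \<Longrightarrow> arc_density p m s > 0"
  using mpos[of s] power_less_one[of s] by (simp add: arc_density_def)

text \<open>
  As \<open>|s|^p \<le> |s|\<close>, the density is dominated by a multiple of \<open>(1 - |s|)^(-1/p)\<close>.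
\<close>
lemma arc_density_integrable: "arc_density p m integrable_on {-1..1}"
proof -
  obtain s0 where s0: "s0 \<in> {-1..1}" "\<And>s. s \<in> {-1..1} \<Longrightarrow> m s0 \<le> m s"
    using continuous_attains_inf[OF _ _ contm] by auto
  have m0: "m s0 > 0" using mpos s0 by auto
  show ?thesis
  proof (rule measurable_bounded_by_integrable_imp_integrable)
    show "arc_density p m \<in> borel_measurable (lebesgue_on {-1..1})"
      unfolding arc_density_def
      by (intro borel_measurable_divide borel_measurable_const
          continuous_imp_measurable_on_sets_lebesgue continuous_on_mult contm radicand_cont) auto
    show "(\<lambda>s. 1 / m s0 * (1 - \<bar>s\<bar>) powr (-1 / p)) integrable_on {-1..1}"
      using endpoint_singularity_integrable[OF p1] by (intro integrable_on_mult_right) auto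
    fix s :: real assume s: "s \<in> {-1..1}"
    show "norm (arc_density p m s) \<le> 1 / m s0 * (1 - \<bar>s\<bar>) powr (-1 / p)"
    proof (cases "\<bar>s\<bar> = 1")
      case True
      then show ?thesis by (simp add: arc_density_def)
    next
      case False
      then have lt: "\<bar>s\<bar> < 1" using s by auto
      have le: "(1 - \<bar>s\<bar>) powr (1 / p) \<le> (1 - \<bar>s\<bar> powr p) powr (1 / p)"
        using lt power_le_base[of s] p1 by (intro powr_mono2) auto
      have "arc_density p m s \<le> 1 / (m s0 * (1 - \<bar>s\<bar>) powr (1 / p))"
        unfolding arc_density_def
        using le s0(2)[OF s] m0 lt mpos[OF s]
        by (intro divide_left_mono mult_mono mult_pos_pos) auto
      also have "\<dots> = 1 / m s0 * (1 - \<bar>s\<bar>) powr (-1 / p)"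
        by (simp add: powr_minus_divide)
      finally show ?thesis using arc_density_nonneg[OF s] by simp
    qed
  qed auto
qed

lemma arc_continuous: "continuous_on {-1..1} (arc p m)"
  unfolding arc_def[abs_def] by (rule indefinite_integral_continuous_1[OF arc_density_integrable])

lemma arc_derivative:
  assumes "x \<in> {-1<..<1}"
  shows "(arc p m has_real_derivative arc_density p m x) (at x)"
proof -
  have inter: "x \<in> interior {-1..1}" using assms by simp
  have le: "\<bar>x\<bar> powr p < 1" using assms power_less_one[of x] by auto
  have "continuous (at x) m"
    using contm inter by (metis continuous_on_interior)
  moreover have "continuous (at x) (\<lambda>s. (1 - \<bar>s\<bar> powr p) powr (1 / p))"
    using radicand_cont inter by (metis continuous_on_interior)
  ultimately have "continuous (at x) (arc_density p m)"
    unfolding arc_density_def[abs_def] using le mpos[of x] assms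
    by (intro continuous_divide continuous_mult) auto
  then have "((\<lambda>u. integral {-1..u} (arc_density p m)) has_vector_derivative arc_density p m x) (at x within {-1..1} - {})"
    using assms by (intro integral_has_vector_derivative_continuous_at[OF arc_density_integrable])
      (auto intro: continuous_at_imp_continuous_at_within)
  then show ?thesis
    using at_within_interior[OF inter]
    by (simp add: has_real_derivative_iff_has_vector_derivative arc_def[abs_def])
qed

lemma arc_mono:
  assumes "-1 \<le> x" "x < y" "y \<le> 1"
  shows "arc p m x < arc p m y"
proof (rule DERIV_pos_imp_increasing_open[OF assms(2)])
  show "continuous_on {x..y} (arc p m)"
    by (rule continuous_on_subset[OF arc_continuous]) (use assms in auto)
  show "\<exists>l. (arc p m has_real_derivative l) (at t) \<and> l > 0" if "x < t" "t < y" for t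
    using arc_derivative[of t] arc_density_pos[of t] that assms by (intro exI[of _ "arc_density p m t"]) auto
qed

lemma arc_minus_one: "arc p m (-1) = 0"
  by (simp add: arc_def)

lemma arc_range: "x \<in> {-1..1} \<Longrightarrow> arc p m x \<in> {0..arc p m 1}"
  using arc_mono[of "-1" x] arc_mono[of x 1] arc_minus_one
  by (cases "x = -1"; cases "x = 1") auto

lemma arc_total_pos: "arc p m 1 > 0"
  using arc_mono[of "-1" 1] arc_minus_one by simp

end

section \<open>One half of the potential well\<close>

text \<open>
  The derivative of the signed root \<open>w\<close> of \<open>W0 - W\<close>; its value at 0 is the continuous extension.
\<close>
definition slope :: "real \<Rightarrow> real \<Rightarrow> real \<Rightarrow> (real \<Rightarrow> real) \<Rightarrow> (real \<Rightarrow> real) \<Rightarrow> real \<Rightarrow> real" where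
  "slope p C0 W0 W W' s =
     (if s = 0 then (C0 / p) powr (1 / p)
      else 1 / p * (W0 - W s) powr (1 / p - 1) * \<bar>W' s\<bar>)"

text \<open>
  Everything that concerns one side of the maximum of \<open>W\<close> is proved on \<open>[0, 1]\<close>.  The negative side
  is the same structure for the reflected potential \<open>W(-s)\<close>.
\<close>
locale half_well =
  fixes p :: real and W W' :: "real \<Rightarrow> real" and W0 C0 C1 :: real
  assumes p1: "p > 1" and W0pos: "W0 > 0" and C0pos: "C0 > 0" and C1pos: "C1 > 0"
    and der: "\<And>s. s \<in> {0..1} \<Longrightarrow> (W has_real_derivative W' s) (at s within {0..1})"
    and contW': "continuous_on {0..1} W'"
    and mono: "strict_mono_on {0<..1} (\<lambda>s. W' s / s powr (p - 1))"
    and lim_top: "((\<lambda>s. (W0 - W s) / s powr p) \<longlongrightarrow> C0 / p) (at_right 0)"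
    and lim_end: "((\<lambda>s. W s / (1 - s) powr p) \<longlongrightarrow> C1 / p) (at_left 1)"
begin

lemma contW: "continuous_on {0..1} W"
  using der by (rule DERIV_continuous_on)

lemma der_at: "0 < s \<Longrightarrow> s < 1 \<Longrightarrow> (W has_real_derivative W' s) (at s)"
  using der[of s] by (simp add: at_within_Icc_at)

lemma W_0: "W 0 = W0"
proof -
  have "((\<lambda>s. s powr p) \<longlongrightarrow> 0 powr p) (at_right (0::real))"
    using p1 by (intro tendsto_powr' tendsto_intros) (auto simp: eventually_at_filter)
  then have "((\<lambda>s. (W0 - W s) / s powr p * s powr p) \<longlongrightarrow> C0 / p * 0) (at_right 0)"
    using p1 by (intro tendsto_mult lim_top) auto
  then have "((\<lambda>s. (W0 - W s) / s powr p * s powr p) \<longlongrightarrow> 0) (at_right 0)" by simp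
  then have "((\<lambda>s. W0 - W s) \<longlongrightarrow> 0) (at_right 0)"
    by (rule Lim_transform_eventually) (auto simp: eventually_at_filter)
  then have "((\<lambda>s. W0 - (W0 - W s)) \<longlongrightarrow> W0 - 0) (at_right 0)"
    by (intro tendsto_intros)
  moreover have "(W \<longlongrightarrow> W 0) (at_right 0)"
    using contW by (auto simp: continuous_on_def at_within_Icc_at_right dest: bspec[of _ _ 0])
  ultimately show ?thesis
    using tendsto_unique[of "at_right (0::real)"] by simp
qed

lemma W_1: "W 1 = 0"
proof -
  have "((\<lambda>s. (1 - s) powr p) \<longlongrightarrow> (1 - 1) powr p) (at_left (1::real))"
    using p1 by (intro tendsto_powr' tendsto_intros) (auto simp: eventually_at_filter)
  then have "((\<lambda>s. W s / (1 - s) powr p * (1 - s) powr p) \<longlongrightarrow> C1 / p * 0) (at_left 1)"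
    using p1 by (intro tendsto_mult lim_end) auto
  then have "((\<lambda>s. W s / (1 - s) powr p * (1 - s) powr p) \<longlongrightarrow> 0) (at_left 1)" by simp
  then have "(W \<longlongrightarrow> 0) (at_left 1)"
    by (rule Lim_transform_eventually) (auto simp: eventually_at_filter)
  moreover have "(W \<longlongrightarrow> W 1) (at_left 1)"
    using contW by (auto simp: continuous_on_def at_within_Icc_at_left dest: bspec[of _ _ 1])
  ultimately show ?thesis
    using tendsto_unique[of "at_left (1::real)"] by simp
qed

text \<open>
  Otherwise \<open>W\<close> would be negative just before 1, against its expansion there.
\<close>
lemma W'_1: "W' 1 \<le> 0"
proof (rule ccontr)
  assume "\<not> ?thesis"
  then obtain d where d: "d > 0" "\<And>h. h > 0 \<Longrightarrow> 1 - h \<in> {0..1} \<Longrightarrow> h < d \<Longrightarrow> W (1 - h) < W 1"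
    using has_real_derivative_pos_inc_left[OF der[of 1]] by auto
  have "\<forall>\<^sub>F s in at_left 1. W s / (1 - s) powr p > 0"
    using order_tendstoD(1)[OF lim_end, of 0] C1pos p1 by simp
  moreover have "\<forall>\<^sub>F s in at_left 1. s \<in> {max 0 (1 - d)<..<1}"
    using d(1) by (intro eventually_at_leftI[of "max 0 (1 - d)"]) auto
  ultimately have "\<forall>\<^sub>F s in at_left (1::real). False"
  proof eventually_elim
    case (elim s)
    then show ?case using d(2)[of "1 - s"] W_1 by (auto simp: zero_less_divide_iff)
  qed
  then show False by simp
qed

text \<open>
  The ratio \<open>W'(s) / s^(p-1)\<close> increases to its nonpositive value at 1.
\<close>
lemma W'_neg:
  assumes "0 < s" "s < 1"
  shows "W' s < 0"
proof -
  have "W' s / s powr (p - 1) < W' 1 / 1 powr (p - 1)"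
    by (rule strict_mono_onD[OF mono]) (use assms in auto)
  then have "W' s / s powr (p - 1) < 0" using W'_1 by simp
  then show ?thesis using assms by (auto simp: divide_less_0_iff)
qed

lemma W_decreasing:
  assumes "0 \<le> s" "s < t" "t \<le> 1"
  shows "W t < W s"
proof (rule DERIV_neg_imp_decreasing_open[OF assms(2)])
  show "continuous_on {s..t} W"
    by (rule continuous_on_subset[OF contW]) (use assms in auto)
  show "\<exists>y. DERIV W x :> y \<and> y < 0" if "s < x" "x < t" for x
    using der_at[of x] W'_neg[of x] that assms by auto
qed

lemma W_less_top: "0 < s \<Longrightarrow> s \<le> 1 \<Longrightarrow> W s < W0"
  using W_decreasing[of 0 s] W_0 by simp

lemma W_pos: "0 \<le> s \<Longrightarrow> s < 1 \<Longrightarrow> 0 < W s"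
  using W_decreasing[of s 1] W_1 by simp

text \<open>
  L'Hospital's rule cannot be reversed in general, but here the ratio \<open>W'(s) / s^(p-1)\<close> is
  monotone.  Replacing it by its value \<open>k\<close> at one end of an interval bounds the increment of \<open>W\<close> by
  that of \<open>k s^p / p\<close>; the interval \<open>[0, u]\<close> gives the lower bound and \<open>[u, 2 u]\<close> the upper one.
  As both bounds tend to \<open>- C0\<close>, so does the ratio.
\<close>
lemma ratio_lower:
  assumes "0 < u" "u < 1"
  shows "- p * ((W0 - W u) / u powr p) \<le> W' u / u powr (p - 1)"
proof -
  define k where "k = W' u / u powr (p - 1)"
  have "W 0 - k * (0 powr p / p) \<ge> W u - k * (u powr p / p)"
  proof (rule DERIV_nonpos_imp_decreasing_open[of 0 u "\<lambda>s. W s - k * (s powr p / p)"])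
    show "continuous_on {0..u} (\<lambda>s. W s - k * (s powr p / p))"
      using p1 assms by (intro continuous_intros continuous_on_powr' continuous_on_subset[OF contW]) auto
    fix s assume s: "0 < s" "s < u"
    have "((\<lambda>s. W s - k * (s powr p / p)) has_real_derivative W' s - k * s powr (p - 1)) (at s)"
      using p1 s assms by (auto intro!: derivative_eq_intros der_at)
    moreover have "W' s / s powr (p - 1) < k"
      unfolding k_def by (rule strict_mono_onD[OF mono]) (use assms s in auto)
    then have "W' s - k * s powr (p - 1) \<le> 0"
      using s by (simp add: divide_less_eq)
    ultimately show "\<exists>y. DERIV (\<lambda>s. W s - k * (s powr p / p)) s :> y \<and> y \<le> 0" by blast
  qed (use assms in auto)
  then have "W u - W0 \<le> k * (u powr p / p)" using W_0 p1 by simp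
  then have "- (p * (W0 - W u)) \<le> k * u powr p" using p1 by (simp add: field_simps)
  then show ?thesis unfolding k_def[symmetric] using assms by (simp add: field_simps)
qed

lemma ratio_upper:
  assumes "0 < u" "2 * u < 1"
  shows "W' u / u powr (p - 1) \<le>
    p * ((W0 - W u) / u powr p - 2 powr p * ((W0 - W (2 * u)) / (2 * u) powr p)) / (2 powr p - 1)"
proof -
  define k where "k = W' u / u powr (p - 1)"
  have "W u - k * (u powr p / p) \<le> W (2 * u) - k * ((2 * u) powr p / p)"
  proof (rule DERIV_nonneg_imp_increasing_open[of u "2 * u" "\<lambda>s. W s - k * (s powr p / p)"])
    show "continuous_on {u..2 * u} (\<lambda>s. W s - k * (s powr p / p))"
      using p1 assms by (intro continuous_intros continuous_on_powr' continuous_on_subset[OF contW]) auto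
    fix s assume s: "u < s" "s < 2 * u"
    have "((\<lambda>s. W s - k * (s powr p / p)) has_real_derivative W' s - k * s powr (p - 1)) (at s)"
      using p1 s assms by (auto intro!: derivative_eq_intros der_at)
    moreover have "k < W' s / s powr (p - 1)"
      unfolding k_def by (rule strict_mono_onD[OF mono]) (use assms s in auto)
    then have "W' s - k * s powr (p - 1) \<ge> 0"
      using s assms by (simp add: less_divide_eq)
    ultimately show "\<exists>y. DERIV (\<lambda>s. W s - k * (s powr p / p)) s :> y \<and> y \<ge> 0" by blast
  qed (use assms in auto)
  moreover have two: "2 powr p > 1" using p1 by simp
  moreover have pw: "(2 * u) powr p = 2 powr p * u powr p" using assms by (simp add: powr_mult)
  ultimately have "k * (((2 powr p - 1) * u powr p) / p) \<le> (W0 - W u) - (W0 - W (2 * u))"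
    by (simp add: algebra_simps diff_divide_distrib)
  then have "k * ((2 powr p - 1) * u powr p) \<le> p * ((W0 - W u) - (W0 - W (2 * u)))"
    using p1 by (simp add: divide_le_eq mult.commute)
  then have "k \<le> p * ((W0 - W u) - (W0 - W (2 * u))) / ((2 powr p - 1) * u powr p)"
    using two assms by (simp add: le_divide_eq)
  also have "\<dots> = p * ((W0 - W u) / u powr p - 2 powr p * ((W0 - W (2 * u)) / (2 * u) powr p)) / (2 powr p - 1)"
  proof -
    have alg: "p * (A - B) / ((t - 1) * v) = p * (A / v - t * (B / (t * v))) / (t - 1)"
      if "v > 0" "t > 1" for A B t v :: real
      using that by (simp add: diff_divide_distrib[symmetric] mult.commute)
    show ?thesis unfolding pw by (rule alg) (use assms two in auto)
  qed
  finally show ?thesis unfolding k_def .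
qed

lemma ratio_limit: "((\<lambda>u. W' u / u powr (p - 1)) \<longlongrightarrow> - C0) (at_right 0)"
proof (rule tendsto_sandwich)
  have ev: "\<forall>\<^sub>F u in at_right 0. u \<in> {0<..<1/2::real}"
    by (intro eventually_at_rightI[of 0 "1/2"]) auto
  show "\<forall>\<^sub>F u in at_right 0. - p * ((W0 - W u) / u powr p) \<le> W' u / u powr (p - 1)"
    using ev by eventually_elim (rule ratio_lower, auto)
  show "\<forall>\<^sub>F u in at_right 0. W' u / u powr (p - 1) \<le>
    p * ((W0 - W u) / u powr p - 2 powr p * ((W0 - W (2 * u)) / (2 * u) powr p)) / (2 powr p - 1)"
    using ev by eventually_elim (rule ratio_upper, auto)
  have "((\<lambda>u. - p * ((W0 - W u) / u powr p)) \<longlongrightarrow> - p * (C0 / p)) (at_right 0)"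
    by (intro tendsto_mult tendsto_const lim_top)
  then show "((\<lambda>u. - p * ((W0 - W u) / u powr p)) \<longlongrightarrow> - C0) (at_right 0)"
    using p1 by simp
  have "filterlim (\<lambda>u::real. 2 * u) (at_right 0) (at_right 0)"
    by (auto simp: filterlim_at eventually_at_filter intro!: tendsto_eq_intros)
  from filterlim_compose[OF lim_top this]
  have l2: "((\<lambda>u. (W0 - W (2 * u)) / (2 * u) powr p) \<longlongrightarrow> C0 / p) (at_right 0)" .
  have two: "2 powr p \<noteq> 1" using p1 by simp
  have "((\<lambda>u. p * ((W0 - W u) / u powr p - 2 powr p * ((W0 - W (2 * u)) / (2 * u) powr p)) / (2 powr p - 1))
    \<longlongrightarrow> p * (C0 / p - 2 powr p * (C0 / p)) / (2 powr p - 1)) (at_right 0)"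
    using two by (intro tendsto_intros lim_top l2) auto
  moreover have "p * (C0 / p - 2 powr p * (C0 / p)) / (2 powr p - 1) = - C0"
    using two p1 by (simp add: field_simps)
  ultimately show "((\<lambda>u. p * ((W0 - W u) / u powr p - 2 powr p * ((W0 - W (2 * u)) / (2 * u) powr p)) / (2 powr p - 1))
    \<longlongrightarrow> - C0) (at_right 0)" by simp
qed

abbreviation "g \<equiv> slope p C0 W0 W W'"

text \<open>
  Both \<open>(W0 - W(s)) / s^p\<close> and \<open>W'(s) / s^(p-1)\<close> have limits at 0, and in \<open>slope\<close> the powers
  of \<open>s\<close> cancel.
\<close>
lemma slope_limit: "(g \<longlongrightarrow> g 0) (at_right 0)"
proof -
  have lim: "((\<lambda>s. 1 / p * ((W0 - W s) / s powr p) powr (1 / p - 1) * \<bar>W' s / s powr (p - 1)\<bar>)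
      \<longlongrightarrow> 1 / p * (C0 / p) powr (1 / p - 1) * \<bar>- C0\<bar>) (at_right 0)"
    using C0pos p1 by (intro tendsto_intros lim_top ratio_limit) auto
  have eq: "\<forall>\<^sub>F s in at_right 0. 1 / p * ((W0 - W s) / s powr p) powr (1 / p - 1) * \<bar>W' s / s powr (p - 1)\<bar> = g s"
  proof -
    have "\<forall>\<^sub>F s in at_right 0. s \<in> {0<..<1::real}" by (intro eventually_at_rightI[of 0 1]) auto
    then show ?thesis
    proof eventually_elim
      case (elim s)
      have "(s powr p) powr (1 / p - 1) * s powr (p - 1) = 1"
        using elim p1 by (simp add: powr_powr powr_add[symmetric] field_simps)
      moreover have "((W0 - W s) / s powr p) powr (1 / p - 1) = (W0 - W s) powr (1 / p - 1) / (s powr p) powr (1 / p - 1)"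
        by (rule powr_divide)
      ultimately show ?case using elim by (simp add: slope_def abs_divide)
    qed
  qed
  have "1 / p * (C0 / p) powr (1 / p - 1) * \<bar>- C0\<bar> = (C0 / p) powr (1 / p - 1) * (C0 / p) powr 1"
    using C0pos p1 by simp
  also have "\<dots> = (C0 / p) powr (1 / p)" unfolding powr_add[symmetric] by simp
  finally have val: "1 / p * (C0 / p) powr (1 / p - 1) * \<bar>- C0\<bar> = g 0" by (simp add: slope_def)
  show ?thesis using Lim_transform_eventually[OF lim eq] unfolding val .
qed

lemma slope_continuous: "continuous_on {0..1} g"
  unfolding continuous_on_def
proof
  fix s :: real assume s: "s \<in> {0..1}"
  show "(g \<longlongrightarrow> g s) (at s within {0..1})"
  proof (cases "s = 0")
    case True
    then show ?thesis using slope_limit by (simp add: at_within_Icc_at_right)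
  next
    case False
    have "((\<lambda>s. 1 / p * (W0 - W s) powr (1 / p - 1) * \<bar>W' s\<bar>) \<longlongrightarrow>
      1 / p * (W0 - W s) powr (1 / p - 1) * \<bar>W' s\<bar>) (at s within {0..1})"
      using W_less_top[of s] s False contW contW'
      by (intro tendsto_intros) (auto simp: continuous_on_def)
    moreover have "\<forall>\<^sub>F x in at s within {0..1}. x \<noteq> 0"
      using False by (metis eventually_neq_at_within)
    then have "\<forall>\<^sub>F x in at s within {0..1}. 1 / p * (W0 - W x) powr (1 / p - 1) * \<bar>W' x\<bar> = g x"
      by eventually_elim (simp add: slope_def)
    ultimately show ?thesis
      using False by (simp add: slope_def[of _ _ _ _ _ s] Lim_transform_eventually)
  qed
qed

lemma slope_pos:
  assumes "0 \<le> s" "s < 1"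
  shows "g s > 0"
proof (cases "s = 0")
  case True
  then show ?thesis using C0pos p1 by (simp add: slope_def)
next
  case False
  then have "1 / p > 0" "(W0 - W s) powr (1 / p - 1) > 0" "\<bar>W' s\<bar> > 0"
    using assms p1 W_less_top[of s] W'_neg[of s] by auto
  then show ?thesis using False unfolding slope_def by (simp only: mult_pos_pos if_False)
qed

lemma root_derivative:
  assumes "0 < s" "s < 1"
  shows "((\<lambda>s. (W0 - W s) powr (1 / p)) has_real_derivative g s) (at s)"
proof -
  have "((\<lambda>s. (W0 - W s) powr (1 / p)) has_real_derivative 1 / p * (W0 - W s) powr (1 / p - 1) * (- W' s)) (at s)"
    using W_less_top[of s] assms by (auto intro!: derivative_eq_intros der_at)
  then show ?thesis using assms W'_neg[of s] by (simp add: slope_def)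
qed

lemma root_continuous: "continuous_on {0..1} (\<lambda>s. (W0 - W s) powr (1 / p))"
proof (intro continuous_on_powr' continuous_intros contW ballI)
  fix s :: real assume s: "s \<in> {0..1}"
  show "0 \<le> W0 - W s \<and> (W0 - W s = 0 \<longrightarrow> 0 < 1 / p)"
    using s p1 W_0 W_less_top[of s] by (cases "s = 0") auto
qed

lemma well_bound:
  obtains C s1 where "0 < C" "0 < s1" "s1 < 1" "\<And>s. s1 < s \<Longrightarrow> s < 1 \<Longrightarrow> W s \<le> C * (1 - s) powr p"
proof -
  define C where "C = C1 / p + 1"
  have "\<forall>\<^sub>F s in at_left 1. W s / (1 - s) powr p < C"
    by (rule order_tendstoD(2)[OF lim_end]) (simp add: C_def)
  then obtain b where b: "b < 1" "\<And>s. b < s \<Longrightarrow> s < 1 \<Longrightarrow> W s / (1 - s) powr p < C"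
    unfolding eventually_at_left_field by blast
  show thesis
  proof (rule that[of C "max (1/2) b"])
    fix s assume s: "max (1/2) b < s" "s < 1"
    then show "W s \<le> C * (1 - s) powr p"
      using b(2)[of s] by (simp add: divide_less_eq)
  qed (use C1pos p1 b in \<open>auto simp: C_def add_pos_pos\<close>)
qed

text \<open>
  The solution of energy 0 needs infinite time to reach the equilibrium 1, because
  \<open>W(s) \<le> C (1 - s)^p\<close> near 1 makes the integral of \<open>W^(-1/p)\<close> diverge logarithmically.  Here \<open>B\<close>
  is a clock whose weight \<open>G + \<kappa>\<close> has been regularised: on any compact part of \<open>[0, 1)\<close> a small
  \<open>\<kappa>\<close> costs at most a factor 2.  The bound holds for all small \<open>\<kappa>\<close>, since both halves of the well
  will use the same one.
\<close>
lemma heteroclinic_time_infinite: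
  obtains \<kappa>0 where "\<kappa>0 > 0"
    "\<And>\<kappa> B G. 0 < \<kappa> \<Longrightarrow> \<kappa> \<le> \<kappa>0 \<Longrightarrow> continuous_on {0..1} B \<Longrightarrow>
      (\<And>s. s \<in> {0<..<1} \<Longrightarrow> (B has_real_derivative 1 / ((G s + \<kappa>) * (1 - s powr p) powr (1 / p))) (at s)) \<Longrightarrow>
      (\<And>s. s \<in> {0..1} \<Longrightarrow> G ((W0 - W s) powr (1 / p) / W0 powr (1 / p)) = g s) \<Longrightarrow> M \<le> B 1 - B 0"
proof -
  obtain C s1 where C: "0 < C" "0 < s1" "s1 < 1" "\<And>s. s1 < s \<Longrightarrow> s < 1 \<Longrightarrow> W s \<le> C * (1 - s) powr p"
    using well_bound by blast
  define c where "c = 1 / (2 * C powr (1 / p))"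
  have c: "c > 0" using C by (simp add: c_def)
  \<comment> \<open>The logarithm of \<open>1 - s\<close> drops by \<open>max 1 (M / c)\<close> between \<open>s1\<close> and \<open>u1\<close>.\<close>
  define u1 where "u1 = 1 - (1 - s1) * exp (- max 1 (M / c))"
  have "exp (- max 1 (M / c)) < exp 0" by (subst exp_less_cancel_iff) auto
  then have "(1 - s1) * exp (- max 1 (M / c)) < (1 - s1) * 1" using C by (intro mult_strict_left_mono) auto
  then have u1: "s1 < u1" "u1 < 1" using C by (simp_all add: u1_def algebra_simps)
  have lnu: "c * (ln (1 - s1) - ln (1 - u1)) \<ge> M"
  proof -
    have "ln (1 - u1) = ln (1 - s1) - max 1 (M / c)" using C by (simp add: u1_def ln_mult)
    then have "M / c \<le> ln (1 - s1) - ln (1 - u1)" by simp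
    then show ?thesis using c by (simp add: field_simps)
  qed
  have "continuous_on {s1..u1} g"
    by (rule continuous_on_subset[OF slope_continuous]) (use C u1 in auto)
  then obtain x0 where x0: "x0 \<in> {s1..u1}" "\<And>x. x \<in> {s1..u1} \<Longrightarrow> g x0 \<le> g x"
    using continuous_attains_inf[of "{s1..u1}" g] u1 by auto
  \<comment> \<open>With \<open>\<kappa> \<le> g\<close> on \<open>[s1, u1]\<close>, replacing \<open>g\<close> by \<open>g + \<kappa>\<close> at most doubles it; hence the factor 2 in \<open>c\<close>.\<close>
  define \<kappa>0 where "\<kappa>0 = g x0"
  have k0: "\<kappa>0 > 0" unfolding \<kappa>0_def using slope_pos[of x0] x0 C u1 by auto
  show thesis
  proof (rule that[OF k0])
    fix \<kappa> :: real and B G :: "real \<Rightarrow> real"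
    assume k: "0 < \<kappa>" and kk0: "\<kappa> \<le> \<kappa>0" and contB: "continuous_on {0..1} B"
      and derB: "\<And>s. s \<in> {0<..<1} \<Longrightarrow> (B has_real_derivative 1 / ((G s + \<kappa>) * (1 - s powr p) powr (1 / p))) (at s)"
      and G: "\<And>s. s \<in> {0..1} \<Longrightarrow> G ((W0 - W s) powr (1 / p) / W0 powr (1 / p)) = g s"
    define w where "w s = (W0 - W s) powr (1 / p) / W0 powr (1 / p)" for s
    have R: "W0 powr (1 / p) > 0" using W0pos by simp
    have contw: "continuous_on {0..1} w"
      unfolding w_def using R by (intro continuous_intros root_continuous) auto
    have w0: "w 0 = 0" and w1: "w 1 = 1" using W_0 W_1 R by (auto simp: w_def)
    have w_mono: "w s < w t" if "0 \<le> s" "s < t" "t \<le> 1" for s t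
    proof -
      have "(W0 - W s) powr (1 / p) < (W0 - W t) powr (1 / p)"
        using W_decreasing[of s t] that W_0 W_less_top[of s] p1
        by (intro powr_less_mono2) (cases "s = 0"; auto)+
      then show ?thesis using R by (simp add: w_def divide_strict_right_mono)
    qed
    have w_in: "w s \<in> {0<..<1}" if "0 < s" "s < 1" for s
      using w_mono[of 0 s] w_mono[of s 1] w0 w1 that by auto
    have Gpos: "G x > 0" if x: "x \<in> {0<..<1}" for x
    proof -
      obtain s where s: "0 \<le> s" "s \<le> 1" "w s = x"
        using IVT'[of w 0 x 1] contw w0 w1 x by auto
      have "s \<noteq> 1" using s w1 x by auto
      then show ?thesis using G[of s] slope_pos[of s] s by (auto simp: w_def)
    qed
    have Bmono: "B x \<le> B y" if "0 \<le> x" "x \<le> y" "y \<le> 1" for x y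
    proof (rule DERIV_nonneg_imp_increasing_open[OF that(2)])
      show "continuous_on {x..y} B" by (rule continuous_on_subset[OF contB]) (use that in auto)
      show "\<exists>l. DERIV B t :> l \<and> l \<ge> 0" if "x < t" "t < y" for t
        using derB[of t] Gpos[of t] k that \<open>0 \<le> x\<close> \<open>y \<le> 1\<close>
        by (intro exI[of _ "1 / ((G t + \<kappa>) * (1 - t powr p) powr (1 / p))"]) auto
    qed
    have "B (w s1) + c * ln (1 - s1) \<le> B (w u1) + c * ln (1 - u1)"
    proof (rule DERIV_nonneg_imp_increasing_open[of s1 u1 "\<lambda>s. B (w s) + c * ln (1 - s)"])
      show "continuous_on {s1..u1} (\<lambda>s. B (w s) + c * ln (1 - s))"
      proof (intro continuous_intros)
        show "continuous_on {s1..u1} (\<lambda>s. B (w s))"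
        proof (rule continuous_on_compose2[OF contB])
          show "continuous_on {s1..u1} w" by (rule continuous_on_subset[OF contw]) (use C u1 in auto)
          show "w ` {s1..u1} \<subseteq> {0..1}" using w_in C u1 by (force simp: less_imp_le)
        qed
      qed (use u1 in auto)
      fix s assume s: "s1 < s" "s < u1"
      then have s01: "0 < s" "s < 1" using C u1 by auto
      have dw: "(w has_real_derivative g s / W0 powr (1 / p)) (at s)"
        unfolding w_def by (intro DERIV_cdivide root_derivative s01)
      have "((\<lambda>s. B (w s)) has_real_derivative
          1 / ((G (w s) + \<kappa>) * (1 - w s powr p) powr (1 / p)) * (g s / W0 powr (1 / p))) (at s)"
        using DERIV_chain2[OF derB[OF w_in[OF s01]] dw] .
      moreover have Gw: "G (w s) = g s" using G[of s] s01 by (simp add: w_def)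
      moreover have "(1 - w s powr p) powr (1 / p) * W0 powr (1 / p) = W s powr (1 / p)"
      proof -
        have "w s powr p = (W0 - W s) / W0"
          using W_less_top[of s] s01 W0pos p1 unfolding w_def by (simp add: powr_divide powr_powr)
        then have e: "1 - w s powr p = W s / W0" using W0pos by (simp add: field_simps)
        have "(1 - w s powr p) powr (1 / p) * W0 powr (1 / p) = (W s / W0 * W0) powr (1 / p)"
          unfolding e by (rule powr_mult[symmetric])
        then show ?thesis using W0pos by simp
      qed
      ultimately have dB: "((\<lambda>s. B (w s)) has_real_derivative g s / ((g s + \<kappa>) * W s powr (1 / p))) (at s)"
        by (simp add: mult.assoc)
      have dl: "((\<lambda>s. c * ln (1 - s)) has_real_derivative - (c / (1 - s))) (at s)"
        using s01 by (auto intro!: derivative_eq_intros)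
      have gk: "\<kappa> \<le> g s" "0 < g s" using x0(2)[of s] s k kk0 by (auto simp: \<kappa>0_def)
      have "W s powr (1 / p) \<le> (C * (1 - s) powr p) powr (1 / p)"
        using C(4)[of s] s s01 W_pos[of s] p1 by (intro powr_mono2) auto
      also have "\<dots> = C powr (1 / p) * (1 - s)"
        using C s01 p1 by (simp add: powr_mult powr_powr)
      finally have Wle: "W s powr (1 / p) \<le> C powr (1 / p) * (1 - s)" .
      have "c / (1 - s) = 1 / 2 * (1 / (C powr (1 / p) * (1 - s)))" by (simp add: c_def)
      also have "\<dots> \<le> g s / (g s + \<kappa>) * (1 / W s powr (1 / p))"
        using gk k Wle W_pos[of s] s01 C
        by (intro mult_mono divide_left_mono) (auto simp: field_simps)
      finally have "0 \<le> g s / ((g s + \<kappa>) * W s powr (1 / p)) + - (c / (1 - s))" by simp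
      then show "\<exists>l. DERIV (\<lambda>s. B (w s) + c * ln (1 - s)) s :> l \<and> l \<ge> 0"
        using DERIV_add[OF dB dl] by blast
    qed (use u1 in auto)
    then have "M \<le> B (w u1) - B (w s1)" using lnu by (simp add: algebra_simps)
    also have "\<dots> \<le> B 1 - B 0"
      using Bmono[of "w u1" 1] Bmono[of 0 "w s1"] w_in[of u1] w_in[of s1] C u1 by auto
    finally show "M \<le> B 1 - B 0" .
  qed
qed

end

section \<open>The whole well and its period\<close>

locale potential =
  fixes p :: real and W W' :: "real \<Rightarrow> real" and Cm1 C0 C1 W0 :: real
  assumes p1: "p > 1"
    and der: "\<And>s. s \<in> {-1..1} \<Longrightarrow> (W has_real_derivative W' s) (at s within {-1..1})"
    and contW': "continuous_on {-1..1} W'"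
    and W1: "W1 p W Cm1 C0 C1 W0"
    and anti: "strict_antimono_on {-1..<0} (\<lambda>u. W' u / phi p u)"
    and mono: "strict_mono_on {0<..1} (\<lambda>u. W' u / phi p u)"
begin

lemma constants_pos: "Cm1 > 0" "C0 > 0" "C1 > 0" "W0 > 0"
  using W1 by (auto simp: W1_def)

lemma phi_pos_eq: "0 < s \<Longrightarrow> phi p s = s powr (p - 1)"
  by (simp add: phi_def powr_diff power2_eq_square field_simps)

lemma top_limit: "((\<lambda>s. (W0 - W s) / \<bar>s\<bar> powr p) \<longlongrightarrow> C0 / p) (at 0)"
proof -
  have "((\<lambda>u. (W u - (W0 - C0 / p * \<bar>u\<bar> powr p)) / \<bar>u\<bar> powr p) \<longlongrightarrow> 0) (at 0)"
    using W1 by (auto simp: W1_def intro: smalloD_tendsto)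
  then have "((\<lambda>u. C0 / p - (W u - (W0 - C0 / p * \<bar>u\<bar> powr p)) / \<bar>u\<bar> powr p) \<longlongrightarrow> C0 / p - 0) (at 0)"
    by (intro tendsto_intros)
  then have "((\<lambda>s. (W0 - W s) / \<bar>s\<bar> powr p) \<longlongrightarrow> C0 / p - 0) (at 0)"
    by (rule Lim_transform_eventually) (auto simp: eventually_at_filter field_simps)
  then show ?thesis by simp
qed

lemma end_limit:
  assumes "(\<lambda>u. W u - C / p * \<bar>u - e\<bar> powr p) \<in> o[at e within S](\<lambda>u. \<bar>u - e\<bar> powr p)"
  shows "((\<lambda>s. W s / \<bar>s - e\<bar> powr p) \<longlongrightarrow> C / p) (at e within S)"
proof -
  have "((\<lambda>u. C / p + (W u - C / p * \<bar>u - e\<bar> powr p) / \<bar>u - e\<bar> powr p) \<longlongrightarrow> C / p + 0) (at e within S)"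
    by (intro tendsto_intros smalloD_tendsto[OF assms])
  then have "((\<lambda>s. W s / \<bar>s - e\<bar> powr p) \<longlongrightarrow> C / p + 0) (at e within S)"
    by (rule Lim_transform_eventually) (auto simp: eventually_at_filter field_simps)
  then show ?thesis by simp
qed

sublocale pos: half_well p W W' W0 C0 C1
proof unfold_locales
  show "(W has_real_derivative W' s) (at s within {0..1})" if "s \<in> {0..1}" for s
    by (rule DERIV_subset[OF der]) (use that in auto)
  show "continuous_on {0..1} W'"
    by (rule continuous_on_subset[OF contW']) auto
  show "strict_mono_on {0<..1} (\<lambda>s. W' s / s powr (p - 1))"
  proof (rule strict_mono_onI)
    fix r s :: real assume "r \<in> {0<..1}" "s \<in> {0<..1}" "r < s"
    then show "W' r / r powr (p - 1) < W' s / s powr (p - 1)"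
      using strict_mono_onD[OF mono, of r s] by (simp add: phi_pos_eq)
  qed
  have "((\<lambda>s. (W0 - W s) / \<bar>s\<bar> powr p) \<longlongrightarrow> C0 / p) (at_right 0)"
    using top_limit by (simp add: filterlim_at_split)
  then show "((\<lambda>s. (W0 - W s) / s powr p) \<longlongrightarrow> C0 / p) (at_right 0)"
    by (rule Lim_transform_eventually) (auto simp: eventually_at_filter)
  have "((\<lambda>s. W s / \<bar>s - 1\<bar> powr p) \<longlongrightarrow> C1 / p) (at 1 within {-1..1})"
    using W1 by (intro end_limit) (auto simp: W1_def)
  then have "((\<lambda>s. W s / \<bar>s - 1\<bar> powr p) \<longlongrightarrow> C1 / p) (at_left 1)"
    by (simp add: at_within_Icc_at_left)
  then show "((\<lambda>s. W s / (1 - s) powr p) \<longlongrightarrow> C1 / p) (at_left 1)"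
    by (rule Lim_transform_eventually) (auto simp: eventually_at_filter)
qed (use p1 constants_pos in auto)

sublocale neg: half_well p "\<lambda>s. W (- s)" "\<lambda>s. - W' (- s)" W0 C0 Cm1
proof unfold_locales
  show "((\<lambda>s. W (- s)) has_real_derivative - W' (- s)) (at s within {0..1})" if s: "s \<in> {0..1}" for s
  proof -
    have "(W has_real_derivative W' (- s)) (at (- s) within uminus ` {0..1})"
      by (rule DERIV_subset[OF der]) (use s in auto)
    moreover have "(uminus has_real_derivative -1) (at s within {0..1})"
      by (auto intro!: derivative_eq_intros)
    ultimately show ?thesis
      using DERIV_image_chain[of W "W' (- s)" uminus s "{0..1}" "-1"] by (simp add: o_def)
  qed
  show "continuous_on {0..1} (\<lambda>s. - W' (- s))"
    by (intro continuous_intros continuous_on_compose2[OF contW']) auto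
  show "strict_mono_on {0<..1} (\<lambda>s. - W' (- s) / s powr (p - 1))"
  proof (rule strict_mono_onI)
    fix r s :: real assume rs: "r \<in> {0<..1}" "s \<in> {0<..1}" "r < s"
    have "phi p (- t) = - (t powr (p - 1))" if "t > 0" for t
      using phi_pos_eq[OF that] by (simp add: phi_def)
    then show "- W' (- r) / r powr (p - 1) < - W' (- s) / s powr (p - 1)"
      using monotone_onD[OF anti, of "- s" "- r"] rs by simp
  qed
  have "filterlim (\<lambda>s::real. - s) (at 0) (at_right 0)"
    by (auto simp: filterlim_at eventually_at_filter intro!: tendsto_eq_intros)
  from filterlim_compose[OF top_limit this]
  have "((\<lambda>s. (W0 - W (- s)) / \<bar>- s\<bar> powr p) \<longlongrightarrow> C0 / p) (at_right 0)" .
  then show "((\<lambda>s. (W0 - W (- s)) / s powr p) \<longlongrightarrow> C0 / p) (at_right 0)"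
    by (rule Lim_transform_eventually) (auto simp: eventually_at_filter)
  have e: "((\<lambda>s. W s / \<bar>s - (-1)\<bar> powr p) \<longlongrightarrow> Cm1 / p) (at (-1) within {-1..1})"
    using W1 by (intro end_limit) (auto simp: W1_def)
  have "\<forall>\<^sub>F s in at_left 1. s \<in> {0<..<1::real}"
    by (intro eventually_at_leftI[of 0]) auto
  then have "\<forall>\<^sub>F s::real in at_left 1. - s \<in> {-1..1} \<and> - s \<noteq> -1"
    by eventually_elim auto
  then have "filterlim (\<lambda>s::real. - s) (at (-1) within {-1..1}) (at_left 1)"
    by (auto simp: filterlim_at intro!: tendsto_eq_intros)
  from filterlim_compose[OF e this]
  have "((\<lambda>s. W (- s) / \<bar>- s - (-1)\<bar> powr p) \<longlongrightarrow> Cm1 / p) (at_left 1)" .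
  then show "((\<lambda>s. W (- s) / (1 - s) powr p) \<longlongrightarrow> Cm1 / p) (at_left 1)"
    by (rule Lim_transform_eventually) (auto simp: eventually_at_filter)
qed (use p1 constants_pos in auto)

abbreviation "g \<equiv> slope p C0 W0 W W'"

text \<open>
  In the coordinate \<open>w\<close> the potential is \<open>W0 - |w|^p\<close>, so that the level sets of the energy become
  \<open>p\<close>-circles; \<open>R\<close> is the radius that belongs to energy 0.  The anharmonicity of \<open>W\<close> is then encoded
  in \<open>\<gamma>\<close>, which is \<open>w'\<close> as a function of \<open>w\<close>: it is positive inside \<open>(-R, R)\<close> and makes the
  angular speed depend on the position.
\<close>
definition w :: "real \<Rightarrow> real" where
  "w s = sgn s * (W0 - W s) powr (1 / p)"

definition R :: real where "R = W0 powr (1 / p)"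

definition \<gamma> :: "real \<Rightarrow> real" where
  "\<gamma> x = g (inv_into {-1..1} w x)"

lemma neg_slope: "neg.g s = g (- s)"
  by (simp add: slope_def)

lemma R_pos: "R > 0"
  using constants_pos by (simp add: R_def)

lemma contW: "continuous_on {-1..1} W"
  using der by (rule DERIV_continuous_on)

lemma W_0: "W 0 = W0" by (rule pos.W_0)

lemma W_nonneg: "s \<in> {-1..1} \<Longrightarrow> W s \<ge> 0"
  using pos.W_pos[of s] neg.W_pos[of "- s"] pos.W_1 neg.W_1
  by (cases "s \<ge> 0"; cases "s = 1"; cases "s = -1") auto

lemma W_le: "s \<in> {-1..1} \<Longrightarrow> W s \<le> W0"
  using pos.W_less_top[of s] neg.W_less_top[of "- s"] W_0
  by (cases "s = 0"; cases "s \<ge> 0") auto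

lemma W_less: "s \<in> {-1..1} \<Longrightarrow> s \<noteq> 0 \<Longrightarrow> W s < W0"
  using pos.W_less_top[of s] neg.W_less_top[of "- s"] by (cases "s \<ge> 0") auto

lemma W'_sign:
  assumes "s \<in> {-1<..<1}"
  shows "sgn (W' s) = - sgn s \<or> s = 0"
  using pos.W'_neg[of s] neg.W'_neg[of "- s"] assms
  by (cases s "0::real" rule: linorder_cases) auto

lemma w_pos_half: "s \<ge> 0 \<Longrightarrow> w s = (W0 - W s) powr (1 / p)"
  using W_0 by (cases "s = 0") (auto simp: w_def)

lemma w_neg_half: "s \<le> 0 \<Longrightarrow> w s = - ((W0 - W s) powr (1 / p))"
  using W_0 by (cases "s = 0") (auto simp: w_def)

lemma w_0: "w 0 = 0" by (simp add: w_def)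

lemma w_ends: "w 1 = R" "w (-1) = - R"
  using pos.W_1 neg.W_1 by (simp_all add: w_def R_def)

lemma abs_w: "\<bar>w s\<bar> = (W0 - W s) powr (1 / p)"
  using W_0 by (cases "s = 0") (auto simp: w_def abs_mult)

lemma abs_w_powr: "s \<in> {-1..1} \<Longrightarrow> \<bar>w s\<bar> powr p = W0 - W s"
  using W_le[of s] p1 by (simp add: abs_w powr_powr)

lemma sgn_w: "s \<in> {-1..1} \<Longrightarrow> sgn (w s) = sgn s"
  using W_less[of s] by (cases "s = 0") (auto simp: w_def sgn_mult)

lemma interval_halves: "{-1..1::real} = {-1..0} \<union> {0..1}" by auto

lemma w_continuous: "continuous_on {-1..1} w"
  unfolding interval_halves
proof (rule continuous_on_closed_Un)
  show "continuous_on {0..1} w"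
    using pos.root_continuous by (rule continuous_on_eq) (simp add: w_pos_half)
  have "continuous_on {-1..0} (\<lambda>s. - ((W0 - W (- (- s))) powr (1 / p)))"
    by (intro continuous_intros continuous_on_compose2[OF neg.root_continuous, of _ uminus]) auto
  then show "continuous_on {-1..0} w"
    by (rule continuous_on_eq) (simp add: w_neg_half)
qed auto

lemma slope_continuous: "continuous_on {-1..1} g"
  unfolding interval_halves
proof (rule continuous_on_closed_Un)
  have "continuous_on {-1..0} (\<lambda>s. neg.g (- s))"
    by (intro continuous_intros continuous_on_compose2[OF neg.slope_continuous, of _ uminus]) auto
  then show "continuous_on {-1..0} g"
    by (rule continuous_on_eq) (simp add: neg_slope)
qed (use pos.slope_continuous in auto)

lemma slope_pos: "s \<in> {-1<..<1} \<Longrightarrow> g s > 0"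
  using pos.slope_pos[of s] neg.slope_pos[of "- s"] neg_slope[of "- s"] by (cases "s \<ge> 0") auto

lemma slope_nonneg: "g s \<ge> 0"
  using p1 by (simp add: slope_def)

lemma w_derivative:
  assumes "s \<in> {-1<..<1}" "s \<noteq> 0"
  shows "(w has_real_derivative g s) (at s)"
proof (cases "s > 0")
  case True
  have "((\<lambda>s. (W0 - W s) powr (1 / p)) has_real_derivative g s) (at s)"
    using pos.root_derivative[of s] True assms by auto
  then show ?thesis
    by (rule has_field_derivative_transform_within_open[where S="{0<..}"])
      (use True in \<open>auto simp: w_pos_half\<close>)
next
  case False
  have "((\<lambda>s. (W0 - W (- s)) powr (1 / p)) has_real_derivative g s) (at (- s))"
    using neg.root_derivative[of "- s"] False assms neg_slope[of "- s"] by auto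
  then have "((\<lambda>s. (W0 - W (- (- s))) powr (1 / p)) has_real_derivative g s * (-1)) (at s)"
    by (rule DERIV_chain2) (auto intro!: derivative_eq_intros)
  then have "((\<lambda>s. - ((W0 - W s) powr (1 / p))) has_real_derivative g s) (at s)"
    using DERIV_minus by fastforce
  then show ?thesis
    by (rule has_field_derivative_transform_within_open[where S="{..<0}"])
      (use False assms in \<open>auto simp: w_neg_half\<close>)
qed

lemma w_mono:
  assumes "-1 \<le> s" "s < t" "t \<le> 1"
  shows "w s < w t"
proof -
  have half: "w x < w y" if "-1 \<le> x" "x < y" "y \<le> 1" "0 \<notin> {x<..<y}" for x y
  proof (rule DERIV_pos_imp_increasing_open[OF that(2)])
    show "continuous_on {x..y} w"
      by (rule continuous_on_subset[OF w_continuous]) (use that in auto)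
    show "\<exists>l. DERIV w z :> l \<and> l > 0" if "x < z" "z < y" for z
      using w_derivative[of z] slope_pos[of z] that \<open>-1 \<le> x\<close> \<open>y \<le> 1\<close> \<open>0 \<notin> {x<..<y}\<close>
      by (intro exI[of _ "g z"]) auto
  qed
  show ?thesis
  proof (cases "0 \<in> {s<..<t}")
    case True
    then show ?thesis using half[of s 0] half[of 0 t] assms by auto
  qed (use half assms in auto)
qed

lemma w_inj: "inj_on w {-1..1}"
  by (rule linorder_inj_onI) (use w_mono in \<open>force+\<close>)

lemma w_image: "w ` {-1..1} = {-R..R}"
proof
  show "w ` {-1..1} \<subseteq> {-R..R}"
  proof clarify
    fix s :: real assume "s \<in> {-1..1}"
    then show "w s \<in> {-R..R}"
      using w_mono[of "-1" s] w_mono[of s 1] w_ends R_pos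
      by (cases "s = 1"; cases "s = -1") auto
  qed
  show "{-R..R} \<subseteq> w ` {-1..1}"
  proof
    fix x assume "x \<in> {-R..R}"
    then obtain s where "-1 \<le> s" "s \<le> 1" "w s = x"
      using IVT'[of w "-1" x 1] w_continuous w_ends by auto
    then show "x \<in> w ` {-1..1}" by force
  qed
qed

lemma \<gamma>_w: "s \<in> {-1..1} \<Longrightarrow> \<gamma> (w s) = g s"
  using w_inj by (simp add: \<gamma>_def)

lemma \<gamma>_continuous: "continuous_on {-R..R} \<gamma>"
proof -
  have "continuous_on (w ` {-1..1}) (inv_into {-1..1} w)"
    by (rule continuous_on_inv[OF w_continuous]) (use w_inj in auto)
  then show ?thesis
    unfolding \<gamma>_def[abs_def] w_image
    by (rule continuous_on_compose2[OF slope_continuous])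
      (metis image_subset_iff inv_into_into w_image)
qed

lemma \<gamma>_pos:
  assumes "x \<in> {-R<..<R}"
  shows "\<gamma> x > 0"
proof -
  have "x \<in> w ` {-1..1}" using assms w_image by auto
  then obtain s where s: "s \<in> {-1..1}" "w s = x" by auto
  then have "s \<noteq> 1" "s \<noteq> -1" using assms w_ends by auto
  then show ?thesis using s \<gamma>_w[of s] slope_pos[of s] by auto
qed

lemma \<gamma>_nonneg: "\<gamma> x \<ge> 0"
  by (simp add: \<gamma>_def slope_nonneg)

text \<open>
  The radius \<open>r0\<close> selects the energy \<open>W0 - r0^p\<close>.  Energy 0 needs the regularisation \<open>\<kappa>\<close>, because
  \<open>\<gamma>\<close> vanishes at \<open>\<plusminus>R\<close>.
\<close>
lemma scaled_clock:
  assumes "0 \<le> r0" "r0 \<le> R" "0 \<le> \<kappa>" "r0 < R \<or> 0 < \<kappa>"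
  shows "arc_clock p (\<lambda>s. \<gamma> (r0 * s) + \<kappa>)"
proof unfold_locales
  have in1: "\<bar>r0 * s\<bar> \<le> r0" if "s \<in> {-1..1}" for s
    using that assms by (auto simp: abs_mult intro!: mult_left_le)
  show "continuous_on {-1..1} (\<lambda>s. \<gamma> (r0 * s) + \<kappa>)"
    using assms in1
    by (intro continuous_intros continuous_on_compose2[OF \<gamma>_continuous]) (force simp: abs_le_iff)+
  fix s :: real assume s: "s \<in> {-1..1}"
  show "0 < \<gamma> (r0 * s) + \<kappa>"
  proof (cases "r0 < R")
    case True
    then have "\<gamma> (r0 * s) > 0" using in1[OF s] by (intro \<gamma>_pos) auto
    then show ?thesis using assms by simp
  qed (use \<gamma>_nonneg[of "r0 * s"] assms in auto)
qed (use p1 in auto)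

text \<open>
  The heteroclinic times of both halves, as statements about the regularised clock at energy 0.
\<close>
lemma arc_divergence:
  obtains \<kappa> where "\<kappa> > 0"
    "M \<le> arc p (\<lambda>s. \<gamma> (R * s) + \<kappa>) 1 - arc p (\<lambda>s. \<gamma> (R * s) + \<kappa>) 0"
    "M \<le> arc p (\<lambda>s. \<gamma> (R * s) + \<kappa>) 0"
proof -
  obtain k1 where k1: "k1 > 0"
    "\<And>\<kappa> B G. 0 < \<kappa> \<Longrightarrow> \<kappa> \<le> k1 \<Longrightarrow> continuous_on {0..1} B \<Longrightarrow>
      (\<And>s. s \<in> {0<..<1} \<Longrightarrow> (B has_real_derivative 1 / ((G s + \<kappa>) * (1 - s powr p) powr (1 / p))) (at s)) \<Longrightarrow>
      (\<And>s. s \<in> {0..1} \<Longrightarrow> G ((W0 - W s) powr (1 / p) / W0 powr (1 / p)) = g s) \<Longrightarrow> M \<le> B 1 - B 0"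
    using pos.heteroclinic_time_infinite[of M] by blast
  obtain k2 where k2: "k2 > 0"
    "\<And>\<kappa> B G. 0 < \<kappa> \<Longrightarrow> \<kappa> \<le> k2 \<Longrightarrow> continuous_on {0..1} B \<Longrightarrow>
      (\<And>s. s \<in> {0<..<1} \<Longrightarrow> (B has_real_derivative 1 / ((G s + \<kappa>) * (1 - s powr p) powr (1 / p))) (at s)) \<Longrightarrow>
      (\<And>s. s \<in> {0..1} \<Longrightarrow> G ((W0 - W (- s)) powr (1 / p) / W0 powr (1 / p)) = neg.g s) \<Longrightarrow> M \<le> B 1 - B 0"
    using neg.heteroclinic_time_infinite[of M] by blast
  define \<kappa> where "\<kappa> = min k1 k2"
  have k: "\<kappa> > 0" "\<kappa> \<le> k1" "\<kappa> \<le> k2" using k1(1) k2(1) by (auto simp: \<kappa>_def)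
  define m where "m s = \<gamma> (R * s) + \<kappa>" for s
  interpret arc_clock p m
    unfolding m_def[abs_def] using k R_pos by (intro scaled_clock) auto
  show thesis
  proof (rule that[OF k(1)]; unfold m_def[symmetric])
    show "M \<le> arc p m 1 - arc p m 0"
    proof (rule k1(2)[of \<kappa> "arc p m" "\<lambda>s. \<gamma> (R * s)"])
      show "continuous_on {0..1} (arc p m)"
        by (rule continuous_on_subset[OF arc_continuous]) auto
      show "(arc p m has_real_derivative 1 / ((\<gamma> (R * s) + \<kappa>) * (1 - s powr p) powr (1 / p))) (at s)"
        if "s \<in> {0<..<1}" for s
        using arc_derivative[of s] that by (simp add: arc_density_def m_def)
      show "\<gamma> (R * ((W0 - W s) powr (1 / p) / W0 powr (1 / p))) = g s" if "s \<in> {0..1}" for s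
        using \<gamma>_w[of s] that w_pos_half[of s] R_pos by (simp add: R_def)
    qed (use k in auto)
    have "M \<le> - arc p m (- 1) - - arc p m (- 0)"
    proof (rule k2(2)[of \<kappa> "\<lambda>s. - arc p m (- s)" "\<lambda>s. \<gamma> (- R * s)"])
      show "continuous_on {0..1} (\<lambda>s. - arc p m (- s))"
        by (intro continuous_intros continuous_on_compose2[OF arc_continuous]) auto
      fix s :: real
      show "((\<lambda>s. - arc p m (- s)) has_real_derivative 1 / ((\<gamma> (- R * s) + \<kappa>) * (1 - s powr p) powr (1 / p))) (at s)"
        if s: "s \<in> {0<..<1}"
      proof -
        have "((\<lambda>s. arc p m (- s)) has_real_derivative arc_density p m (- s) * (-1)) (at s)"
          by (rule DERIV_chain2[OF arc_derivative]) (use s in \<open>auto intro!: derivative_eq_intros\<close>)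
        then have "((\<lambda>s. - arc p m (- s)) has_real_derivative arc_density p m (- s)) (at s)"
          using DERIV_minus by fastforce
        then show ?thesis using s by (simp add: arc_density_def m_def)
      qed
      show "\<gamma> (- R * ((W0 - W (- s)) powr (1 / p) / W0 powr (1 / p))) = neg.g s" if "s \<in> {0..1}"
        using \<gamma>_w[of "- s"] that w_neg_half[of "- s"] R_pos neg_slope[of s] by (simp add: R_def)
    qed (use k in auto)
    then show "M \<le> arc p m 0" using arc_minus_one by simp
  qed
qed

lemma conj_exp_pos: "conj_exp p > 0"
  using p1 by (simp add: conj_exp_def)

text \<open>
  The substitution \<open>\<sigma> = w(s) / r0\<close> in the period integral: \<open>d\<sigma> = w'(s) ds / r0\<close>, and
  \<open>(W(s) - \<xi>)^(1/p) = r0 (1 - |\<sigma>|^p)^(1/p)\<close>.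
\<close>
lemma period_interior:
  assumes "0 < \<xi>" "\<xi> < W0" and r0: "r0 = (W0 - \<xi>) powr (1 / p)"
  shows "period p W C0 W0 \<xi> = ereal (2 * arc p (\<lambda>s. \<gamma> (r0 * s)) 1 / conj_exp p powr (1 / p))"
proof -
  have r0': "0 < r0" "r0 < R"
    using assms p1 by (auto simp: R_def intro!: powr_less_mono2)
  have r0p: "r0 powr p = W0 - \<xi>" using assms p1 by (simp add: powr_powr)
  define m where "m s = \<gamma> (r0 * s)" for s
  interpret arc_clock p m
    using scaled_clock[of r0 0] r0' by (simp add: m_def[abs_def])
  have "\<exists>s\<ge>0. s \<le> 1 \<and> W s = \<xi>"
    using IVT2'[of W 1 \<xi> 0] pos.W_1 W_0 assms pos.contW by auto
  then obtain hp where hp: "0 \<le> hp" "hp \<le> 1" "W hp = \<xi>" by auto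
  have hp': "0 < hp" "hp < 1"
    using hp assms W_0 pos.W_1 by (metis less_eq_real_def order_less_irrefl)+
  have "\<exists>s\<ge>-1. s \<le> 0 \<and> W s = \<xi>"
    using IVT'[of W "-1" \<xi> 0] neg.W_1 W_0 assms continuous_on_subset[OF contW, of "{-1..0}"] by auto
  then obtain hm where hm: "-1 \<le> hm" "hm \<le> 0" "W hm = \<xi>" by auto
  have hm': "-1 < hm" "hm < 0"
    using hm assms W_0 neg.W_1 by (metis less_eq_real_def order_less_irrefl)+
  have "h_plus W \<xi> = hp"
    unfolding h_plus_def
  proof (rule the_equality)
    fix s assume s: "0 < s \<and> s < 1 \<and> W s = \<xi>"
    then show "s = hp"
      using pos.W_decreasing[of s hp] pos.W_decreasing[of hp s] hp hp' by (cases s hp rule: linorder_cases) auto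
  qed (use hp hp' in auto)
  moreover have "h_minus W \<xi> = hm"
    unfolding h_minus_def
  proof (rule the_equality)
    fix s assume s: "- 1 < s \<and> s < 0 \<and> W s = \<xi>"
    then show "s = hm"
      using neg.W_decreasing[of "- s" "- hm"] neg.W_decreasing[of "- hm" "- s"] hm hm'
      by (cases s hm rule: linorder_cases) auto
  qed (use hm hm' in auto)
  moreover have whp: "w hp = r0" "w hm = - r0"
    using hp hm w_pos_half[of hp] w_neg_half[of hm] r0 by auto
  define c where "c = conj_exp p powr (1 / p)"
  have c: "c > 0" using conj_exp_pos by (simp add: c_def)
  \<comment> \<open>The point 0 is excepted because \<open>w_derivative\<close> leaves it out; continuity there is enough.\<close>
  have "((\<lambda>s. 1 / (conj_exp p * (W s - \<xi>)) powr (1 / p)) has_integral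
      arc p m (w hp / r0) / c - arc p m (w hm / r0) / c) {hm..hp}"
  proof (rule fundamental_theorem_of_calculus_interior_strong[of "{0}"])
    have win: "w s / r0 \<in> {-1<..<1}" if "s \<in> {hm<..<hp}" for s
      using w_mono[of hm s] w_mono[of s hp] that whp hp' hm' r0' by (auto simp: field_simps)
    have win': "w s / r0 \<in> {-1..1}" if "s \<in> {hm..hp}" for s
      using win[of s] that whp r0' by (cases "s = hm"; cases "s = hp") auto
    show "continuous_on {hm..hp} (\<lambda>s. arc p m (w s / r0) / c)"
      using c r0' win'
      by (intro continuous_intros continuous_on_compose2[OF arc_continuous]
          continuous_on_subset[OF w_continuous]) (use hp hm in auto)
    fix s assume s: "s \<in> {hm<..<hp} - {0}"
    then have s1: "s \<in> {-1<..<1}" "s \<noteq> 0" using hp hm by auto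
    have dw: "((\<lambda>s. w s / r0) has_real_derivative g s / r0) (at s)"
      by (intro DERIV_cdivide w_derivative s1)
    have "((\<lambda>s. arc p m (w s / r0) / c) has_real_derivative
        arc_density p m (w s / r0) * (g s / r0) / c) (at s)"
      by (intro DERIV_cdivide DERIV_chain2[OF arc_derivative dw] win) (use s in auto)
    moreover have "arc_density p m (w s / r0) * (g s / r0) / c = 1 / (conj_exp p * (W s - \<xi>)) powr (1 / p)"
    proof -
      have "m (w s / r0) = g s" using r0' \<gamma>_w[of s] s1 by (simp add: m_def)
      moreover have gs: "g s > 0" using slope_pos s1 by auto
      moreover have "\<bar>w s / r0\<bar> powr p = (W0 - W s) / (W0 - \<xi>)"
        using abs_w_powr[of s] s1 r0' r0p by (simp add: abs_divide powr_divide)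
      then have "1 - \<bar>w s / r0\<bar> powr p = (W s - \<xi>) / (W0 - \<xi>)"
        using assms by (simp add: field_simps)
      moreover have "((W s - \<xi>) / (W0 - \<xi>)) powr (1 / p) * r0 = (W s - \<xi>) powr (1 / p)"
        using assms by (simp add: powr_divide)
      moreover have "(conj_exp p * (W s - \<xi>)) powr (1 / p) = c * (W s - \<xi>) powr (1 / p)"
        by (simp add: powr_mult c_def)
      ultimately show ?thesis
        unfolding arc_density_def by (simp add: mult.commute mult.left_commute)
    qed
    ultimately show "((\<lambda>s. arc p m (w s / r0) / c) has_vector_derivative
        1 / (conj_exp p * (W s - \<xi>)) powr (1 / p)) (at s)"
      by (simp add: has_real_derivative_iff_has_vector_derivative)
  qed (use hp' hm' in auto)
  then have "integral {hm..hp} (\<lambda>s. 1 / (conj_exp p * (W s - \<xi>)) powr (1 / p)) = arc p m 1 / c"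
    using whp r0' arc_minus_one by (simp add: integral_unique)
  ultimately show ?thesis
    using assms by (simp add: period_def m_def[abs_def] c_def)
qed

text \<open>
  At radius 0 the weight is the constant \<open>\<gamma>(0) = (C0 / p)^(1/p)\<close>, and the clock is a multiple of the
  arcsine in the definition of \<open>pi_p\<close>.
\<close>
lemma period_top: "period p W C0 W0 W0 = ereal (2 * arc p (\<lambda>s. \<gamma> (0 * s)) 1 / conj_exp p powr (1 / p))"
proof -
  define m where "m s = \<gamma> (0 * s)" for s
  interpret arc_clock p m
    using scaled_clock[of 0 0] R_pos by (simp add: m_def[abs_def])
  define I where "I = integral {0..1} (\<lambda>s. 1 / (1 - s powr p) powr (1 / p))"
  have m: "m s = (C0 / p) powr (1 / p)" for s
    using \<gamma>_w[of 0] w_0 by (simp add: m_def slope_def)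
  have "arc p m 1 = integral {-1..0} (arc_density p m) + integral {0..1} (arc_density p m)"
    unfolding arc_def by (rule Henstock_Kurzweil_Integration.integral_combine[symmetric])
      (use arc_density_integrable in auto)
  also have "integral {-1..0} (arc_density p m) = integral {0..1} (arc_density p m)"
  proof -
    have "integral {-1..-0} (\<lambda>s. arc_density p m (- s)) = integral {0..1} (arc_density p m)"
      by (rule Henstock_Kurzweil_Integration.integral_reflect_real)
    moreover have "arc_density p m (- s) = arc_density p m s" for s
      by (simp add: arc_density_def m)
    ultimately show ?thesis by simp
  qed
  also have "integral {0..1} (arc_density p m) = integral {0..1} (\<lambda>s. 1 / (C0 / p) powr (1 / p) * (1 / (1 - s powr p) powr (1 / p)))"
    by (rule Henstock_Kurzweil_Integration.integral_cong) (simp add: arc_density_def m)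
  also have "\<dots> = I / (C0 / p) powr (1 / p)"
    unfolding I_def by (subst Henstock_Kurzweil_Integration.integral_mult_right) simp
  finally have arc: "arc p m 1 = 2 * I / (C0 / p) powr (1 / p)" by simp
  have "conj_exp p powr (1 / p) * (p - 1) powr (1 / p) = p powr (1 / p)"
    using p1 by (simp add: powr_mult[symmetric] conj_exp_def)
  then have "(p - 1) powr (1 / p) = p powr (1 / p) / conj_exp p powr (1 / p)"
    using conj_exp_pos by (simp add: field_simps)
  then have "2 * pi_p p / C0 powr (1 / p) = 2 * (2 * I / (C0 / p) powr (1 / p)) / conj_exp p powr (1 / p)"
    by (simp add: pi_p_def I_def powr_divide mult.commute)
  then show ?thesis
    using constants_pos arc by (simp add: period_def m_def[abs_def])
qed

end

section \<open>A single solution\<close>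

lemma phi_abs: "\<bar>phi p s\<bar> = \<bar>s\<bar> powr (p - 1)"
  by (cases "s = 0") (simp_all add: phi_def abs_mult powr_diff power2_eq_square field_simps)

lemma phi_sgn: "sgn (phi p s) = sgn s"
  by (cases "s = 0") (simp_all add: phi_def sgn_mult)

lemma phi_mult: "c > 0 \<Longrightarrow> phi p (c * s) = c powr (p - 1) * phi p s"
  by (cases "s = 0") (simp_all add: phi_def abs_mult powr_mult powr_diff power2_eq_square field_simps)

text \<open>
  The inverse of \<open>\<phi>\<^sub>p\<close> is \<open>\<phi>\<close> for the conjugate exponent.
\<close>
lemma phi_conj:
  assumes "p > 1"
  shows "phi (conj_exp p) (phi p s) = s"
proof (cases "s = 0")
  case False
  have e: "(p - 1) * (conj_exp p - 2) + (p - 2) = 0"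
    using assms by (simp add: conj_exp_def field_simps)
  have "\<bar>phi p s\<bar> powr (conj_exp p - 2) * \<bar>s\<bar> powr (p - 2) = \<bar>s\<bar> powr 0"
    unfolding phi_abs powr_powr powr_add[symmetric] e ..
  then have "\<bar>phi p s\<bar> powr (conj_exp p - 2) * \<bar>s\<bar> powr (p - 2) = 1" using False by simp
  then have "\<bar>phi p s\<bar> powr (conj_exp p - 2) * \<bar>s\<bar> powr (p - 2) * s = s" by simp
  then show ?thesis
    by (simp add: phi_def mult.assoc)
qed (simp add: phi_def)

lemma abs_powr_derivative:
  assumes "q > (1::real)"
  shows "((\<lambda>x. \<bar>x\<bar> powr q) has_real_derivative q * phi q x) (at x)"
proof (cases x "0::real" rule: linorder_cases)
  case greater
  have "((\<lambda>x. x powr q) has_real_derivative q * x powr (q - 1)) (at x)"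
    using greater by (auto intro!: derivative_eq_intros)
  then have "((\<lambda>x. \<bar>x\<bar> powr q) has_real_derivative q * x powr (q - 1)) (at x)"
    by (rule has_field_derivative_transform_within_open[where S="{0<..}"]) (use greater in auto)
  moreover have "phi q x = x powr (q - 1)"
    using greater by (simp add: phi_def powr_diff power2_eq_square field_simps)
  ultimately show ?thesis by simp
next
  case less
  have "((\<lambda>x. (- x) powr q) has_real_derivative - (q * (- x) powr (q - 1))) (at x)"
    using less by (auto intro!: derivative_eq_intros)
  then have "((\<lambda>x. \<bar>x\<bar> powr q) has_real_derivative - (q * (- x) powr (q - 1))) (at x)"
    by (rule has_field_derivative_transform_within_open[where S="{..<0}"]) (use less in auto)
  moreover have "phi q x = - ((- x) powr (q - 1))"
    using less by (simp add: phi_def powr_diff power2_eq_square field_simps)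
  ultimately show ?thesis by simp
next
  case equal
  have "((\<lambda>y. \<bar>y\<bar> powr (q - 1) * sgn y) \<longlongrightarrow> 0) (at 0)"
  proof (rule tendsto_rabs_zero_cancel)
    have "((\<lambda>y::real. \<bar>y\<bar> powr (q - 1)) \<longlongrightarrow> \<bar>0\<bar> powr (q - 1)) (at 0)"
      using assms by (intro tendsto_powr' tendsto_intros) auto
    then have "((\<lambda>y::real. \<bar>y\<bar> powr (q - 1)) \<longlongrightarrow> 0) (at 0)" using assms by simp
    then show "((\<lambda>y::real. \<bar>\<bar>y\<bar> powr (q - 1) * sgn y\<bar>) \<longlongrightarrow> 0) (at 0)"
      by (rule Lim_transform_eventually) (auto simp: eventually_at_filter abs_mult)
  qed
  then have "((\<lambda>y. (\<bar>y\<bar> powr q - \<bar>0\<bar> powr q) / (y - 0)) \<longlongrightarrow> 0) (at 0)"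
    by (rule Lim_transform_eventually)
      (auto simp: eventually_at_filter powr_diff sgn_if field_simps)
  then show ?thesis
    using equal by (simp add: has_field_derivative_iff phi_def)
qed

lemma chain_within:
  fixes f h :: "real \<Rightarrow> real"
  assumes "(f has_real_derivative d) (at (h x) within T)" "(h has_real_derivative e) (at x within S)"
    and "h ` S \<subseteq> T"
  shows "((\<lambda>x. f (h x)) has_real_derivative d * e) (at x within S)"
  using DERIV_image_chain[OF DERIV_subset[OF assms(1,3)] assms(2)] by (simp add: o_def)

text \<open>
  Solutions are described by \<open>u\<close> and its derivative \<open>du\<close>; the constant \<open>K\<close> bounds the logarithmic
  derivative of the weight.
\<close>
locale oscillator = potential +
  fixes a a' u du :: "real \<Rightarrow> real" and \<epsilon> K :: real
  assumes eps: "\<epsilon> > 0" and apos: "\<And>x. x \<in> {0..1} \<Longrightarrow> a x > 0"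
    and a_der: "\<And>x. x \<in> {0..1} \<Longrightarrow> (a has_real_derivative a' x) (at x within {0..1})"
    and a'_bound: "\<And>x. x \<in> {0..1} \<Longrightarrow> \<bar>a' x\<bar> \<le> K * a x"
    and u_der: "\<And>x. x \<in> {0..1} \<Longrightarrow> (u has_real_derivative du x) (at x within {0..1})"
    and du_cont: "continuous_on {0..1} du"
    and u_range: "\<And>x. x \<in> {0..1} \<Longrightarrow> u x \<in> {-1..1}"
    and ode: "\<And>x. x \<in> {0..1} \<Longrightarrow>
      ((\<lambda>x. phi p (\<epsilon> * du x)) has_real_derivative a x * W' (u x) / \<epsilon>) (at x within {0..1})"
    and nontrivial: "\<exists>x\<in>{0..1}. u x \<noteq> 0"
begin

text \<open>
  The energy is \<open>W(u) - kin\<close>, so \<open>D\<close> is its depth below \<open>W0\<close>.  By \<open>|w(u)|^p + kin = D\<close>, the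
  number \<open>\<sigma>\<close> is the first coordinate of a point on the \<open>p\<close>-circle.
\<close>
definition kin :: "real \<Rightarrow> real" where
  "kin x = \<bar>\<epsilon> * du x\<bar> powr p / (conj_exp p * a x)"

definition D :: "real \<Rightarrow> real" where
  "D x = W0 - W (u x) + kin x"

definition \<sigma> :: "real \<Rightarrow> real" where
  "\<sigma> x = w (u x) / D x powr (1 / p)"

lemma u_cont: "continuous_on {0..1} u"
  using u_der by (rule DERIV_continuous_on)

lemma kin_nonneg: "x \<in> {0..1} \<Longrightarrow> kin x \<ge> 0"
  using apos[of x] conj_exp_pos by (simp add: kin_def)

lemma kin_pos: "x \<in> {0..1} \<Longrightarrow> du x \<noteq> 0 \<Longrightarrow> kin x > 0"
  using apos[of x] conj_exp_pos eps by (simp add: kin_def)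

lemma kin_le_D: "x \<in> {0..1} \<Longrightarrow> kin x \<le> D x"
  using W_le[OF u_range[of x]] by (simp add: D_def)

lemma K_nonneg: "K \<ge> 0"
proof -
  have "0 \<le> K * a 0" using a'_bound[of 0] by simp
  then show ?thesis using apos[of 0] by (simp add: zero_le_mult_iff)
qed

text \<open>
  Only \<open>v = \<phi>\<^sub>p(\<epsilon> u')\<close> is differentiable, whereas \<open>u'\<close> need not be.  The power is therefore
  rewritten as \<open>|v|^q\<close> for the conjugate exponent \<open>q > 1\<close>, which is differentiable also at 0.
\<close>
lemma kinetic_derivative:
  assumes x: "x \<in> {0..1}"
  shows "((\<lambda>x. \<bar>\<epsilon> * du x\<bar> powr p) has_real_derivative conj_exp p * (du x * (a x * W' (u x)))) (at x within {0..1})"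
proof -
  have q: "conj_exp p > 1" using p1 by (simp add: conj_exp_def)
  have "((\<lambda>x. \<bar>phi p (\<epsilon> * du x)\<bar> powr conj_exp p) has_real_derivative
     conj_exp p * phi (conj_exp p) (phi p (\<epsilon> * du x)) * (a x * W' (u x) / \<epsilon>)) (at x within {0..1})"
    by (rule DERIV_chain2[OF abs_powr_derivative[OF q] ode[OF x]])
  moreover have "\<bar>phi p s\<bar> powr conj_exp p = \<bar>s\<bar> powr p" for s
    using p1 by (simp add: phi_abs powr_powr conj_exp_def)
  ultimately show ?thesis
    using eps by (simp add: phi_conj[OF p1] mult.assoc)
qed

lemma kin_derivative:
  assumes x: "x \<in> {0..1}"
  shows "(kin has_real_derivative du x * W' (u x) - a' x / a x * kin x) (at x within {0..1})"
proof -
  have "(kin has_real_derivative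
     (conj_exp p * (du x * (a x * W' (u x))) * (conj_exp p * a x) - \<bar>\<epsilon> * du x\<bar> powr p * (conj_exp p * a' x))
       / ((conj_exp p * a x) * (conj_exp p * a x))) (at x within {0..1})"
    unfolding kin_def[abs_def]
    by (rule DERIV_divide[OF kinetic_derivative[OF x] DERIV_cmult[OF a_der[OF x]]])
      (use apos[OF x] conj_exp_pos in simp)
  moreover have "(conj_exp p * (du x * (a x * W' (u x))) * (conj_exp p * a x) - \<bar>\<epsilon> * du x\<bar> powr p * (conj_exp p * a' x))
       / ((conj_exp p * a x) * (conj_exp p * a x)) = du x * W' (u x) - a' x / a x * kin x"
    using apos[OF x] conj_exp_pos by (simp add: kin_def field_simps)
  ultimately show ?thesis by simp
qed

text \<open>
  The terms with \<open>W'\<close> cancel; the energy changes only because the weight does.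
\<close>
lemma D_derivative:
  assumes x: "x \<in> {0..1}"
  shows "(D has_real_derivative - (a' x / a x * kin x)) (at x within {0..1})"
proof -
  have "((\<lambda>x. W (u x)) has_real_derivative W' (u x) * du x) (at x within {0..1})"
    by (rule chain_within[OF der[OF u_range[OF x]] u_der[OF x]]) (use u_range in auto)
  from DERIV_add[OF DERIV_diff[OF DERIV_const[of W0] this] kin_derivative[OF x]]
  show ?thesis unfolding D_def[abs_def] by (simp add: mult.commute)
qed

lemma D_cont: "continuous_on {0..1} D"
  using D_derivative by (rule DERIV_continuous_on)

lemma D_derivative_bound:
  assumes x: "x \<in> {0..1}"
  shows "\<bar>a' x / a x * kin x\<bar> \<le> K * D x"
proof -
  have "\<bar>a' x / a x\<bar> \<le> K"
    using a'_bound[OF x] apos[OF x] by (simp add: abs_divide divide_le_eq)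
  then show ?thesis
    unfolding abs_mult using kin_nonneg[OF x] kin_le_D[OF x] K_nonneg by (intro mult_mono) auto
qed

lemma at_interior: "x \<in> {0<..<1} \<Longrightarrow> at x within {0..1} = at (x::real)"
  by (simp add: at_within_Icc_at)

text \<open>
  Gronwall's inequality for \<open>|D'| \<le> K D\<close>, in both directions from a point where \<open>u\<close> is nonzero.
\<close>
lemma D_pos:
  assumes x: "x \<in> {0..1}"
  shows "D x > 0"
proof -
  obtain x0 where x0: "x0 \<in> {0..1}" "u x0 \<noteq> 0" using nontrivial by blast
  have D0: "D x0 > 0"
    using W_less[OF u_range[OF x0(1)] x0(2)] kin_nonneg[OF x0(1)] by (simp add: D_def)
  have mono: "D s * exp (K * s) \<le> D t * exp (K * t)" "D t * exp (- K * t) \<le> D s * exp (- K * s)"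
    if st: "0 \<le> s" "s \<le> t" "t \<le> 1" for s t
  proof -
    have d: "\<exists>y. ((\<lambda>x. D x * exp (c * x)) has_real_derivative y) (at z) \<and>
        y = (- (a' z / a z * kin z) + c * D z) * exp (c * z)"
      if "s < z" "z < t" for z c
      using D_derivative[of z] that st at_interior[of z]
      by (intro exI conjI[OF _ refl]) (auto intro!: derivative_eq_intros simp: algebra_simps)
    have bd: "\<bar>a' z / a z * kin z\<bar> \<le> K * D z" if "s < z" "z < t" for z
      by (rule D_derivative_bound) (use that st in auto)
    have cont: "continuous_on {s..t} (\<lambda>x. D x * exp (c * x))" for c
      by (intro continuous_intros continuous_on_subset[OF D_cont]) (use st in auto)
    show "D s * exp (K * s) \<le> D t * exp (K * t)"
    proof (rule DERIV_nonneg_imp_increasing_open[OF st(2) _ cont])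
      fix z assume z: "s < z" "z < t"
      have "0 \<le> (- (a' z / a z * kin z) + K * D z) * exp (K * z)"
        using abs_le_D1[OF bd[OF z]] by (intro mult_nonneg_nonneg; simp)
      then show "\<exists>y. ((\<lambda>x. D x * exp (K * x)) has_real_derivative y) (at z) \<and> 0 \<le> y"
        using d[OF z, of K] by blast
    qed
    show "D t * exp (- K * t) \<le> D s * exp (- K * s)"
    proof (rule DERIV_nonpos_imp_decreasing_open[OF st(2) _ cont])
      fix z assume z: "s < z" "z < t"
      have "(- (a' z / a z * kin z) + - K * D z) * exp (- K * z) \<le> 0"
        using abs_le_D2[OF bd[OF z]] by (intro mult_nonpos_nonneg; simp)
      then show "\<exists>y. ((\<lambda>x. D x * exp (- K * x)) has_real_derivative y) (at z) \<and> y \<le> 0"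
        using d[OF z, of "- K"] by blast
    qed
  qed
  show ?thesis
  proof (cases "x0 \<le> x")
    case True
    have "0 < D x0 * exp (K * x0)" using D0 by simp
    also have "\<dots> \<le> D x * exp (K * x)" using mono(1)[of x0 x] True x x0 by auto
    finally show ?thesis by (simp add: zero_less_mult_iff)
  next
    case False
    have "0 < D x0 * exp (- K * x0)" using D0 by simp
    also have "\<dots> \<le> D x * exp (- K * x)" using mono(2)[of x x0] False x x0 by auto
    finally show ?thesis by (simp add: zero_less_mult_iff)
  qed
qed

lemma simple_zeros: "x \<in> {0..1} \<Longrightarrow> u x \<noteq> 0 \<or> du x \<noteq> 0"
  using D_pos[of x] W_0 p1 by (auto simp: D_def kin_def)

lemma finite_zeros: "finite {x \<in> {0..1}. u x = 0}"
proof -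
  have "finite ({0..1} \<inter> {x \<in> {0..1}. u x = 0})"
  proof (rule finite_not_islimpt_in_compact)
    fix z :: real assume z: "z \<in> {0..1}"
    show "\<not> z islimpt {x \<in> {0..1}. u x = 0}"
    proof
      assume lim: "z islimpt {x \<in> {0..1}. u x = 0}"
      have cl: "closed {x \<in> {0..1}. u x = 0}"
        using continuous_closed_preimage_constant[OF u_cont, of 0] by simp
      have "z \<in> {x \<in> {0..1}. u x = 0}" by (rule cl[unfolded closed_limpt, rule_format, OF lim])
      then have uz: "u z = 0" by simp
      then have duz: "du z \<noteq> 0" using simple_zeros[OF z] by simp
      from sign_near_simple_zero[OF u_der[OF z] uz duz] obtain d where d: "d > 0"
        "\<forall>y\<in>{0..1}. y \<noteq> z \<and> \<bar>y - z\<bar> < d \<longrightarrow> sgn (u y) = sgn (du z) * sgn (y - z)"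
        by (elim exE conjE)
      from lim d(1) obtain y where y: "y \<in> {0..1}" "u y = 0" "y \<noteq> z" "dist y z < d"
        unfolding islimpt_approachable by auto
      then show False
        using d(2) duz by (auto simp: dist_real_def sgn_zero_iff)
    qed
  qed auto
  moreover have "{0..1} \<inter> {x \<in> {0..1}. u x = 0} = {x \<in> {0..1}. u x = 0}" by auto
  ultimately show ?thesis by simp
qed

lemma \<sigma>_powr:
  assumes x: "x \<in> {0..1}"
  shows "\<bar>\<sigma> x\<bar> powr p = 1 - kin x / D x"
proof -
  have "\<bar>\<sigma> x\<bar> powr p = (W0 - W (u x)) / D x"
    using D_pos[OF x] p1 abs_w_powr[OF u_range[OF x]]
    by (simp add: \<sigma>_def abs_divide powr_divide powr_powr)
  then show ?thesis using D_pos[OF x] by (simp add: D_def field_simps)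
qed

lemma \<sigma>_range: "x \<in> {0..1} \<Longrightarrow> \<sigma> x \<in> {-1..1}"
proof -
  assume x: "x \<in> {0..1}"
  have "\<bar>\<sigma> x\<bar> powr p \<le> 1"
    unfolding \<sigma>_powr[OF x] using kin_nonneg[OF x] D_pos[OF x] by simp
  moreover have "1 powr p < \<bar>\<sigma> x\<bar> powr p" if "1 < \<bar>\<sigma> x\<bar>"
    by (rule powr_less_mono2) (use p1 that in auto)
  ultimately have "\<bar>\<sigma> x\<bar> \<le> 1" by fastforce
  then show ?thesis by auto
qed

lemma \<sigma>_interior:
  assumes x: "x \<in> {0..1}" and "du x \<noteq> 0"
  shows "\<sigma> x \<in> {-1<..<1}"
proof -
  have "\<bar>\<sigma> x\<bar> powr p \<noteq> 1"
    unfolding \<sigma>_powr[OF x] using kin_pos[OF x] D_pos[OF x] assms by simp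
  then have "\<bar>\<sigma> x\<bar> \<noteq> 1" by auto
  then show ?thesis using \<sigma>_range[OF x] by auto
qed

lemma \<sigma>_zero: "u x = 0 \<Longrightarrow> \<sigma> x = 0"
  by (simp add: \<sigma>_def w_0)

lemma sgn_\<sigma>: "x \<in> {0..1} \<Longrightarrow> sgn (\<sigma> x) = sgn (u x)"
  using D_pos[of x] sgn_w[OF u_range[of x]] by (simp add: \<sigma>_def sgn_divide)

lemma \<sigma>_turning:
  assumes x: "x \<in> {0..1}" and "du x = 0"
  shows "\<sigma> x = sgn (u x)"
proof -
  have "\<bar>\<sigma> x\<bar> powr p = 1"
    unfolding \<sigma>_powr[OF x] using assms p1 by (simp add: kin_def)
  moreover have "\<bar>\<sigma> x\<bar> = (\<bar>\<sigma> x\<bar> powr p) powr (1 / p)" using p1 by (simp add: powr_powr)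
  ultimately have "\<bar>\<sigma> x\<bar> = 1" by simp
  then show ?thesis using sgn_\<sigma>[OF x] by (metis mult_sgn_abs mult.right_neutral)
qed

lemma \<sigma>_cont: "continuous_on {0..1} \<sigma>"
  unfolding \<sigma>_def[abs_def] using D_pos u_range
  by (intro continuous_intros continuous_on_compose2[OF w_continuous u_cont] D_cont)
    (force simp: less_imp_neq[symmetric])+

text \<open>
  A value \<open>\<plusminus>1\<close> of \<open>u\<close> at an inner point is an extremum.
\<close>
lemma u_interior:
  assumes x: "x \<in> {0<..<1}" and "du x \<noteq> 0"
  shows "u x \<in> {-1<..<1}"
proof -
  have d: "DERIV u x :> du x" using u_der[of x] at_interior[of x] x by auto
  have near: "u y \<in> {-1..1}" if "\<bar>x - y\<bar> < min x (1 - x)" for y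
    using that by (intro u_range) auto
  have "u x \<noteq> 1"
  proof
    assume "u x = 1"
    then have "du x = 0"
      using DERIV_local_max[OF d, of "min x (1 - x)"] near x by auto
    then show False using assms by simp
  qed
  moreover have "u x \<noteq> -1"
  proof
    assume "u x = -1"
    then have "du x = 0"
      using DERIV_local_min[OF d, of "min x (1 - x)"] near x by auto
    then show False using assms by simp
  qed
  ultimately show ?thesis using u_range[of x] x by auto
qed

text \<open>
  The speed \<open>\<epsilon> |\<theta>'|\<close> of the angle \<open>\<theta>\<close> on the \<open>p\<close>-circle, up to terms of order \<open>\<epsilon>\<close>.
\<close>
definition speed :: "real \<Rightarrow> real" where
  "speed x = g (u x) * (conj_exp p * a x) powr (1 / p)"

text \<open>
  The velocity \<open>u'\<close> contributes the factor \<open>(kin / D)^(1/p) = (1 - |\<sigma>|^p)^(1/p)\<close> to \<open>\<sigma>'\<close>, which the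
  density of the arcsine cancels.  The change of \<open>D\<close> contributes the error \<open>e\<close>: it carries the
  factor \<open>kin / D\<close>, so it stays bounded after division by \<open>(kin / D)^(1/p)\<close>, however small \<open>D\<close> is.
\<close>
lemma arc_rate:
  assumes "arc_clock p m" and x: "x \<in> {0<..<1}" and ux: "u x \<noteq> 0" and dux: "du x \<noteq> 0"
  obtains e where "\<bar>e\<bar> \<le> K"
    "((\<lambda>x. arc p m (\<sigma> x)) has_real_derivative (sgn (du x) * speed x / \<epsilon> + e) / m (\<sigma> x)) (at x)"
proof -
  interpret arc_clock p m by fact
  have x': "x \<in> {0..1}" using x by auto
  define r where "r = D x powr (1 / p)"
  have Dx: "D x > 0" using D_pos[OF x'] .
  have r: "r > 0" using Dx by (simp add: r_def)
  define \<kappa> where "\<kappa> = kin x / D x"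
  have \<kappa>: "0 < \<kappa>" "\<kappa> \<le> 1"
    using kin_pos[OF x' dux] kin_le_D[OF x'] Dx by (auto simp: \<kappa>_def)
  have dD: "DERIV D x :> - (a' x / a x * kin x)"
    using D_derivative[OF x'] at_interior[OF x] by simp
  have dr: "((\<lambda>x. D x powr (1 / p)) has_real_derivative 1 / p * D x powr (1 / p - 1) * (- (a' x / a x * kin x))) (at x)"
    using DERIV_chain2[OF has_real_derivative_powr[OF Dx, of "1 / p"] dD] .
  have dw: "((\<lambda>x. w (u x)) has_real_derivative g (u x) * du x) (at x)"
    using DERIV_chain2[of w "g (u x)" u x "du x", OF w_derivative[OF u_interior[OF x dux] ux]]
      u_der[OF x'] at_interior[OF x] by simp
  have "(\<sigma> has_real_derivative (g (u x) * du x * r - w (u x) * (1 / p * D x powr (1 / p - 1) * (- (a' x / a x * kin x)))) / (r * r)) (at x)"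
    unfolding \<sigma>_def[abs_def] r_def by (rule DERIV_divide[OF dw dr]) (use r in \<open>simp add: r_def\<close>)
  moreover have "(g (u x) * du x * r - w (u x) * (1 / p * D x powr (1 / p - 1) * (- (a' x / a x * kin x)))) / (r * r)
      = g (u x) * du x / r + \<sigma> x * (a' x / a x) * \<kappa> / p"
  proof -
    have e1: "D x powr (1 / p - 1) = r / D x" using Dx by (simp add: r_def powr_diff)
    show ?thesis unfolding e1 using r Dx by (simp add: \<sigma>_def r_def[symmetric] \<kappa>_def field_simps)
  qed
  ultimately have d\<sigma>: "(\<sigma> has_real_derivative g (u x) * du x / r + \<sigma> x * (a' x / a x) * \<kappa> / p) (at x)"
    by simp
  have m: "m (\<sigma> x) > 0" using mpos \<sigma>_range[OF x'] by auto
  have dens: "arc_density p m (\<sigma> x) = 1 / (m (\<sigma> x) * \<kappa> powr (1 / p))"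
    using \<sigma>_powr[OF x'] by (simp add: arc_density_def \<kappa>_def)
  \<comment> \<open>One power \<open>\<kappa>^(1/p)\<close> of \<open>\<kappa> = 1 - |\<sigma>|^p\<close> has been cancelled by the density.\<close>
  define e where "e = \<sigma> x * (a' x / a x) * \<kappa> powr (1 - 1 / p) / p"
  have "arc_density p m (\<sigma> x) * (g (u x) * du x / r + \<sigma> x * (a' x / a x) * \<kappa> / p)
      = (sgn (du x) * speed x / \<epsilon> + e) / m (\<sigma> x)"
  proof -
    have k1: "\<kappa> = \<kappa> powr (1 / p) * \<kappa> powr (1 - 1 / p)"
      using \<kappa> by (simp add: powr_add[symmetric])
    have k2: "\<kappa> powr (1 / p) * r = \<epsilon> * \<bar>du x\<bar> / (conj_exp p * a x) powr (1 / p)"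
    proof -
      have "\<kappa> powr (1 / p) * r = (\<kappa> * D x) powr (1 / p)"
        unfolding r_def by (rule powr_mult[symmetric])
      also have "\<kappa> * D x = kin x" using Dx by (simp add: \<kappa>_def)
      finally show ?thesis
        using p1 eps unfolding kin_def by (simp add: powr_divide powr_powr abs_mult)
    qed
    have A: "(conj_exp p * a x) powr (1 / p) > 0" using conj_exp_pos apos[OF x'] by simp
    have "arc_density p m (\<sigma> x) * (g (u x) * du x / r) = g (u x) * du x / (m (\<sigma> x) * (\<kappa> powr (1 / p) * r))"
      unfolding dens by (simp add: mult.assoc)
    also have "\<dots> = sgn (du x) * speed x / \<epsilon> / m (\<sigma> x)"
      unfolding k2 speed_def using dux eps A m by (auto simp: field_simps sgn_if abs_if)
    finally have 1: "arc_density p m (\<sigma> x) * (g (u x) * du x / r) = sgn (du x) * speed x / \<epsilon> / m (\<sigma> x)" .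
    have "arc_density p m (\<sigma> x) * (\<sigma> x * (a' x / a x) * \<kappa> / p) = e / m (\<sigma> x)"
      unfolding dens e_def using \<kappa> m by (subst (2) k1) (simp add: field_simps)
    with 1 show ?thesis by (simp add: distrib_left add_divide_distrib)
  qed
  moreover have "\<bar>e\<bar> \<le> K"
  proof -
    have "\<bar>e\<bar> = \<bar>\<sigma> x\<bar> * (\<bar>a' x / a x\<bar> * (\<kappa> powr (1 - 1 / p) * (1 / p)))"
      using p1 by (simp add: e_def abs_mult abs_divide)
    also have "\<dots> \<le> 1 * (K * (1 * 1))"
    proof (intro mult_mono)
      show "\<bar>a' x / a x\<bar> \<le> K"
        using a'_bound[OF x'] apos[OF x'] by (simp add: abs_divide divide_le_eq)
      show "\<kappa> powr (1 - 1 / p) \<le> 1"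
        using \<kappa> p1 powr_le1[of "1 - 1 / p" \<kappa>] by simp
    qed (use \<sigma>_range[OF x'] p1 K_nonneg in auto)
    finally show ?thesis by simp
  qed
  ultimately show thesis
    using that[of e] DERIV_chain2[OF arc_derivative[OF \<sigma>_interior[OF x' dux]] d\<sigma>] by simp
qed

lemma arc_increment:
  assumes clock: "arc_clock p m" and xy: "0 \<le> x" "x < y" "y \<le> 1"
    and s: "\<And>t. t \<in> {x<..<y} \<Longrightarrow> u t \<noteq> 0 \<and> sgn (du t) = s" "s \<noteq> 0"
    and bd: "\<And>t. t \<in> {x..y} \<Longrightarrow> c * m (\<sigma> t) \<le> speed t - \<epsilon> * K \<and> speed t + \<epsilon> * K \<le> C * m (\<sigma> t)"
  shows "s * (arc p m (\<sigma> y) - arc p m (\<sigma> x)) \<in> {c / \<epsilon> * (y - x)..C / \<epsilon> * (y - x)}"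
proof -
  interpret arc_clock p m by fact
  have cont: "continuous_on {x..y} (\<lambda>t. arc p m (\<sigma> t))"
    using \<sigma>_range xy
    by (intro continuous_on_compose2[OF arc_continuous] continuous_on_subset[OF \<sigma>_cont]) auto
  have diff: "\<exists>e. \<bar>e\<bar> \<le> K \<and> ((\<lambda>x. arc p m (\<sigma> x)) has_real_derivative (sgn (du t) * speed t / \<epsilon> + e) / m (\<sigma> t)) (at t)"
    if "x < t" "t < y" for t
  proof -
    have "u t \<noteq> 0" "du t \<noteq> 0" "t \<in> {0<..<1}" using s(1)[of t] s(2) that xy by auto
    then show ?thesis using arc_rate[OF clock] by metis
  qed
  obtain l t where t: "x < t" "t < y" "DERIV (\<lambda>x. arc p m (\<sigma> x)) t :> l"
      "arc p m (\<sigma> y) - arc p m (\<sigma> x) = (y - x) * l"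
    using MVT[OF xy(2) cont] diff real_differentiable_def by metis
  obtain e where e: "\<bar>e\<bar> \<le> K" "((\<lambda>x. arc p m (\<sigma> x)) has_real_derivative (sgn (du t) * speed t / \<epsilon> + e) / m (\<sigma> t)) (at t)"
    using diff[OF t(1,2)] by blast
  have l: "l = (s * speed t / \<epsilon> + e) / m (\<sigma> t)"
    using DERIV_unique[OF t(3) e(2)] s(1)[of t] t by simp
  have m: "m (\<sigma> t) > 0" using mpos \<sigma>_range[of t] t xy by auto
  have sc: "s = 1 \<or> s = -1"
    using s(1)[of t] s(2) t by (auto simp: sgn_if split: if_splits)
  then have ss: "\<bar>s\<bar> = 1" by auto
  have sl: "s * l = (speed t + \<epsilon> * (s * e)) / (\<epsilon> * m (\<sigma> t))"
    using sc eps m by (elim disjE) (simp_all add: l field_simps)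
  have se: "\<bar>s * e\<bar> \<le> K" using e ss by (simp add: abs_mult)
  then have "\<bar>\<epsilon> * (s * e)\<bar> \<le> \<epsilon> * K" using eps by (simp add: abs_mult mult_left_mono)
  then have "c * m (\<sigma> t) \<le> speed t + \<epsilon> * (s * e)" "speed t + \<epsilon> * (s * e) \<le> C * m (\<sigma> t)"
    using bd[of t] t by auto
  moreover have "c / \<epsilon> = c * m (\<sigma> t) / (\<epsilon> * m (\<sigma> t))" "C / \<epsilon> = C * m (\<sigma> t) / (\<epsilon> * m (\<sigma> t))"
    using m by simp_all
  ultimately have "c / \<epsilon> \<le> s * l" "s * l \<le> C / \<epsilon>"
    unfolding sl using eps m by (simp_all only: divide_right_mono mult_nonneg_nonneg less_imp_le)
  moreover have "s * (arc p m (\<sigma> y) - arc p m (\<sigma> x)) = (s * l) * (y - x)"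
    using t(4) by simp
  ultimately show ?thesis
    using xy by (simp only: atLeastAtMost_iff) (intro conjI mult_right_mono; simp)
qed

text \<open>
  The phase count for the clock \<open>arc p m \<circ> \<sigma>\<close>.  Turning points inside the well are isolated, because
  \<open>W'(u) \<noteq> 0\<close> there, so the equation makes \<open>u'\<close> change sign.
\<close>
lemma zero_count_window:
  assumes clock: "arc_clock p m" and window: "0 \<le> \<alpha>" "\<alpha> \<le> \<beta>" "\<beta> \<le> 1"
    and inside: "\<And>t. t \<in> {\<alpha>..\<beta>} \<Longrightarrow> u t \<in> {-1<..<1}"
    and bd: "\<And>t. t \<in> {\<alpha>..\<beta>} \<Longrightarrow> c * m (\<sigma> t) \<le> speed t - \<epsilon> * K \<and> speed t + \<epsilon> * K \<le> C * m (\<sigma> t)"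
  shows "\<epsilon> * (arc p m 1 * real (card {z \<in> {\<alpha><..\<beta>}. u z = 0})) \<in>
    {c * (\<beta> - \<alpha>) - \<epsilon> * (2 * arc p m 1)..C * (\<beta> - \<alpha>) + \<epsilon> * (2 * arc p m 1)}"
proof -
  interpret arc_clock p m by fact
  have sub: "{\<alpha>..\<beta>} \<subseteq> {0..1}" using window by auto
  have "arc p m 1 * real (card {z \<in> {\<alpha><..\<beta>}. u z = 0}) \<in>
    {c / \<epsilon> * (\<beta> - \<alpha>) - 2 * arc p m 1..C / \<epsilon> * (\<beta> - \<alpha>) + 2 * arc p m 1}"
  proof (rule zero_count_by_phase[where V = du and b = "\<lambda>x. arc p m (\<sigma> x)"])
    show "finite {z \<in> {\<alpha>..\<beta>}. u z = 0}"
      by (rule finite_subset[OF _ finite_zeros]) (use sub in auto)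
    show "continuous_on {\<alpha>..\<beta>} du" by (rule continuous_on_subset[OF du_cont sub])
    fix x assume x: "x \<in> {\<alpha>..\<beta>}"
    then have x': "x \<in> {0..1}" using sub by auto
    show "(u has_real_derivative du x) (at x within {\<alpha>..\<beta>})"
      by (rule DERIV_subset[OF u_der[OF x'] sub])
    show "u x \<noteq> 0 \<or> du x \<noteq> 0" by (rule simple_zeros[OF x'])
    show "arc p m (\<sigma> x) \<in> {0..arc p m 1}" by (rule arc_range[OF \<sigma>_range[OF x']])
    show "arc p m (\<sigma> x) = arc p m 1" if "du x = 0" "0 < u x"
      using \<sigma>_turning[OF x'] that by simp
    show "arc p m (\<sigma> x) = 0" if "du x = 0" "u x < 0"
      using \<sigma>_turning[OF x'] that arc_minus_one by simp
    show "\<exists>d>0. \<forall>y\<in>{\<alpha>..\<beta>}. y \<noteq> x \<and> \<bar>y - x\<bar> < d \<longrightarrow> sgn (du y) = - sgn (u x) * sgn (y - x)"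
      if d0: "du x = 0"
    proof -
      have ux: "u x \<noteq> 0" using simple_zeros[OF x'] d0 by auto
      have sW: "sgn (W' (u x)) = - sgn (u x)" using W'_sign[OF inside[OF x]] ux by auto
      then have sl: "sgn (a x * W' (u x) / \<epsilon>) = - sgn (u x)"
        using apos[OF x'] eps by (simp add: sgn_mult sgn_divide)
      then have "a x * W' (u x) / \<epsilon> \<noteq> 0" using ux by (metis neg_equal_0_iff_equal sgn_0_0)
      from sign_near_simple_zero[OF DERIV_subset[OF ode[OF x'] sub] _ this]
      have "\<exists>d>0. \<forall>y\<in>{\<alpha>..\<beta>}. y \<noteq> x \<and> \<bar>y - x\<bar> < d \<longrightarrow>
          sgn (phi p (\<epsilon> * du y)) = - sgn (u x) * sgn (y - x)"
        unfolding sl using d0 by (simp add: phi_def)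
      then show ?thesis using eps by (simp add: phi_sgn sgn_mult)
    qed
  next
    fix x y assume xy: "\<alpha> \<le> x" "x < y" "y \<le> \<beta>"
    have b: "c * m (\<sigma> t) \<le> speed t - \<epsilon> * K \<and> speed t + \<epsilon> * K \<le> C * m (\<sigma> t)" if "t \<in> {x..y}" for t
      by (rule bd) (use that xy in auto)
    show "arc p m (\<sigma> y) - arc p m (\<sigma> x) \<in> {c / \<epsilon> * (y - x)..C / \<epsilon> * (y - x)}"
      if "\<And>t. x < t \<Longrightarrow> t < y \<Longrightarrow> u t \<noteq> 0 \<and> 0 < du t"
      using arc_increment[OF clock _ xy(2) _ _ _ b, of 1] that xy window by auto
    show "arc p m (\<sigma> x) - arc p m (\<sigma> y) \<in> {c / \<epsilon> * (y - x)..C / \<epsilon> * (y - x)}"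
      if "\<And>t. x < t \<Longrightarrow> t < y \<Longrightarrow> u t \<noteq> 0 \<and> du t < 0"
      using arc_increment[OF clock _ xy(2) _ _ _ b, of "-1"] that xy window by auto
  qed (use window in auto)
  then show ?thesis using eps by (simp add: field_simps)
qed

text \<open>
  Up to the first turning point \<open>q\<close> after a zero the clock runs monotonically from its middle position
  \<open>arc p m 0\<close> to one of its ends, and its speed is at most \<open>C / \<epsilon>\<close>.  No information on what happens
  after \<open>q\<close> enters; the solution may stay close to \<open>\<plusminus>1\<close>, or even reach it.
\<close>
lemma zero_gap:
  assumes clock: "arc_clock p m" and xy: "0 \<le> x" "x < y" "y \<le> 1" and zeros: "u x = 0" "u y = 0"
    and bd: "\<And>t. t \<in> {x..y} \<Longrightarrow> speed t + \<epsilon> * K \<le> C * m (\<sigma> t)" and C: "C > 0"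
    and \<delta>: "\<delta> \<le> arc p m 1 - arc p m 0" "\<delta> \<le> arc p m 0"
  shows "\<epsilon> * \<delta> / C \<le> y - x"
proof -
  interpret arc_clock p m by fact
  have in01: "t \<in> {0..1}" if "t \<in> {x..y}" for t using that xy by auto
  have rolle: "\<exists>z. s < z \<and> z < t \<and> du z = 0" if "x \<le> s" "s < t" "t \<le> y" "u s = u t" for s t
  proof -
    have "\<exists>z. s < z \<and> z < t \<and> DERIV u z :> 0"
    proof (rule Rolle[OF that(2)])
      show "continuous_on {s..t} u" by (rule continuous_on_subset[OF u_cont]) (use that xy in auto)
      show "u differentiable at z" if "s < z" "z < t" for z
        using u_der[of z] at_interior[of z] that \<open>x \<le> s\<close> \<open>t \<le> y\<close> xy
        by (auto simp: real_differentiable_def)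
    qed (use that in auto)
    then obtain z where z: "s < z" "z < t" "DERIV u z :> 0" by blast
    then have "du z = 0"
      using u_der[of z] at_interior[of z] that xy by (auto dest: DERIV_unique)
    then show ?thesis using z by blast
  qed
  define T where "T = {t \<in> {x..y}. du t = 0}"
  have "compact T"
  proof -
    have "closed T" unfolding T_def
      by (rule continuous_closed_preimage_constant) (use xy in \<open>auto intro: continuous_on_subset[OF du_cont]\<close>)
    moreover have "bounded T"
      by (rule bounded_subset[of "{x..y}"]) (auto simp: T_def)
    ultimately show ?thesis by (simp add: compact_eq_bounded_closed)
  qed
  moreover have "T \<noteq> {}"
  proof -
    obtain z where "x < z" "z < y" "du z = 0" using rolle[of x y] zeros xy by auto
    then have "z \<in> T" by (simp add: T_def)
    then show ?thesis by blast
  qed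
  ultimately obtain q where q: "q \<in> T" "\<And>t. t \<in> T \<Longrightarrow> q \<le> t"
    using compact_attains_inf[of T] by blast
  have dx: "du x \<noteq> 0" using simple_zeros[of x] zeros in01[of x] xy by auto
  have xq: "x < q" "q \<le> y" "du q = 0" using q dx by (auto simp: T_def less_le)
  have nz: "du t \<noteq> 0" if "x \<le> t" "t < q" for t
    using q(2)[of t] that xq by (auto simp: T_def)
  have unz: "u t \<noteq> 0" if t: "x < t" "t < q" for t
  proof
    assume "u t = 0"
    then obtain z where "x < z" "z < t" "du z = 0" using rolle[of x t] t xq zeros by auto
    then show False using nz[of z] t by simp
  qed
  define s where "s = sgn (du x)"
  have s: "s \<noteq> 0" using dx by (simp add: s_def sgn_zero_iff)
  have sg: "sgn (du t) = s" if "x < t" "t < q" for t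
  proof (rule ccontr)
    assume ne: "sgn (du t) \<noteq> s"
    have c: "continuous_on {x..t} du" by (rule continuous_on_subset[OF du_cont]) (use that xq xy in auto)
    have "\<exists>z. x \<le> z \<and> z \<le> t \<and> du z = 0"
    proof (cases "du x < 0")
      case True
      then have "du t > 0" using ne nz[of t] that by (auto simp: s_def sgn_if split: if_splits)
      then show ?thesis using IVT'[of du x 0 t] c True that by auto
    next
      case False
      then have "du x > 0" "du t < 0" using ne nz[of t] that dx by (auto simp: s_def sgn_if split: if_splits)
      then show ?thesis using IVT2'[of du t 0 x] c that by auto
    qed
    then obtain z where "x \<le> z" "z \<le> t" "du z = 0" by blast
    then show False using nz[of z] that by simp
  qed
  have uq: "sgn (u q) = s"
  proof -
    have cu: "continuous_on {x..q} u" by (rule continuous_on_subset[OF u_cont]) (use xq xy in auto)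
    have dd: "DERIV u z :> du z" if "x < z" "z < q" for z
      using u_der[of z] at_interior[of z] that xq xy by auto
    obtain l z where z: "x < z" "z < q" "DERIV u z :> l" "u q - u x = (q - x) * l"
      using MVT[OF xq(1) cu] dd real_differentiable_def by metis
    then have "u q = (q - x) * du z" using dd[of z] zeros by (auto dest: DERIV_unique)
    then show ?thesis using sg[OF z(1,2)] xq by (simp add: sgn_mult)
  qed
  have q01: "q \<in> {0..1}" using xq xy by auto
  have "s * (arc p m (\<sigma> q) - arc p m (\<sigma> x)) \<le> C / \<epsilon> * (q - x)"
  proof -
    obtain t0 where t0: "t0 \<in> {-1..1}" "\<And>t. t \<in> {-1..1} \<Longrightarrow> m t0 \<le> m t"
      using continuous_attains_inf[OF _ _ contm] by auto
    have m0: "m t0 > 0" using mpos t0 by auto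
    \<comment> \<open>The lower bound is a trivial one, supplied because increments are estimated from both sides.\<close>
    have "s * (arc p m (\<sigma> q) - arc p m (\<sigma> x)) \<in> {- (\<epsilon> * K / m t0) / \<epsilon> * (q - x)..C / \<epsilon> * (q - x)}"
    proof (rule arc_increment[OF clock])
      fix t assume t: "t \<in> {x..q}"
      then have t01: "t \<in> {0..1}" using xq xy by auto
      have "speed t \<ge> 0" using slope_nonneg by (simp add: speed_def)
      moreover have "- (\<epsilon> * K / m t0) * m (\<sigma> t) \<le> - (\<epsilon> * K)"
        using t0(2)[OF \<sigma>_range[OF t01]] m0 eps K_nonneg by (simp add: field_simps mult_left_mono)
      ultimately show "- (\<epsilon> * K / m t0) * m (\<sigma> t) \<le> speed t - \<epsilon> * K \<and> speed t + \<epsilon> * K \<le> C * m (\<sigma> t)"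
        using bd[of t] t xq by auto
    qed (use xq xy unz sg s in auto)
    then show ?thesis by auto
  qed
  moreover have "\<delta> \<le> s * (arc p m (\<sigma> q) - arc p m (\<sigma> x))"
    using \<sigma>_turning[OF q01 xq(3)] \<sigma>_zero[OF zeros(1)] uq \<delta> s arc_minus_one
    by (auto simp: s_def sgn_if split: if_splits)
  ultimately have "\<delta> \<le> C / \<epsilon> * (q - x)" by simp
  then have "\<epsilon> * \<delta> / C \<le> q - x" using eps C by (simp add: field_simps)
  then show ?thesis using xq by simp
qed

lemma zero_count_slow:
  assumes clock: "arc_clock p m" and window: "0 \<le> \<alpha>" "\<alpha> \<le> \<beta>" "\<beta> \<le> 1"
    and bd: "\<And>t. t \<in> {\<alpha>..\<beta>} \<Longrightarrow> speed t + \<epsilon> * K \<le> C * m (\<sigma> t)" and C: "C > 0"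
    and \<delta>: "0 < \<delta>" "\<delta> \<le> arc p m 1 - arc p m 0" "\<delta> \<le> arc p m 0"
  shows "\<epsilon> * real (card {z \<in> {\<alpha><..\<beta>}. u z = 0}) \<le> \<epsilon> + C / \<delta> * (\<beta> - \<alpha>)"
proof -
  define Z where "Z = {z \<in> {\<alpha><..\<beta>}. u z = 0}"
  have "\<epsilon> * \<delta> / C * real (card Z) \<le> \<epsilon> * \<delta> / C + (\<beta> - \<alpha>)"
  proof (rule count_from_gap)
    show "finite Z"
      by (rule finite_subset[OF _ finite_zeros]) (use window in \<open>auto simp: Z_def\<close>)
    fix x y assume "x \<in> Z" "y \<in> Z" "x < y"
    then show "\<epsilon> * \<delta> / C \<le> y - x"
      using window by (intro zero_gap[OF clock _ _ _ _ _ _ C \<delta>(2,3)] bd) (auto simp: Z_def)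
  qed (use window eps \<delta> C in \<open>auto simp: Z_def\<close>)
  then have "C / \<delta> * (\<epsilon> * \<delta> / C * real (card Z)) \<le> C / \<delta> * (\<epsilon> * \<delta> / C + (\<beta> - \<alpha>))"
    using C \<delta> by (intro mult_left_mono) auto
  then show ?thesis using C \<delta> by (simp add: Z_def distrib_left)
qed

end

section \<open>Passing to the limit\<close>

text \<open>
  First, subdividing \<open>[0, x]\<close> into short intervals around points where the density is known shows that
  \<open>N n 0 x\<close> eventually stays within \<open>\<eta> x\<close> of a fixed number, so it converges.  Then the same
  hypothesis says that the limit, as a function of \<open>x\<close>, has derivative \<open>f\<close> everywhere.  Integrability
  of \<open>f\<close> is part of the fundamental theorem of calculus.
\<close>
lemma interval_function_limit:
  fixes N :: "nat \<Rightarrow> real \<Rightarrow> real \<Rightarrow> real" and f :: "real \<Rightarrow> real"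
  assumes add: "\<And>n r s t. 0 \<le> r \<Longrightarrow> r \<le> s \<Longrightarrow> s \<le> t \<Longrightarrow> t \<le> 1 \<Longrightarrow> N n r t = N n r s + N n s t"
    and density: "\<And>x \<eta>. x \<in> {0..1} \<Longrightarrow> \<eta> > 0 \<Longrightarrow> \<exists>d>0. \<forall>s t. 0 \<le> s \<and> s \<le> x \<and> x \<le> t \<and> t \<le> 1 \<and> t - s < d \<longrightarrow>
      (\<forall>\<^sub>F n in sequentially. \<bar>N n s t - (t - s) * f x\<bar> \<le> \<eta> * (t - s))"
  shows "(\<lambda>n. N n 0 1) \<longlonglongrightarrow> integral {0..1} f"
proof -
  have approx: "\<exists>S. \<forall>\<^sub>F n in sequentially. \<bar>N n 0 x - S\<bar> \<le> \<eta> * x" if x: "x \<in> {0..1}" and \<eta>: "\<eta> > 0" for x \<eta>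
  proof -
    define P where "P s t \<longleftrightarrow> (0 \<le> s \<and> s \<le> t \<and> t \<le> 1 \<longrightarrow>
      (\<exists>S. \<forall>\<^sub>F n in sequentially. \<bar>N n s t - S\<bar> \<le> \<eta> * (t - s)))" for s t
    have "P 0 x"
    proof (rule Bolzano)
      show "0 \<le> x" using x by simp
      fix r s t assume P: "P r s" "P s t" and le: "r \<le> s" "s \<le> t"
      show "P r t"
        unfolding P_def
      proof
        assume b: "0 \<le> r \<and> r \<le> t \<and> t \<le> 1"
        have "0 \<le> r \<and> r \<le> s \<and> s \<le> 1" using b le by auto
        then obtain S1 where S1: "\<forall>\<^sub>F n in sequentially. \<bar>N n r s - S1\<bar> \<le> \<eta> * (s - r)"
          using P(1)[unfolded P_def] by (elim impE exE)
        have "0 \<le> s \<and> s \<le> t \<and> t \<le> 1" using b le by auto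
        then obtain S2 where S2: "\<forall>\<^sub>F n in sequentially. \<bar>N n s t - S2\<bar> \<le> \<eta> * (t - s)"
          using P(2)[unfolded P_def] by (elim impE exE)
        have "\<forall>\<^sub>F n in sequentially. \<bar>N n r t - (S1 + S2)\<bar> \<le> \<eta> * (t - r)"
          using S1 S2
        proof eventually_elim
          case (elim n)
          have "N n r t = N n r s + N n s t" by (rule add) (use b le in auto)
          then show ?case using elim by (simp add: algebra_simps)
        qed
        then show "\<exists>S. \<forall>\<^sub>F n in sequentially. \<bar>N n r t - S\<bar> \<le> \<eta> * (t - r)" by blast
      qed
    next
      fix y assume "0 \<le> y" "y \<le> x"
      then have y: "y \<in> {0..1}" using x by auto
      obtain d where d: "d > 0" "\<forall>s t. 0 \<le> s \<and> s \<le> y \<and> y \<le> t \<and> t \<le> 1 \<and> t - s < d \<longrightarrow>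
          (\<forall>\<^sub>F n in sequentially. \<bar>N n s t - (t - s) * f y\<bar> \<le> \<eta> * (t - s))"
        using density[OF y \<eta>] by (elim exE conjE)
      have "P s t" if "s \<le> y \<and> y \<le> t \<and> t - s < d" for s t
        unfolding P_def
      proof
        assume "0 \<le> s \<and> s \<le> t \<and> t \<le> 1"
        then have "\<forall>\<^sub>F n in sequentially. \<bar>N n s t - (t - s) * f y\<bar> \<le> \<eta> * (t - s)"
          using d(2) that by simp
        then show "\<exists>S. \<forall>\<^sub>F n in sequentially. \<bar>N n s t - S\<bar> \<le> \<eta> * (t - s)" by (rule exI)
      qed
      then show "\<exists>d>0. \<forall>s t. s \<le> y \<and> y \<le> t \<and> t - s < d \<longrightarrow> P s t" using d(1) by blast
    qed
    moreover have "0 \<le> (0::real) \<and> 0 \<le> x \<and> x \<le> 1" using x by simp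
    ultimately have "\<exists>S. \<forall>\<^sub>F n in sequentially. \<bar>N n 0 x - S\<bar> \<le> \<eta> * (x - 0)"
      unfolding P_def by (rule mp)
    then show ?thesis by simp
  qed
  have conv: "convergent (\<lambda>n. N n 0 x)" if x: "x \<in> {0..1}" for x
  proof -
    have "Cauchy (\<lambda>n. N n 0 x)"
    proof (rule CauchyI)
      fix e :: real assume e: "e > 0"
      then have e3: "e / 3 > 0" by simp
      obtain S where "\<forall>\<^sub>F n in sequentially. \<bar>N n 0 x - S\<bar> \<le> e / 3 * x"
        using approx[OF x e3] by (elim exE)
      then obtain M where M: "\<And>n. n \<ge> M \<Longrightarrow> \<bar>N n 0 x - S\<bar> \<le> e / 3 * x"
        unfolding eventually_sequentially by blast
      have "e / 3 * x \<le> e / 3" using x e by (simp add: mult_left_le)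
      then have "norm (N m 0 x - N n 0 x) < e" if "m \<ge> M" "n \<ge> M" for m n
        using order_trans[OF M[OF that(1)] \<open>e / 3 * x \<le> e / 3\<close>] order_trans[OF M[OF that(2)] \<open>e / 3 * x \<le> e / 3\<close>] e
        unfolding real_norm_def by linarith
      then show "\<exists>M. \<forall>m\<ge>M. \<forall>n\<ge>M. norm (N m 0 x - N n 0 x) < e" by blast
    qed
    then show ?thesis by (rule Cauchy_convergent)
  qed
  define F where "F x = lim (\<lambda>n. N n 0 x)" for x
  have F: "(\<lambda>n. N n 0 x) \<longlonglongrightarrow> F x" if "x \<in> {0..1}" for x
    using conv[OF that] unfolding F_def by (rule convergent_LIMSEQ_iff[THEN iffD1])
  have "(f has_integral F 1 - F 0) {0..1}"
  proof (rule fundamental_theorem_of_calculus)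
    fix x :: real assume x: "x \<in> {0..1}"
    show "(F has_vector_derivative f x) (at x within {0..1})"
      unfolding has_vector_derivative_def has_derivative_within_alt
    proof (intro conjI allI impI)
      show "bounded_linear (\<lambda>h. h *\<^sub>R f x)" by (rule bounded_linear_scaleR_left)
      fix e :: real assume e: "e > 0"
      obtain d where d: "d > 0" "\<forall>s t. 0 \<le> s \<and> s \<le> x \<and> x \<le> t \<and> t \<le> 1 \<and> t - s < d \<longrightarrow>
          (\<forall>\<^sub>F n in sequentially. \<bar>N n s t - (t - s) * f x\<bar> \<le> e * (t - s))"
        using density[OF x e] by (elim exE conjE)
      have incr: "\<bar>F t - F s - (t - s) * f x\<bar> \<le> e * (t - s)"
        if st: "0 \<le> s" "s \<le> x" "x \<le> t" "t \<le> 1" "t - s < d" for s t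
      proof -
        have "(\<lambda>n. \<bar>N n 0 t - N n 0 s - (t - s) * f x\<bar>) \<longlonglongrightarrow> \<bar>F t - F s - (t - s) * f x\<bar>"
          using st x by (intro tendsto_intros F) auto
        moreover have "\<forall>\<^sub>F n in sequentially. \<bar>N n 0 t - N n 0 s - (t - s) * f x\<bar> \<le> e * (t - s)"
          using d(2)[rule_format, OF conjI[OF st(1) conjI[OF st(2) conjI[OF st(3) conjI[OF st(4,5)]]]]]
        proof eventually_elim
          case (elim n)
          have "N n 0 t = N n 0 s + N n s t" using add[of 0 s t n] st by auto
          then show ?case using elim by simp
        qed
        ultimately show ?thesis
          by (rule tendsto_upperbound) simp
      qed
      have "norm (F y - F x - (y - x) *\<^sub>R f x) \<le> e * norm (y - x)" if "y \<in> {0..1}" "norm (y - x) < d" for y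
      proof (cases "x \<le> y")
        case True
        then show ?thesis using incr[of x y] that x by auto
      next
        case False
        then have "\<bar>F x - F y - (x - y) * f x\<bar> \<le> e * (x - y)"
          using incr[of y x] that x by auto
        then show ?thesis using False by (auto simp: abs_if algebra_simps split: if_splits)
      qed
      then show "\<exists>d>0. \<forall>y\<in>{0..1}. norm (y - x) < d \<longrightarrow> norm (F y - F x - (y - x) *\<^sub>R f x) \<le> e * norm (y - x)"
        using d(1) by blast
    qed
  qed auto
  moreover have "N n 0 0 = 0" for n using add[of 0 0 0 n] by simp
  then have "F 0 = 0" by (simp add: F_def)
  ultimately show ?thesis using F[of 1] by (simp add: integral_unique)
qed

locale oscillator_family = potential +
  fixes a a' :: "real \<Rightarrow> real" and u du :: "nat \<Rightarrow> real \<Rightarrow> real" and \<epsilon> :: "nat \<Rightarrow> real" and K :: real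
    and E :: "real \<Rightarrow> real"
  assumes osc: "\<And>n. oscillator p W W' Cm1 C0 C1 W0 a a' (u n) (du n) (\<epsilon> n) K"
    and eps_lim: "\<epsilon> \<longlonglongrightarrow> 0"
    and energy_lim: "uniform_limit {0..1}
      (\<lambda>n x. W (u n x) - \<bar>\<epsilon> n * du n x\<bar> powr p / (conj_exp p * a x)) E sequentially"
begin

definition energy_n :: "nat \<Rightarrow> real \<Rightarrow> real" where
  "energy_n n x = W (u n x) - \<bar>\<epsilon> n * du n x\<bar> powr p / (conj_exp p * a x)"

text \<open>
  The coordinate \<open>\<sigma>\<close> of the \<open>n\<close>-th solution, in terms of its energy.
\<close>
definition \<sigma>_seq :: "nat \<Rightarrow> real \<Rightarrow> real" where
  "\<sigma>_seq n x = w (u n x) / (W0 - energy_n n x) powr (1 / p)"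

text \<open>
  The factor by which the weight accelerates the clock.
\<close>
definition freq :: "real \<Rightarrow> real" where
  "freq x = (conj_exp p * a x) powr (1 / p)"

lemma energy_lim': "uniform_limit {0..1} energy_n E sequentially"
  using energy_lim by (simp add: energy_n_def[abs_def])

lemma eps_pos: "\<epsilon> n > 0"
  using oscillator.eps[OF osc] .

lemma a_pos: "x \<in> {0..1} \<Longrightarrow> a x > 0"
  using oscillator.apos[OF osc[of 0]] .

lemma a_cont: "continuous_on {0..1} a"
  using oscillator.a_der[OF osc[of 0]] by (rule DERIV_continuous_on)

lemma freq_cont: "continuous_on {0..1} freq"
  unfolding freq_def[abs_def] using a_pos conj_exp_pos
  by (intro continuous_intros a_cont) (force simp: less_imp_neq[symmetric])+

lemma freq_pos: "x \<in> {0..1} \<Longrightarrow> freq x > 0"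
  using a_pos[of x] conj_exp_pos by (simp add: freq_def)

lemma D_eq: "oscillator.D p W W0 a (u n) (du n) (\<epsilon> n) x = W0 - energy_n n x"
proof -
  interpret o: oscillator p W W' Cm1 C0 C1 W0 a a' "u n" "du n" "\<epsilon> n" K by (rule osc)
  show ?thesis by (simp add: o.D_def o.kin_def energy_n_def)
qed

lemma energy_n_less: "x \<in> {0..1} \<Longrightarrow> energy_n n x < W0"
  using oscillator.D_pos[OF osc, of x n] by (simp add: D_eq)

lemma energy_n_cont: "continuous_on {0..1} (energy_n n)"
proof -
  have "continuous_on {0..1} (\<lambda>x. W0 - energy_n n x)"
    using oscillator.D_cont[OF osc, of n] unfolding D_eq .
  from continuous_on_diff[OF continuous_on_const[of _ W0] this] show ?thesis by simp
qed

lemma E_cont: "continuous_on {0..1} E"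
  by (rule uniform_limit_theorem[OF _ energy_lim']) (auto simp: energy_n_cont)

lemma energy_n_tendsto: "x \<in> {0..1} \<Longrightarrow> (\<lambda>n. energy_n n x) \<longlonglongrightarrow> E x"
  using tendsto_uniform_limitI[OF energy_lim'] .

lemma E_le: "x \<in> {0..1} \<Longrightarrow> E x \<le> W0"
  by (rule LIMSEQ_le_const2[OF energy_n_tendsto]) (use energy_n_less in \<open>auto simp: less_imp_le\<close>)

lemma energy_near:
  assumes x: "x \<in> {0..1}" and \<eta>: "\<eta> > 0"
  shows "\<exists>d>0. \<forall>\<^sub>F n in sequentially. \<forall>t\<in>{0..1}. \<bar>t - x\<bar> < d \<longrightarrow> \<bar>energy_n n t - E x\<bar> < \<eta>"
proof -
  obtain d where d: "d > 0" "\<And>t. t \<in> {0..1} \<Longrightarrow> dist t x < d \<Longrightarrow> dist (E t) (E x) < \<eta> / 2"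
    using E_cont x \<eta> unfolding continuous_on_iff by (meson half_gt_zero)
  have "\<forall>\<^sub>F n in sequentially. \<forall>t\<in>{0..1}. dist (energy_n n t) (E t) < \<eta> / 2"
    using energy_lim' \<eta> unfolding uniform_limit_iff by (meson half_gt_zero)
  then have "\<forall>\<^sub>F n in sequentially. \<forall>t\<in>{0..1}. \<bar>t - x\<bar> < d \<longrightarrow> \<bar>energy_n n t - E x\<bar> < \<eta>"
  proof eventually_elim
    case (elim n)
    show ?case
    proof (intro ballI impI)
      fix t assume t: "t \<in> {0..1}" "\<bar>t - x\<bar> < d"
      have "dist (energy_n n t) (E t) < \<eta> / 2" "dist (E t) (E x) < \<eta> / 2"
        using elim d(2) t by (auto simp: dist_real_def)
      then show "\<bar>energy_n n t - E x\<bar> < \<eta>" unfolding dist_real_def by linarith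
    qed
  qed
  then show ?thesis using d(1) by blast
qed

text \<open>
  If the energies are at most \<open>-\<kappa>\<close> on an interval of fixed length, then \<open>kin \<ge> \<kappa>\<close> there and \<open>u\<close>
  would have to travel a distance of order \<open>1/\<epsilon>\<close> within \<open>[-1, 1]\<close>.
\<close>
lemma E_nonneg:
  assumes x: "x \<in> {0..1}"
  shows "E x \<ge> 0"
proof (rule ccontr)
  assume neg: "\<not> E x \<ge> 0"
  \<comment> \<open>Near \<open>x\<close> the energies will differ from \<open>E x\<close> by less than \<open>\<kappa>\<close>, hence be below \<open>-\<kappa>\<close>.\<close>
  define \<kappa> where "\<kappa> = - E x / 2"
  have \<kappa>: "\<kappa> > 0" using neg by (simp add: \<kappa>_def)
  obtain d where d: "d > 0" "\<forall>\<^sub>F n in sequentially. \<forall>t\<in>{0..1}. \<bar>t - x\<bar> < d \<longrightarrow> \<bar>energy_n n t - E x\<bar> < \<kappa>"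
    using energy_near[OF x \<kappa>] by blast
  obtain x1 where x1: "x1 \<in> {0..1}" "\<And>t. t \<in> {0..1} \<Longrightarrow> a x1 \<le> a t"
    using continuous_attains_inf[OF _ _ a_cont] by auto
  define c where "c = (\<kappa> * (conj_exp p * a x1)) powr (1 / p)"
  have c: "c > 0" using \<kappa> conj_exp_pos a_pos[OF x1(1)] by (simp add: c_def)
  define \<alpha> where "\<alpha> = max 0 (x - d / 2)"
  define \<beta> where "\<beta> = min 1 (x + d / 2)"
  have ab: "0 \<le> \<alpha>" "\<alpha> < \<beta>" "\<beta> \<le> 1" and near: "\<And>t. t \<in> {\<alpha>..\<beta>} \<Longrightarrow> t \<in> {0..1} \<and> \<bar>t - x\<bar> < d"
    using x d(1) by (auto simp: \<alpha>_def \<beta>_def)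
  have "\<forall>\<^sub>F n in sequentially. \<epsilon> n < (\<beta> - \<alpha>) * c / 2"
    by (rule order_tendstoD(2)[OF eps_lim]) (use ab c in simp)
  with d(2) have "\<forall>\<^sub>F n in sequentially. False"
  proof eventually_elim
    case (elim n)
    interpret o: oscillator p W W' Cm1 C0 C1 W0 a a' "u n" "du n" "\<epsilon> n" K by (rule osc)
    have "\<exists>z. \<alpha> < z \<and> z < \<beta> \<and> u n \<beta> - u n \<alpha> = (\<beta> - \<alpha>) * du n z"
    proof -
      have cu: "continuous_on {\<alpha>..\<beta>} (u n)" by (rule continuous_on_subset[OF o.u_cont]) (use ab in auto)
      have dd: "DERIV (u n) z :> du n z" if "\<alpha> < z" "z < \<beta>" for z
        using o.u_der[of z] o.at_interior[of z] that ab by auto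
      obtain l z where z: "\<alpha> < z" "z < \<beta>" "DERIV (u n) z :> l" "u n \<beta> - u n \<alpha> = (\<beta> - \<alpha>) * l"
        using MVT[OF ab(2) cu] dd real_differentiable_def by metis
      then show ?thesis using dd[of z] by (auto dest: DERIV_unique)
    qed
    then obtain z where z: "\<alpha> < z" "z < \<beta>" "u n \<beta> - u n \<alpha> = (\<beta> - \<alpha>) * du n z" by blast
    then have z01: "z \<in> {0..1}" "\<bar>z - x\<bar> < d" using near[of z] by auto
    have "W (u n z) \<ge> 0" by (rule W_nonneg[OF o.u_range[OF z01(1)]])
    moreover have "\<bar>energy_n n z - E x\<bar> < \<kappa>" using elim z01 by blast
    then have "energy_n n z < - \<kappa>" by (simp add: \<kappa>_def abs_less_iff)
    ultimately have "\<kappa> \<le> \<bar>\<epsilon> n * du n z\<bar> powr p / (conj_exp p * a z)" by (simp add: energy_n_def)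
    then have "\<kappa> * (conj_exp p * a z) \<le> \<bar>\<epsilon> n * du n z\<bar> powr p"
      using conj_exp_pos a_pos[OF z01(1)] by (simp add: le_divide_eq)
    moreover have "\<kappa> * (conj_exp p * a x1) \<le> \<kappa> * (conj_exp p * a z)"
      using \<kappa> conj_exp_pos x1(2)[OF z01(1)] by (intro mult_left_mono) auto
    ultimately have "\<kappa> * (conj_exp p * a x1) \<le> \<bar>\<epsilon> n * du n z\<bar> powr p" by simp
    then have "c \<le> (\<bar>\<epsilon> n * du n z\<bar> powr p) powr (1 / p)"
      unfolding c_def using \<kappa> conj_exp_pos a_pos[OF x1(1)] p1 by (intro powr_mono2) auto
    then have "c \<le> \<epsilon> n * \<bar>du n z\<bar>" using p1 o.eps by (simp add: powr_powr abs_mult)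
    then have "(\<beta> - \<alpha>) * c \<le> \<epsilon> n * ((\<beta> - \<alpha>) * \<bar>du n z\<bar>)" using ab by (simp add: mult.left_commute)
    also have "(\<beta> - \<alpha>) * \<bar>du n z\<bar> = \<bar>u n \<beta> - u n \<alpha>\<bar>" using z(3) ab by (simp add: abs_mult)
    also have "\<dots> \<le> 2" using o.u_range[of \<alpha>] o.u_range[of \<beta>] ab by auto
    finally have "(\<beta> - \<alpha>) * c \<le> \<epsilon> n * 2" using o.eps by simp
    then show False using elim(2) by simp
  qed
  then show False by simp
qed

text \<open>
  The exact position on the circle of radius \<open>r = D^(1/p)\<close> is \<open>r \<sigma>\<close>, and freezing the radius at \<open>r0\<close>
  moves it by at most \<open>|r - r0|\<close>.  Uniform continuity of \<open>\<gamma>\<close> on \<open>[-R, R]\<close> makes the estimate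
  uniform in \<open>\<sigma>\<close>; it covers the radii \<open>0\<close> and \<open>R\<close>.
\<close>
lemma speed_near:
  assumes x: "x \<in> {0..1}" and \<eta>: "\<eta> > 0" and r0: "r0 = (W0 - E x) powr (1 / p)"
  shows "\<exists>d>0. \<forall>\<^sub>F n in sequentially. \<forall>t\<in>{0..1}. \<bar>t - x\<bar> < d \<longrightarrow>
    \<bar>g (u n t) * freq t - freq x * \<gamma> (r0 * \<sigma>_seq n t)\<bar> \<le> \<eta>"
proof -
  have r0R: "0 \<le> r0" "r0 \<le> R"
    using E_le[OF x] E_nonneg[OF x] p1 by (auto simp: r0 R_def intro!: powr_mono2)
  obtain xa where "xa \<in> {0..1}" and xa: "\<And>t. t \<in> {0..1} \<Longrightarrow> freq t \<le> freq xa"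
    using continuous_attains_sup[OF _ _ freq_cont] by auto
  then have A: "freq xa > 0" using freq_pos by auto
  obtain ga where "ga \<in> {-R..R}" and ga: "\<And>s. s \<in> {-R..R} \<Longrightarrow> \<gamma> s \<le> \<gamma> ga"
    using continuous_attains_sup[OF _ _ \<gamma>_continuous] R_pos by auto
  define G where "G = \<gamma> ga + 1"
  have G: "G > 0" using \<gamma>_nonneg[of ga] by (simp add: G_def)
  have "uniformly_continuous_on {-R..R} \<gamma>"
    by (rule compact_uniformly_continuous[OF \<gamma>_continuous]) auto
  then obtain \<rho> where \<rho>: "\<rho> > 0"
    "\<And>s t. s \<in> {-R..R} \<Longrightarrow> t \<in> {-R..R} \<Longrightarrow> dist t s < \<rho> \<Longrightarrow> dist (\<gamma> t) (\<gamma> s) < \<eta> / (2 * freq xa)"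
    using \<eta> A unfolding uniformly_continuous_on_def by (metis divide_pos_pos mult_pos_pos zero_less_numeral)
  have "continuous_on {0..} (\<lambda>s::real. s powr (1 / p))"
    using p1 by (intro continuous_on_powr' continuous_intros) auto
  moreover have "W0 - E x \<in> {0..}" using E_le[OF x] by simp
  ultimately obtain \<kappa> where \<kappa>: "\<kappa> > 0"
    "\<And>s. s \<in> {0..} \<Longrightarrow> dist s (W0 - E x) < \<kappa> \<Longrightarrow> dist (s powr (1 / p)) r0 < \<rho>"
    using \<rho>(1) unfolding continuous_on_iff r0 by metis
  obtain d1 where d1: "d1 > 0" "\<forall>\<^sub>F n in sequentially. \<forall>t\<in>{0..1}. \<bar>t - x\<bar> < d1 \<longrightarrow> \<bar>energy_n n t - E x\<bar> < \<kappa>"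
    using energy_near[OF x \<kappa>(1)] by blast
  obtain d2 where d2: "d2 > 0" "\<And>t. t \<in> {0..1} \<Longrightarrow> dist t x < d2 \<Longrightarrow> dist (freq t) (freq x) < \<eta> / (2 * G)"
    using freq_cont x \<eta> G unfolding continuous_on_iff by (metis divide_pos_pos mult_pos_pos zero_less_numeral)
  have "\<forall>\<^sub>F n in sequentially. \<forall>t\<in>{0..1}. \<bar>t - x\<bar> < min d1 d2 \<longrightarrow>
    \<bar>g (u n t) * freq t - freq x * \<gamma> (r0 * \<sigma>_seq n t)\<bar> \<le> \<eta>"
    using d1(2)
  proof eventually_elim
    case (elim n)
    interpret o: oscillator p W W' Cm1 C0 C1 W0 a a' "u n" "du n" "\<epsilon> n" K by (rule osc)
    show ?case
    proof (intro ballI impI)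
      fix t assume t: "t \<in> {0..1}" "\<bar>t - x\<bar> < min d1 d2"
      define r where "r = (W0 - energy_n n t) powr (1 / p)"
      have r: "r > 0" using energy_n_less[OF t(1), of n] by (simp add: r_def)
      have \<sigma>: "\<sigma>_seq n t \<in> {-1..1}"
        using o.\<sigma>_range[OF t(1)] by (simp add: o.\<sigma>_def D_eq \<sigma>_seq_def)
      have "\<bar>energy_n n t - E x\<bar> < \<kappa>" using elim t by auto
      then have rr: "\<bar>r - r0\<bar> < \<rho>"
        using \<kappa>(2)[of "W0 - energy_n n t"] energy_n_less[OF t(1), of n] by (simp add: dist_real_def r_def abs_minus_commute)
      have w: "w (u n t) = r * \<sigma>_seq n t" using r by (simp add: \<sigma>_seq_def r_def)
      have ut: "u n t \<in> {-1..1}" by (rule o.u_range[OF t(1)])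
      have in1: "r * \<sigma>_seq n t \<in> {-R..R}" unfolding w[symmetric] using w_image ut by blast
      have "\<bar>r0 * \<sigma>_seq n t\<bar> \<le> r0" using \<sigma> r0R by (auto simp: abs_mult intro!: mult_left_le)
      then have in2: "r0 * \<sigma>_seq n t \<in> {-R..R}" using r0R by (auto simp: abs_le_iff)
      have "\<bar>r * \<sigma>_seq n t - r0 * \<sigma>_seq n t\<bar> = \<bar>r - r0\<bar> * \<bar>\<sigma>_seq n t\<bar>" by (simp add: abs_mult[symmetric] left_diff_distrib)
      also have "\<dots> \<le> \<bar>r - r0\<bar>" using \<sigma> by (intro mult_left_le) auto
      finally have "\<bar>r * \<sigma>_seq n t - r0 * \<sigma>_seq n t\<bar> < \<rho>" using rr by simp
      then have g1: "\<bar>\<gamma> (r * \<sigma>_seq n t) - \<gamma> (r0 * \<sigma>_seq n t)\<bar> \<le> \<eta> / (2 * freq xa)"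
        using \<rho>(2)[OF in2 in1] by (simp add: dist_real_def)
      have g2: "g (u n t) = \<gamma> (r * \<sigma>_seq n t)" using \<gamma>_w[OF ut] w by simp
      have f1: "\<bar>freq t - freq x\<bar> \<le> \<eta> / (2 * G)" using d2(2)[OF t(1)] t(2) by (simp add: dist_real_def)
      have split: "g (u n t) * freq t - freq x * \<gamma> (r0 * \<sigma>_seq n t) =
          (\<gamma> (r * \<sigma>_seq n t) - \<gamma> (r0 * \<sigma>_seq n t)) * freq t + \<gamma> (r0 * \<sigma>_seq n t) * (freq t - freq x)"
        unfolding g2 by (simp add: algebra_simps)
      have "\<bar>g (u n t) * freq t - freq x * \<gamma> (r0 * \<sigma>_seq n t)\<bar>
          \<le> \<bar>\<gamma> (r * \<sigma>_seq n t) - \<gamma> (r0 * \<sigma>_seq n t)\<bar> * freq t + \<gamma> (r0 * \<sigma>_seq n t) * \<bar>freq t - freq x\<bar>"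
        unfolding split using freq_pos[OF t(1)] \<gamma>_nonneg[of "r0 * \<sigma>_seq n t"]
        by (intro order_trans[OF abs_triangle_ineq]) (simp add: abs_mult)
      also have "\<dots> \<le> \<eta> / (2 * freq xa) * freq xa + G * (\<eta> / (2 * G))"
      proof (rule add_mono)
        have "0 \<le> \<eta> / (2 * freq xa)" using \<eta> A by simp
        then show "\<bar>\<gamma> (r * \<sigma>_seq n t) - \<gamma> (r0 * \<sigma>_seq n t)\<bar> * freq t \<le> \<eta> / (2 * freq xa) * freq xa"
          using freq_pos[OF t(1)] by (intro mult_mono g1 xa t(1)) simp_all
        have "\<gamma> (r0 * \<sigma>_seq n t) \<le> G" using ga[OF in2] by (simp add: G_def)
        then show "\<gamma> (r0 * \<sigma>_seq n t) * \<bar>freq t - freq x\<bar> \<le> G * (\<eta> / (2 * G))"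
          using G by (intro mult_mono f1) simp_all
      qed
      also have "\<dots> = \<eta>" using A G by simp
      finally show "\<bar>g (u n t) * freq t - freq x * \<gamma> (r0 * \<sigma>_seq n t)\<bar> \<le> \<eta>" .
    qed
  qed
  then show ?thesis using d1(1) d2(1) by (intro exI[of _ "min d1 d2"]) auto
qed

definition zero_density :: "real \<Rightarrow> real" where
  "zero_density x = real_of_ereal (ereal (2 * a x powr (1 / p)) / period p W C0 W0 (E x))"

lemma zero_density_pos_energy:
  assumes x: "x \<in> {0..1}" and "E x > 0" and r0: "r0 = (W0 - E x) powr (1 / p)"
  shows "zero_density x = freq x / arc p (\<lambda>s. \<gamma> (r0 * s)) 1"
proof -
  have "period p W C0 W0 (E x) = ereal (2 * arc p (\<lambda>s. \<gamma> (r0 * s)) 1 / conj_exp p powr (1 / p))"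
  proof (cases "E x = W0")
    case True
    then have "r0 = 0" by (simp add: r0)
    then show ?thesis using period_top True by simp
  next
    case False
    then show ?thesis using period_interior[OF _ _ r0] E_le[OF x] assms by simp
  qed
  moreover have "freq x = conj_exp p powr (1 / p) * a x powr (1 / p)"
    by (simp add: freq_def powr_mult)
  ultimately show ?thesis by (simp add: zero_density_def)
qed

lemma zero_density_zero_energy: "E x = 0 \<Longrightarrow> zero_density x = 0"
  by (simp add: zero_density_def period_def)

definition scaled_count :: "nat \<Rightarrow> real \<Rightarrow> real \<Rightarrow> real" where
  "scaled_count n s t = \<epsilon> n * real (card {z \<in> {s<..t}. u n z = 0})"

lemma eps_small: "\<eta> > 0 \<Longrightarrow> \<forall>\<^sub>F n in sequentially. \<epsilon> n * k \<le> \<eta>"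
proof -
  assume "\<eta> > 0"
  have "(\<lambda>n. \<epsilon> n * k) \<longlonglongrightarrow> 0 * k" by (intro tendsto_intros eps_lim)
  then have "\<forall>\<^sub>F n in sequentially. \<epsilon> n * k < \<eta>"
    using \<open>\<eta> > 0\<close> by (intro order_tendstoD(2)) auto
  then show ?thesis by eventually_elim simp
qed

lemma density_pos_energy:
  assumes x: "x \<in> {0..1}" and Ex: "E x > 0" and \<eta>: "\<eta> > 0"
  shows "\<exists>d>0. \<forall>s t. 0 \<le> s \<and> s \<le> x \<and> x \<le> t \<and> t \<le> 1 \<and> t - s < d \<longrightarrow>
      (\<forall>\<^sub>F n in sequentially. \<bar>scaled_count n s t - (t - s) * zero_density x\<bar> \<le> \<eta> * (t - s))"
proof -
  define r0 where "r0 = (W0 - E x) powr (1 / p)"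
  have r0: "0 \<le> r0" "r0 < R"
    using E_le[OF x] Ex p1 by (auto simp: r0_def R_def intro!: powr_less_mono2)
  define m where "m s = \<gamma> (r0 * s)" for s
  have clock: "arc_clock p m" using scaled_clock[of r0 0] r0 by (simp add: m_def[abs_def])
  interpret arc_clock p m by (rule clock)
  define Q where "Q = arc p m 1"
  have Q: "Q > 0" using arc_total_pos by (simp add: Q_def)
  have dens: "zero_density x = freq x / Q"
    using zero_density_pos_energy[OF x Ex r0_def] by (simp add: Q_def m_def[abs_def])
  obtain s0 where s0: "s0 \<in> {-1..1}" "\<And>s. s \<in> {-1..1} \<Longrightarrow> m s0 \<le> m s"
    using continuous_attains_inf[OF _ _ contm] by auto
  have m0: "m s0 > 0" using mpos s0 by auto
  \<comment> \<open>Half of the tolerance is for the speed of the clock, the other half for the error \<open>2 Q\<close> of the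
    phase count, which is multiplied by \<open>\<epsilon>\<close>.\<close>
  define \<eta>' where "\<eta>' = \<eta> * Q / 2"
  have \<eta>': "\<eta>' > 0" using \<eta> Q by (simp add: \<eta>'_def)
  have h: "\<eta>' * m s0 / 2 > 0" using \<eta>' m0 by simp
  obtain d1 where d1: "d1 > 0" "\<forall>\<^sub>F n in sequentially. \<forall>t\<in>{0..1}. \<bar>t - x\<bar> < d1 \<longrightarrow>
    \<bar>g (u n t) * freq t - freq x * \<gamma> (r0 * \<sigma>_seq n t)\<bar> \<le> \<eta>' * m s0 / 2"
    using speed_near[OF x h r0_def] by blast
  \<comment> \<open>Positive energy keeps \<open>u\<close> away from the equilibria \<open>\<plusminus>1\<close>.\<close>
  obtain d2 where d2: "d2 > 0" "\<forall>\<^sub>F n in sequentially. \<forall>t\<in>{0..1}. \<bar>t - x\<bar> < d2 \<longrightarrow> \<bar>energy_n n t - E x\<bar> < E x"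
    using energy_near[OF x Ex] by blast
  have "\<forall>\<^sub>F n in sequentially. \<bar>scaled_count n s t - (t - s) * zero_density x\<bar> \<le> \<eta> * (t - s)"
    if st: "0 \<le> s" "s \<le> x" "x \<le> t" "t \<le> 1" "t - s < min d1 d2" for s t
  proof (cases "s = t")
    case True
    then show ?thesis by (simp add: scaled_count_def)
  next
    case False
    then have L: "t - s > 0" using st by simp
    have near: "y \<in> {0..1} \<and> \<bar>y - x\<bar> < d1 \<and> \<bar>y - x\<bar> < d2" if "y \<in> {s..t}" for y
      using that st by auto
    have L2: "\<eta> * (t - s) / 2 > 0" using \<eta> L by simp
    show ?thesis
      using d1(2) d2(2) eps_small[OF h, of K] eps_small[OF L2, of 2]
    proof eventually_elim
      case (elim n)
      interpret o: oscillator p W W' Cm1 C0 C1 W0 a a' "u n" "du n" "\<epsilon> n" K by (rule osc)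
      have \<sigma>: "o.\<sigma> y = \<sigma>_seq n y" for y by (simp add: o.\<sigma>_def D_eq \<sigma>_seq_def)
      have "\<epsilon> n * (arc p m 1 * real (card {z \<in> {s<..t}. u n z = 0})) \<in>
        {(freq x - \<eta>') * (t - s) - \<epsilon> n * (2 * arc p m 1)..(freq x + \<eta>') * (t - s) + \<epsilon> n * (2 * arc p m 1)}"
      proof (rule o.zero_count_window[OF clock])
        fix y assume y: "y \<in> {s..t}"
        note y' = near[OF y]
        have "\<bar>energy_n n y - E x\<bar> < E x" using elim(2) y' by blast
        then have "energy_n n y > 0" by (simp add: abs_less_iff)
        then have "W (u n y) > 0"
          using o.kin_nonneg[of y] y' by (simp add: energy_n_def o.kin_def)
        moreover have "u n y \<in> {-1..1}" using o.u_range y' by blast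
        ultimately show "u n y \<in> {-1<..<1}"
          using pos.W_1 neg.W_1 by (cases "u n y = 1"; cases "u n y = -1") auto
        have sp: "\<bar>o.speed y - freq x * m (o.\<sigma> y)\<bar> \<le> \<eta>' * m s0 / 2"
          using elim(1) y' by (simp add: o.speed_def freq_def m_def \<sigma>)
        have "\<eta>' * m s0 \<le> \<eta>' * m (o.\<sigma> y)"
          using s0(2)[OF o.\<sigma>_range[of y]] y' \<eta>' by (intro mult_left_mono) auto
        then show "(freq x - \<eta>') * m (o.\<sigma> y) \<le> o.speed y - \<epsilon> n * K \<and> o.speed y + \<epsilon> n * K \<le> (freq x + \<eta>') * m (o.\<sigma> y)"
          unfolding left_diff_distrib distrib_right
          using abs_le_D1[OF sp] abs_le_D2[OF sp] elim(3) by linarith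
      qed (use st in auto)
      then have cnt: "Q * scaled_count n s t \<in> {(freq x - \<eta>') * (t - s) - \<epsilon> n * 2 * Q..(freq x + \<eta>') * (t - s) + \<epsilon> n * 2 * Q}"
        by (simp add: scaled_count_def Q_def mult_ac)
      define Y where "Y = \<eta> * (t - s) * Q / 2"
      have Y: "\<eta>' * (t - s) = Y" by (simp add: \<eta>'_def Y_def)
      have lo: "(freq x - \<eta>') * (t - s) = (t - s) * freq x - Y"
        and hi: "(freq x + \<eta>') * (t - s) = (t - s) * freq x + Y"
        unfolding Y[symmetric] by (simp_all add: algebra_simps)
      have "\<epsilon> n * 2 * Q \<le> Y"
        using mult_right_mono[OF elim(4), of Q] Q by (simp add: Y_def)
      then have "\<bar>Q * scaled_count n s t - (t - s) * freq x\<bar> \<le> 2 * Y"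
        using cnt unfolding lo hi by (simp add: abs_le_iff)
      then have "\<bar>Q * scaled_count n s t - (t - s) * freq x\<bar> \<le> \<eta> * (t - s) * Q"
        by (simp add: Y_def)
      moreover have "Q * scaled_count n s t - (t - s) * freq x = Q * (scaled_count n s t - (t - s) * zero_density x)"
        using Q by (simp add: dens right_diff_distrib)
      ultimately have "Q * \<bar>scaled_count n s t - (t - s) * zero_density x\<bar> \<le> Q * (\<eta> * (t - s))"
        using Q by (simp add: abs_mult mult_ac)
      then show ?case using Q by simp
    qed
  qed
  then show ?thesis using d1(1) d2(1) by (intro exI[of _ "min d1 d2"]) auto
qed

text \<open>
  By \<open>\<gamma> \<le> \<gamma> + \<kappa>\<close> the regularised clock at energy 0 runs at speed at most \<open>C / \<epsilon>\<close>, and \<open>\<kappa>\<close> is taken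
  so small that it needs at least \<open>\<epsilon> M / C\<close> from a zero to the next turning point.
\<close>
lemma density_zero_energy:
  assumes x: "x \<in> {0..1}" and Ex: "E x = 0" and \<eta>: "\<eta> > 0"
  shows "\<exists>d>0. \<forall>s t. 0 \<le> s \<and> s \<le> x \<and> x \<le> t \<and> t \<le> 1 \<and> t - s < d \<longrightarrow>
      (\<forall>\<^sub>F n in sequentially. \<bar>scaled_count n s t - (t - s) * zero_density x\<bar> \<le> \<eta> * (t - s))"
proof -
  define C where "C = freq x + 1"
  have C: "C > 0" using freq_pos[OF x] by (simp add: C_def)
  \<comment> \<open>The density of zeros is at most \<open>C / M = \<eta> / 2\<close>.\<close>
  define M where "M = 2 * C / \<eta>"
  have M: "M > 0" using C \<eta> by (simp add: M_def)
  obtain \<kappa> where \<kappa>: "\<kappa> > 0"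
    "M \<le> arc p (\<lambda>s. \<gamma> (R * s) + \<kappa>) 1 - arc p (\<lambda>s. \<gamma> (R * s) + \<kappa>) 0"
    "M \<le> arc p (\<lambda>s. \<gamma> (R * s) + \<kappa>) 0"
    using arc_divergence[of M] by blast
  define m where "m s = \<gamma> (R * s) + \<kappa>" for s
  have clock: "arc_clock p m" unfolding m_def[abs_def] using \<kappa> R_pos by (intro scaled_clock) auto
  have r0: "R = (W0 - E x) powr (1 / p)" by (simp add: R_def Ex)
  have h: "\<kappa> / 2 > 0" using \<kappa> by simp
  obtain d where d: "d > 0" "\<forall>\<^sub>F n in sequentially. \<forall>t\<in>{0..1}. \<bar>t - x\<bar> < d \<longrightarrow>
    \<bar>g (u n t) * freq t - freq x * \<gamma> (R * \<sigma>_seq n t)\<bar> \<le> \<kappa> / 2"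
    using speed_near[OF x h r0] by blast
  have "\<forall>\<^sub>F n in sequentially. \<bar>scaled_count n s t - (t - s) * zero_density x\<bar> \<le> \<eta> * (t - s)"
    if st: "0 \<le> s" "s \<le> x" "x \<le> t" "t \<le> 1" "t - s < d" for s t
  proof (cases "s = t")
    case True
    then show ?thesis by (simp add: scaled_count_def)
  next
    case False
    then have L: "t - s > 0" using st by simp
    have near: "y \<in> {0..1} \<and> \<bar>y - x\<bar> < d" if "y \<in> {s..t}" for y
      using that st by auto
    have L2: "\<eta> * (t - s) / 2 > 0" using \<eta> L by simp
    show ?thesis
      using d(2) eps_small[OF h, of K] eps_small[OF L2, of 1]
    proof eventually_elim
      case (elim n)
      interpret o: oscillator p W W' Cm1 C0 C1 W0 a a' "u n" "du n" "\<epsilon> n" K by (rule osc)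
      have \<sigma>: "o.\<sigma> y = \<sigma>_seq n y" for y by (simp add: o.\<sigma>_def D_eq \<sigma>_seq_def)
      have "scaled_count n s t \<le> \<epsilon> n + C / M * (t - s)"
        unfolding scaled_count_def
      proof (rule o.zero_count_slow[OF clock _ _ _ _ C M])
        fix y assume y: "y \<in> {s..t}"
        have sp: "\<bar>o.speed y - freq x * \<gamma> (R * o.\<sigma> y)\<bar> \<le> \<kappa> / 2"
          using elim(1) near[OF y] by (simp add: o.speed_def freq_def \<sigma>)
        have "o.speed y + \<epsilon> n * K \<le> freq x * \<gamma> (R * o.\<sigma> y) + \<kappa>"
          using abs_le_D1[OF sp] elim(2) by linarith
        also have "\<dots> \<le> C * m (o.\<sigma> y)"
          using \<kappa>(1) freq_pos[OF x] \<gamma>_nonneg[of "R * o.\<sigma> y"] by (simp add: C_def m_def algebra_simps)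
        finally show "o.speed y + \<epsilon> n * K \<le> C * m (o.\<sigma> y)" .
      qed (use st \<kappa> in \<open>auto simp: m_def[abs_def]\<close>)
      also have "C / M = \<eta> / 2" using C by (simp add: M_def)
      also have "\<epsilon> n + \<eta> / 2 * (t - s) \<le> \<eta> * (t - s) / 2 + \<eta> / 2 * (t - s)" using elim(3) by simp
      also have "\<dots> = \<eta> * (t - s)" by simp
      finally have "scaled_count n s t \<le> \<eta> * (t - s)" .
      moreover have "scaled_count n s t \<ge> 0" using o.eps by (simp add: scaled_count_def)
      ultimately show ?case by (simp add: zero_density_zero_energy[OF Ex])
    qed
  qed
  then show ?thesis using d(1) by blast
qed

lemma zero_count_limit:
  "(\<lambda>n. \<epsilon> n * real (card {x \<in> {0..1}. u n x = 0})) \<longlonglongrightarrow> integral {0..1} zero_density"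
proof -
  have fin: "finite {z \<in> {s<..t}. u n z = 0}" if "0 \<le> s" "t \<le> 1" for n s t
    by (rule finite_subset[OF _ oscillator.finite_zeros[OF osc[of n]]]) (use that in auto)
  have "(\<lambda>n. scaled_count n 0 1) \<longlonglongrightarrow> integral {0..1} zero_density"
  proof (rule interval_function_limit)
    fix n and r s t :: real assume le: "0 \<le> r" "r \<le> s" "s \<le> t" "t \<le> 1"
    have eq: "{z \<in> {r<..t}. u n z = 0} = {z \<in> {r<..s}. u n z = 0} \<union> {z \<in> {s<..t}. u n z = 0}"
      using le by auto
    have "card ({z \<in> {r<..s}. u n z = 0} \<union> {z \<in> {s<..t}. u n z = 0}) =
        card {z \<in> {r<..s}. u n z = 0} + card {z \<in> {s<..t}. u n z = 0}"
      by (rule card_Un_disjoint[OF fin fin]) (use le in auto)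
    then show "scaled_count n r t = scaled_count n r s + scaled_count n s t"
      unfolding scaled_count_def eq by (simp add: distrib_left)
  next
    fix x \<eta> :: real assume x: "x \<in> {0..1}" and \<eta>: "\<eta> > 0"
    show "\<exists>d>0. \<forall>s t. 0 \<le> s \<and> s \<le> x \<and> x \<le> t \<and> t \<le> 1 \<and> t - s < d \<longrightarrow>
      (\<forall>\<^sub>F n in sequentially. \<bar>scaled_count n s t - (t - s) * zero_density x\<bar> \<le> \<eta> * (t - s))"
      using density_pos_energy[OF x _ \<eta>] density_zero_energy[OF x _ \<eta>] E_nonneg[OF x]
      by (cases "E x = 0") auto
  qed
  moreover have "(\<lambda>n. \<epsilon> n * (if u n 0 = 0 then 1 else 0)) \<longlonglongrightarrow> 0"
  proof (rule Lim_null_comparison[OF _ eps_lim])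
    show "\<forall>\<^sub>F n in sequentially. norm (\<epsilon> n * (if u n 0 = 0 then 1 else 0)) \<le> \<epsilon> n"
      using eps_pos by (auto simp: less_imp_le)
  qed
  ultimately have "(\<lambda>n. scaled_count n 0 1 + \<epsilon> n * (if u n 0 = 0 then 1 else 0)) \<longlonglongrightarrow> integral {0..1} zero_density + 0"
    by (rule tendsto_add)
  moreover have "scaled_count n 0 1 + \<epsilon> n * (if u n 0 = 0 then 1 else 0) = \<epsilon> n * real (card {x \<in> {0..1}. u n x = 0})" for n
  proof -
    have eq: "{x \<in> {0..1}. u n x = 0} = {z \<in> {0<..1}. u n z = 0} \<union> (if u n 0 = 0 then {0} else {})"
      by (auto simp: less_le)
    have "card ({z \<in> {0<..1}. u n z = 0} \<union> (if u n 0 = 0 then {0} else {})) =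
        card {z \<in> {0<..1}. u n z = 0} + (if u n 0 = 0 then 1 else 0)"
      using fin[of 0 1 n] by auto
    then show ?thesis unfolding scaled_count_def eq by (simp add: distrib_left)
  qed
  ultimately show ?thesis by simp
qed

end

theorem proposition4p1:
  fixes p Cm1 C0 C1 W0 :: real
    and a W E :: "real \<Rightarrow> real"
    and \<epsilon> :: "nat \<Rightarrow> real"
    and u :: "nat \<Rightarrow> real \<Rightarrow> real"
  assumes "p > 1"
    and "C1_on {0..1} a" and "\<And>x. x \<in> {0..1} \<Longrightarrow> a x > 0"
    and "C1_on {- 1..1} W" and "W1 p W Cm1 C0 C1 W0" and "W2 p W"
    and "\<And>n. \<epsilon> n > 0" and "\<epsilon> \<longlonglongrightarrow> 0"
    and "\<And>n. is_solution p a W (\<epsilon> n) (u n)"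
    and nontrivial: "\<And>n. \<exists>x\<in>{0..1}. u n x \<noteq> 0"
    and "uniform_limit {0..1} (\<lambda>n. energy p a W (\<epsilon> n) (u n)) E sequentially"
  shows "(\<forall>n. finite {x \<in> {0..1}. u n x = 0}) \<and>
    (\<lambda>n. \<epsilon> n * real (card {x \<in> {0..1}. u n x = 0})) \<longlonglongrightarrow>
      integral {0..1}
        (\<lambda>x. real_of_ereal (ereal (2 * a x powr (1 / p)) / period p W C0 W0 (E x)))"
proof -
  have C1D: "(f has_real_derivative deriv_on S f x) (at x within S)" if "C1_on S f" "x \<in> S" for S f x
    using that unfolding C1_on_def differentiable_on_def deriv_on_def
    by (auto simp: has_real_derivative_iff_has_vector_derivative vector_derivative_works[symmetric])
  have C1C: "continuous_on S (deriv_on S f)" if "C1_on S f" for S f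
    using that by (simp add: C1_on_def)
  interpret potential p W "deriv_on {-1..1} W" Cm1 C0 C1 W0
    using assms(1,4,5,6) C1D C1C by unfold_locales (auto simp: W2_def)
  have "continuous_on {0..1} (\<lambda>x. \<bar>deriv_on {0..1} a x\<bar> / a x)"
    using assms(3) by (intro continuous_intros C1C[OF assms(2)] DERIV_continuous_on[OF C1D[OF assms(2)]])
      (auto simp: less_imp_neq[symmetric])
  from continuous_attains_sup[OF _ _ this]
  obtain x0 where x0: "\<forall>x\<in>{0..1}. \<bar>deriv_on {0..1} a x\<bar> / a x \<le> \<bar>deriv_on {0..1} a x0\<bar> / a x0"
    by auto
  \<comment> \<open>The maximum over \<open>[0, 1]\<close> of \<open>|a'/a|\<close>.\<close>
  define K where "K = \<bar>deriv_on {0..1} a x0\<bar> / a x0"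
  have K: "\<bar>deriv_on {0..1} a x\<bar> \<le> K * a x" if "x \<in> {0..1}" for x
    using bspec[OF x0 that] assms(3)[OF that] by (simp add: K_def divide_le_eq)
  have osc: "oscillator p W (deriv_on {-1..1} W) Cm1 C0 C1 W0 a (deriv_on {0..1} a)
      (u n) (deriv_on {0..1} (u n)) (\<epsilon> n) K" for n
  proof unfold_locales
    have sol: "is_solution p a W (\<epsilon> n) (u n)" by (rule assms(9))
    have Cu: "C1_on {0..1} (u n)" and Cv: "C1_on {0..1} (\<lambda>x. phi p (deriv_on {0..1} (u n) x))"
      using sol by (auto simp: is_solution_def)
    show "\<epsilon> n > 0" by (rule assms(7))
    show "\<exists>x\<in>{0..1}. u n x \<noteq> 0" by (rule nontrivial)
    show "continuous_on {0..1} (deriv_on {0..1} (u n))" by (rule C1C[OF Cu])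
    fix x :: real assume x: "x \<in> {0..1}"
    show "0 < a x" by (rule assms(3)[OF x])
    show "(a has_real_derivative deriv_on {0..1} a x) (at x within {0..1})" by (rule C1D[OF assms(2) x])
    show "\<bar>deriv_on {0..1} a x\<bar> \<le> K * a x" by (rule K[OF x])
    show "(u n has_real_derivative deriv_on {0..1} (u n) x) (at x within {0..1})" by (rule C1D[OF Cu x])
    show "u n x \<in> {-1..1}" using sol x by (auto simp: is_solution_def)
    define v where "v = (\<lambda>y. phi p (\<epsilon> n * deriv_on {0..1} (u n) y))"
    \<comment> \<open>The hypotheses make \<open>\<phi>\<^sub>p(u')\<close> differentiable; homogeneity carries this over to \<open>\<phi>\<^sub>p(\<epsilon> u')\<close>.\<close>
    have veq: "v = (\<lambda>y. \<epsilon> n powr (p - 1) * phi p (deriv_on {0..1} (u n) y))"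
      unfolding v_def using assms(7)[of n] by (simp add: phi_mult)
    have "(v has_real_derivative \<epsilon> n powr (p - 1) * deriv_on {0..1} (\<lambda>y. phi p (deriv_on {0..1} (u n) y)) x) (at x within {0..1})"
      unfolding veq by (rule DERIV_cmult[OF C1D[OF Cv x]])
    then have "(v has_vector_derivative deriv_on {0..1} v x) (at x within {0..1})"
      unfolding deriv_on_def has_real_derivative_iff_has_vector_derivative
      by (simp add: vector_derivative_works[symmetric] differentiableI_vector)
    moreover have "- \<epsilon> n * deriv_on {0..1} v x + a x * deriv_on {-1..1} W (u n x) = 0"
      using sol x unfolding is_solution_def v_def by blast
    then have "deriv_on {0..1} v x = a x * deriv_on {-1..1} W (u n x) / \<epsilon> n"
      using assms(7)[of n] by (simp add: field_simps)
    ultimately show "((\<lambda>x. phi p (\<epsilon> n * deriv_on {0..1} (u n) x)) has_real_derivative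
        a x * deriv_on {-1..1} W (u n x) / \<epsilon> n) (at x within {0..1})"
      by (simp add: has_real_derivative_iff_has_vector_derivative v_def)
  qed
  interpret oscillator_family p W "deriv_on {-1..1} W" Cm1 C0 C1 W0 a "deriv_on {0..1} a"
      u "\<lambda>n. deriv_on {0..1} (u n)" \<epsilon> K E
  proof (intro oscillator_family.intro oscillator_family_axioms.intro)
    show "uniform_limit {0..1} (\<lambda>n x. W (u n x) - \<bar>\<epsilon> n * deriv_on {0..1} (u n) x\<bar> powr p / (conj_exp p * a x)) E sequentially"
    proof -
      have "(\<lambda>n. energy p a W (\<epsilon> n) (u n)) =
          (\<lambda>n x. W (u n x) - \<bar>\<epsilon> n * deriv_on {0..1} (u n) x\<bar> powr p / (conj_exp p * a x))"
        by (intro ext) (simp add: energy_def kinetic_def mult.commute)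
      then show ?thesis using assms(11) by simp
    qed
  qed (fact potential_axioms osc assms(8))+
  show ?thesis
    using zero_count_limit oscillator.finite_zeros[OF osc] by (simp add: zero_density_def[abs_def])
qed

end
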